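(* Let $g\geq 3$ be an integer, let $K$ be an integer sufficiently large in terms of $g$, and let $M$ be an integer with $M\in(g^{K-1},g^K]$. Let $k_1,k_2,k_3\in\mathbb{N}$ satisfy: $|k_i-\mu_K|\leq C_g$ for $i=1,2,3$; $k_1+k_2+k_3\equiv M\pmod{g-1}$; $\gcd(k_i,g)=1$ for $i=1,2,3$; and $\gcd(k_i,k_j)=1$ for $i\neq j$. For $i=1,2,3$ let $S_i=\{n<g^K: s_g(n)=k_i\}$ and $\mathcal{N}_i=\{n\in S_i: k_i\mid n\}$. Let $r_{S_1+S_2+S_3}(M)$ (resp. $r_{\mathcal{N}_1+\mathcal{N}_2+\mathcal{N}_3}(M)$) be the number of triples in $S_1\times S_2\times S_3$ (resp. $\mathcal{N}_1\times\mathcal{N}_2\times\mathcal{N}_3$) summing to $M$. Let \[c_g(k_1,k_2,k_3)=\frac{4}{(g-1)^2}\prod_{i=1}^3\gcd(g-1,k_i).\] Then \[r_{\mathcal{N}_1+\mathcal{N}_2+\mathcal{N}_3}(M)=\frac{(g-1)^2c_g(k_1,k_2,k_3)}{4k_1k_2k_3}\,r_{S_1+S_2+S_3}(M)+O_g(M^2K^{-29/6}),\] and in particular \[r_{\mathcal{N}_1+\mathcal{N}_2+\mathcal{N}_3}(M)=c_g(k_1,k_2,k_3)\frac{M^2}{(2\pi\sigma^2)^{3/2}K^{9/2}}+O_g(M^2(\log K)^4K^{-19/4}),\] where $\sigma^2=(g^2-1)/12$.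
   Context: $s_g(n)$ denotes the sum of the base-$g$ digits of $n$. $\mu_K=(g-1)K/2$. $C_g=g(g-1)\prod_{p\leq 10g^2}p$, the product being over primes. $O_g(\cdot)$ denotes a term bounded in absolute value by a constant depending only on $g$ times the given quantity. *)

theory Defs
  imports Complex_Main "HOL-Computational_Algebra.Primes" "HOL-Number_Theory.Cong"
begin

text \<open>The base-\<open>g\<close> digits of \<open>n\<close> are \<open>n div g ^ i mod g\<close>; positions with \<open>g ^ i > n\<close> carry
  only leading zeros. The index set is finite for \<open>g \<ge> 2\<close>, and the definition is meaningful only
  for such \<open>g\<close>.\<close>

definition digit_sum :: "nat \<Rightarrow> nat \<Rightarrow> nat" where
  "digit_sum g n = (\<Sum>i | g ^ i \<le> n. n div g ^ i mod g)"

definition digit_mean :: "nat \<Rightarrow> nat \<Rightarrow> real" where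
  "digit_mean g K = (real g - 1) * real K / 2"

definition digit_var :: "nat \<Rightarrow> real" where
  "digit_var g = ((real g)\<^sup>2 - 1) / 12"

definition C_const :: "nat \<Rightarrow> nat" where
  "C_const g = g * (g - 1) * (\<Prod>p | prime p \<and> p \<le> 10 * g\<^sup>2. p)"

definition digit_set :: "nat \<Rightarrow> nat \<Rightarrow> nat \<Rightarrow> nat set" where
  "digit_set g K k = {n. n < g ^ K \<and> digit_sum g n = k}"

definition niven_set :: "nat \<Rightarrow> nat \<Rightarrow> nat \<Rightarrow> nat set" where
  "niven_set g K k = {n \<in> digit_set g K k. k dvd n}"

definition rep3 :: "nat set \<Rightarrow> nat set \<Rightarrow> nat set \<Rightarrow> nat \<Rightarrow> nat" where
  "rep3 A B C M = card {(a, b, c). a \<in> A \<and> b \<in> B \<and> c \<in> C \<and> a + b + c = M}"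

definition c_const :: "nat \<Rightarrow> nat \<Rightarrow> nat \<Rightarrow> nat \<Rightarrow> real" where
  "c_const g k1 k2 k3 =
     4 / (real g - 1)\<^sup>2 * real (gcd (g - 1) k1 * gcd (g - 1) k2 * gcd (g - 1) k3)"

end

theory Submission
  imports Defs "HOL-Probability.Probability" "HOL-Real_Asymp.Real_Asymp"
begin

text \<open>
  Detecting \<open>k\<^sub>i | n\<^sub>i\<close> with additive characters turns the left-hand side into an average, over
  frequencies \<open>l\<^sub>i / k\<^sub>i\<close>, of twisted counts of triples of integers with the prescribed digit sums.
  If all \<open>(g - 1) l\<^sub>i / k\<^sub>i\<close> are integers, the twist is trivial because \<open>n \<equiv> s\<^sub>g(n) (mod g - 1)\<close>,
  and these terms give the main term exactly. Otherwise, by coprimality, some difference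
  \<open>(g - 1) (l\<^sub>i / k\<^sub>i - l\<^sub>j / k\<^sub>j) g\<^sup>r\<close> is never an integer and is repeatedly far from the integers as
  \<open>r\<close> varies. Since exponential sums over digit sums factor over the digits, at every point of the
  circle one of the two exponential sums involved is then very small, and the circle method for
  three summands shows that the term is negligible.

  For the asymptotics of the untwisted count, the digit sums are detected by characters as well.
  Adding three numbers digit by digit from the bottom, the three digits at each position are pairwise
  independent and uniformly distributed whatever the carry is. Hence each position multiplies the
  characteristic function by \<open>1 - 2 \<pi>\<^sup>2 \<sigma>\<^sup>2 |\<beta>|\<^sup>2 + O(|\<beta>|\<^sup>3)\<close> up to a phase, uniformly in the carry,
  which yields the Gaussian approximation near the origin; away from the origin the circle method
  bound applies again.
\<close>

section \<open>Additive characters\<close>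

text \<open>At digit place j an exponential sum sees only the combination a + t g^j of a digit-sum
  frequency a and a circle frequency t, and bounds uniform in one of the two are needed. Linear
  combinations of phases eliminate it: place j+1 minus place j leaves (g-1) t g^j; g times place j
  minus place j+1 leaves (g-1) a; the same place in two sums leaves a - a'. This is the source of
  the factor g-1, and the reason why the frequencies with (g-1) l/k integral are singled out. At
  every point of the circle one factor is bounded pointwise and Parseval handles the other two, so
  no logarithm is lost and the twisted terms are at most of order M^2 exp(-c sqrt K). The carry
  recursion cannot run through the leading digits, where M itself restricts the summands; about
  K^(1/24) top digits are counted trivially instead, which produces the factor M^2/2. The error
  K^(-7/4) for the normalised untwisted count is decided by the cubic remainder of the
  characteristic function, accumulated over K digits and integrated over a box of side
  K^(-11/24).\<close>

definition ee :: "real \<Rightarrow> complex" where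
  "ee x = cis (2 * pi * x)"

lemma ee_add: "ee (x + y) = ee x * ee y"
  by (simp add: ee_def cis_mult algebra_simps)

lemma ee_0 [simp]: "ee 0 = 1"
  by (simp add: ee_def)

lemma norm_ee [simp]: "norm (ee x) = 1"
  by (simp add: ee_def)

lemma ee_minus: "ee (- x) = cnj (ee x)"
  by (simp add: ee_def cis_cnj)

lemma ee_Ints: "x \<in> \<int> \<Longrightarrow> ee x = 1"
  by (simp add: ee_def)

lemma ee_eq_1_imp_Ints: "ee x = 1 \<Longrightarrow> x \<in> \<int>"
proof -
  assume "ee x = 1"
  hence "cos (2 * pi * x) = 1"
    by (simp add: ee_def complex_eq_iff)
  then obtain n :: int where "2 * pi * x = of_int n * 2 * pi"
    using cos_one_2pi_int by auto
  hence "x = of_int n" by simp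
  thus ?thesis by simp
qed

lemma ee_power: "ee x ^ n = ee (real n * x)"
  unfolding ee_def Complex.DeMoivre by (simp add: mult_ac)

lemma norm_ee_diff_le: "norm (ee x - ee y) \<le> 2 * pi * \<bar>x - y\<bar>"
proof -
  have "ee x - ee y = ee y * (ee (x - y) - 1)"
    using ee_add[of y "x - y"] by (simp add: algebra_simps)
  hence "norm (ee x - ee y) = norm (ee (x - y) - 1)"
    by (simp add: norm_mult)
  also have "\<dots> \<le> \<bar>2 * pi * (x - y)\<bar>"
    using iexp_approx1[of "2 * pi * (x - y)" 0] by (simp add: ee_def cis_conv_exp)
  finally show ?thesis by (simp add: abs_mult)
qed

lemma sum_ee_orthogonal:
  fixes N :: nat and m :: int
  assumes "N > 0"
  shows "(\<Sum>t<N. ee (real t * (of_int m / real N))) = (if int N dvd m then of_nat N else 0)"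
proof (cases "int N dvd m")
  case True
  then obtain q where q: "m = int N * q" by blast
  have "ee (real t * (of_int m / real N)) = 1" for t
    using assms by (intro ee_Ints) (simp add: q)
  thus ?thesis using True by simp
next
  case False
  define z where "z = ee (of_int m / real N)"
  have "z \<noteq> 1"
  proof
    assume "z = 1"
    then obtain q :: int where "of_int m / real N = of_int q"
      using ee_eq_1_imp_Ints Ints_cases unfolding z_def by metis
    hence "real_of_int m = real_of_int (int N * q)"
      using assms by (simp add: field_simps)
    hence "m = int N * q" by linarith
    with False show False by simp
  qed
  moreover have "z ^ N = 1"
    unfolding z_def ee_power using assms by (intro ee_Ints) simp
  ultimately have "(\<Sum>t<N. z ^ t) = 0"
    by (simp add: sum_gp_strict)
  thus ?thesis using False by (simp add: z_def ee_power)
qed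

text \<open>Centring the frequencies at 0 puts every b/(2R+1) between -1/2 and 1/2, where closeness
  to the origin can be read off from the absolute value. The bound on m makes 0 the only possible
  multiple of 2R+1.\<close>

lemma sum_ee_orthogonal_symmetric:
  fixes R :: nat and m :: int
  assumes "\<bar>m\<bar> \<le> 2 * int R"
  shows "(\<Sum>b\<in>{-int R..int R}. ee (of_int b * of_int m / real (2 * R + 1)))
           = (if m = 0 then of_nat (2 * R + 1) else 0)"
proof -
  let ?Q = "2 * R + 1"
  have "(\<Sum>b\<in>{-int R..int R}. ee (of_int b * of_int m / real ?Q))
      = (\<Sum>t<?Q. ee (of_int (int t - int R) * of_int m / real ?Q))"
    by (rule sum.reindex_bij_witness[of _ "\<lambda>t. int t - int R" "\<lambda>b. nat (b + int R)"]) auto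
  also have "\<dots> = (\<Sum>t<?Q. ee (- (real R * of_int m / real ?Q)) * ee (real t * (of_int m / real ?Q)))"
  proof (rule sum.cong[OF refl])
    fix t :: nat
    have "of_int (int t - int R) * of_int m / real ?Q
            = - (real R * of_int m / real ?Q) + real t * (of_int m / real ?Q)"
      by (simp add: diff_divide_distrib algebra_simps)
    thus "ee (of_int (int t - int R) * of_int m / real ?Q)
            = ee (- (real R * of_int m / real ?Q)) * ee (real t * (of_int m / real ?Q))"
      by (simp only: ee_add)
  qed
  also have "\<dots> = ee (- (real R * of_int m / real ?Q)) * (if int ?Q dvd m then of_nat ?Q else 0)"
    by (simp only: sum_distrib_left[symmetric] sum_ee_orthogonal)
  also have "\<dots> = (if m = 0 then of_nat ?Q else 0)"
  proof (cases "m = 0")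
    case False
    hence "\<not> int ?Q dvd m"
      using assms zdvd_imp_le[of "int ?Q" "\<bar>m\<bar>"] by auto
    thus ?thesis using False by simp
  qed simp
  finally show ?thesis .
qed

section \<open>Digit sums\<close>

lemma digit_sum_upto:
  assumes "g \<ge> 2" "n < g ^ D"
  shows "digit_sum g n = (\<Sum>i<D. n div g ^ i mod g)"
  unfolding digit_sum_def
proof (rule sum.mono_neutral_left)
  show "{i. g ^ i \<le> n} \<subseteq> {..<D}"
  proof
    fix i assume "i \<in> {i. g ^ i \<le> n}"
    hence "g ^ i < g ^ D" using assms by (simp only: mem_Collect_eq)
    thus "i \<in> {..<D}" using assms power_less_imp_less_exp[of g i D] by simp
  qed
qed auto

lemma less_power_self:
  assumes "g \<ge> (2::nat)"
  shows "n < g ^ n"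
  using assms by (intro less_le_trans[OF less_exp power_mono]) auto

lemma digit_sum_step:
  assumes "g \<ge> 2" "d < g"
  shows "digit_sum g (d + g * n) = d + digit_sum g n"
proof -
  have n: "n < g ^ n" using assms less_power_self by blast
  have "d + g * n < g * (n + 1)" using assms by simp
  also have "\<dots> \<le> g * g ^ n" using n by (intro mult_le_mono2) simp
  finally have *: "d + g * n < g ^ Suc n" by simp
  have "digit_sum g (d + g * n) = (\<Sum>i<Suc n. (d + g * n) div g ^ i mod g)"
    by (rule digit_sum_upto[OF assms(1) *])
  also have "\<dots> = (d + g * n) mod g + (\<Sum>i<n. (d + g * n) div g ^ Suc i mod g)"
    by (simp add: sum.lessThan_Suc_shift del: power_Suc sum.lessThan_Suc)
  also have "\<dots> = d + (\<Sum>i<n. n div g ^ i mod g)"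
    using assms by (simp add: div_mult2_eq)
  finally show ?thesis using digit_sum_upto[OF assms(1) n] by simp
qed

lemma digit_sum_0 [simp]: "g \<ge> 2 \<Longrightarrow> digit_sum g 0 = 0"
  using digit_sum_upto[of g 0 0] by simp

lemma digit_sum_cong_self:
  assumes "g \<ge> 2"
  shows "[int (digit_sum g n) = int n] (mod (int g - 1))"
proof (induction n rule: less_induct)
  case (less n)
  show ?case
  proof (cases "n = 0")
    case False
    define q d where "q = n div g" and "d = n mod g"
    have n: "n = d + g * q" by (simp add: q_def d_def)
    have d: "d < g" using assms by (simp add: d_def)
    have "q < n" using False assms by (simp add: q_def)
    hence "[int (digit_sum g q) = int q] (mod (int g - 1))" by (rule less)
    hence "int g - 1 dvd int (digit_sum g q) - int q" by (simp add: cong_iff_dvd_diff)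
    hence "int g - 1 dvd (int (digit_sum g q) - int q) - (int g - 1) * int q"
      by (rule dvd_diff) simp
    also have "\<dots> = int (digit_sum g n) - int n"
      unfolding n digit_sum_step[OF assms d] by (simp add: algebra_simps)
    finally show ?thesis by (simp add: cong_iff_dvd_diff)
  qed (use assms in simp)
qed

lemma digit_sum_le:
  assumes "g \<ge> 2" "n < g ^ D"
  shows "digit_sum g n \<le> (g - 1) * D"
proof -
  have "digit_sum g n = (\<Sum>i<D. n div g ^ i mod g)" by (rule digit_sum_upto[OF assms])
  also have "\<dots> \<le> (\<Sum>i<D. g - 1)"
  proof (rule sum_mono)
    fix i
    have "n div g ^ i mod g < g" using assms by simp
    thus "n div g ^ i mod g \<le> g - 1" by simp
  qed
  finally show ?thesis by (simp add: mult.commute)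
qed

lemma sum_split_last_digit:
  fixes f :: "nat \<Rightarrow> 'a :: comm_monoid_add"
  shows "(\<Sum>n<g ^ Suc D. f n) = (\<Sum>d<g. \<Sum>n<g ^ D. f (d + g * n))"
proof -
  have "(\<Sum>n<g ^ Suc D. f n) = (\<Sum>m<g ^ D. sum f {m * g..<m * g + g})"
    by (simp add: sum.nat_group mult.commute)
  also have "\<dots> = (\<Sum>m<g ^ D. \<Sum>d<g. f (d + g * m))"
  proof (rule sum.cong[OF refl])
    fix m
    show "sum f {m * g..<m * g + g} = (\<Sum>d<g. f (d + g * m))"
      by (rule sum.reindex_bij_witness[of _ "\<lambda>d. d + g * m" "\<lambda>n. n - g * m"])
         (auto simp: mult.commute)
  qed
  also have "\<dots> = (\<Sum>d<g. \<Sum>n<g ^ D. f (d + g * n))" by (rule sum.swap)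
  finally show ?thesis .
qed

text \<open>Peeling off the lowest digit d gives the factor e(d (a + t)) and turns t into t g for
  the remaining digits, hence the induction with t arbitrary.\<close>

lemma sum_ee_digit_sum:
  assumes "g \<ge> 2"
  shows "(\<Sum>n<g ^ D. ee (a * real (digit_sum g n) + t * real n))
           = (\<Prod>j<D. \<Sum>d<g. ee (real d * (a + t * real g ^ j)))"
proof (induction D arbitrary: t)
  case (Suc D)
  have "(\<Sum>n<g ^ Suc D. ee (a * real (digit_sum g n) + t * real n))
      = (\<Sum>d<g. \<Sum>n<g ^ D. ee (a * real (digit_sum g (d + g * n)) + t * real (d + g * n)))"
    by (rule sum_split_last_digit)
  also have "\<dots> = (\<Sum>d<g. \<Sum>n<g ^ D. ee (real d * (a + t)) *
                     ee (a * real (digit_sum g n) + (t * real g) * real n))"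
  proof (intro sum.cong refl)
    fix d n assume "d \<in> {..<g}"
    hence "digit_sum g (d + g * n) = d + digit_sum g n"
      by (intro digit_sum_step assms) simp
    thus "ee (a * real (digit_sum g (d + g * n)) + t * real (d + g * n)) =
          ee (real d * (a + t)) * ee (a * real (digit_sum g n) + (t * real g) * real n)"
      by (simp add: ee_add[symmetric] algebra_simps)
  qed
  also have "\<dots> = (\<Sum>d<g. ee (real d * (a + t))) *
                     (\<Sum>n<g ^ D. ee (a * real (digit_sum g n) + (t * real g) * real n))"
    by (simp add: sum_product)
  also have "\<dots> = (\<Sum>d<g. ee (real d * (a + t))) *
                   (\<Prod>j<D. \<Sum>d<g. ee (real d * (a + (t * real g) * real g ^ j)))"
    by (simp only: Suc.IH)
  also have "\<dots> = (\<Prod>j<Suc D. \<Sum>d<g. ee (real d * (a + t * real g ^ j)))"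
    by (simp add: prod.lessThan_Suc_shift mult.assoc del: prod.lessThan_Suc)
  finally show ?case .
qed (use assms in simp)

section \<open>Squared sines as a substitute for the distance to the nearest integer\<close>

text \<open>Comparable to the squared distance to the nearest integer, but periodic without choosing
  an integer. It is subadditive up to a factor 2 and grows at most quadratically under integer
  multiples, which suits sums over digit places.\<close>

definition sin2 :: "real \<Rightarrow> real" where
  "sin2 x = (sin (pi * x))\<^sup>2"

lemma sin2_nonneg [simp]: "sin2 x \<ge> 0"
  by (simp add: sin2_def)

lemma sin2_minus [simp]: "sin2 (- x) = sin2 x"
  by (simp add: sin2_def)

lemma abs_sin_add_le: "\<bar>sin (x + y)\<bar> \<le> \<bar>sin x\<bar> + \<bar>sin (y::real)\<bar>"
proof -
  have "\<bar>sin (x + y)\<bar> \<le> \<bar>sin x\<bar> * \<bar>cos y\<bar> + \<bar>cos x\<bar> * \<bar>sin y\<bar>"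
    unfolding sin_add using abs_triangle_ineq[of "sin x * cos y" "cos x * sin y"]
    by (simp add: abs_mult)
  also have "\<dots> \<le> \<bar>sin x\<bar> * 1 + 1 * \<bar>sin y\<bar>"
    by (intro add_mono mult_mono) auto
  finally show ?thesis by simp
qed

lemma abs_sin_of_nat_mult_le: "\<bar>sin (real n * x)\<bar> \<le> real n * \<bar>sin x\<bar>"
proof (induction n)
  case (Suc n)
  have "\<bar>sin (real (Suc n) * x)\<bar> \<le> \<bar>sin (real n * x)\<bar> + \<bar>sin x\<bar>"
    using abs_sin_add_le[of "real n * x" x] by (simp add: algebra_simps)
  with Suc show ?case by (simp add: algebra_simps)
qed simp

lemma sin2_add_le: "sin2 (x + y) \<le> 2 * sin2 x + 2 * sin2 y"
proof -
  have "sin2 (x + y) = \<bar>sin (pi * x + pi * y)\<bar>\<^sup>2" by (simp add: sin2_def algebra_simps)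
  also have "\<dots> \<le> (\<bar>sin (pi * x)\<bar> + \<bar>sin (pi * y)\<bar>)\<^sup>2"
    by (intro power_mono abs_sin_add_le) auto
  also have "\<dots> \<le> 2 * \<bar>sin (pi * x)\<bar>\<^sup>2 + 2 * \<bar>sin (pi * y)\<bar>\<^sup>2"
    using zero_le_power2[of "\<bar>sin (pi * x)\<bar> - \<bar>sin (pi * y)\<bar>"]
    by (simp add: power2_eq_square algebra_simps)
  finally show ?thesis by (simp add: sin2_def)
qed

lemma sin2_diff_le: "sin2 (x - y) \<le> 2 * sin2 x + 2 * sin2 y"
  using sin2_add_le[of x "- y"] by simp

lemma sin2_of_nat_mult_le: "sin2 (real n * x) \<le> (real n)\<^sup>2 * sin2 x"
proof -
  have "sin2 (real n * x) = \<bar>sin (real n * (pi * x))\<bar>\<^sup>2" by (simp add: sin2_def mult_ac)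
  also have "\<dots> \<le> (real n * \<bar>sin (pi * x)\<bar>)\<^sup>2"
    by (intro power_mono abs_sin_of_nat_mult_le) auto
  finally show ?thesis by (simp add: sin2_def power_mult_distrib)
qed

text \<open>By concavity on the first quarter period the sine lies above its chord (Jordan's
  inequality).\<close>

lemma abs_sin_pi_ge:
  assumes "\<bar>x\<bar> \<le> 1 / 2"
  shows "\<bar>sin (pi * x)\<bar> \<ge> 2 * \<bar>x\<bar>"
proof -
  have conc: "concave_on {0..pi/2} (sin :: real \<Rightarrow> real)"
    unfolding concave_on_def
  proof (rule f''_ge0_imp_convex)
    show "((\<lambda>x. - sin x) has_real_derivative - cos x) (at x)" for x :: real
      by (auto intro!: derivative_eq_intros)
    show "((\<lambda>x. - cos x) has_real_derivative sin x) (at x)" for x :: real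
      by (auto intro!: derivative_eq_intros)
    show "x \<in> {0..pi / 2} \<Longrightarrow> sin x \<ge> 0" for x :: real
      by (auto intro: sin_ge_zero)
  qed auto
  define y where "y = \<bar>x\<bar>"
  have y: "0 \<le> y" "y \<le> 1/2" using assms by (auto simp: y_def)
  have "sin ((1 - 2 * y) *\<^sub>R 0 + (2 * y) *\<^sub>R (pi/2)) \<ge> (1 - 2 * y) * sin 0 + (2 * y) * sin (pi/2)"
    by (rule concave_onD[OF conc]) (use y in auto)
  hence *: "sin (pi * y) \<ge> 2 * y" by (simp add: mult.commute)
  have "\<bar>sin (pi * x)\<bar> = \<bar>sin (pi * y)\<bar>"
    unfolding y_def by (cases "x \<ge> 0") auto
  thus ?thesis using * y_def by linarith
qed

lemma sin2_ge:
  assumes "\<bar>x\<bar> \<le> 1 / 2"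
  shows "sin2 x \<ge> 4 * x\<^sup>2"
proof -
  have "(2 * \<bar>x\<bar>)\<^sup>2 \<le> \<bar>sin (pi * x)\<bar>\<^sup>2"
    by (intro power_mono abs_sin_pi_ge assms) auto
  thus ?thesis by (simp add: sin2_def power_mult_distrib)
qed

text \<open>Only the digits 0 and 1 are exploited, the other g-2 terms being bounded by 1: already
  |1 + e(x)| = 2 |cos(pi x)| \<le> 1 + cos(pi x)^2 = 2 - sin2 x saves \<open>sin2 x\<close> out of
  g.\<close>

lemma norm_sum_ee_digits_le:
  assumes "g \<ge> 2"
  shows "norm (\<Sum>d<g. ee (real d * x)) \<le> real g * exp (- (sin2 x / real g))"
proof -
  obtain h where h: "g = Suc (Suc h)" using assms that[of "g - 2"] by simp
  have "1 + ee x = ee (x / 2) * (ee (- (x / 2)) + ee (x / 2))"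
    using ee_add[of "x/2" "-(x/2)"] ee_add[of "x/2" "x/2"] by (simp add: algebra_simps)
  also have "ee (- (x / 2)) + ee (x / 2) = complex_of_real (2 * cos (pi * x))"
    by (simp add: ee_def complex_eq_iff)
  finally have "norm (1 + ee x) = 2 * \<bar>cos (pi * x)\<bar>" by (simp add: norm_mult)
  also have "\<dots> \<le> 2 - sin2 x"
  proof -
    have "(\<bar>cos (pi * x)\<bar> - 1)\<^sup>2 \<ge> 0" by simp
    hence "2 * \<bar>cos (pi * x)\<bar> \<le> 1 + (cos (pi * x))\<^sup>2" by (simp add: power2_diff)
    thus ?thesis by (simp add: sin2_def cos_squared_eq)
  qed
  finally have *: "norm (1 + ee x) \<le> 2 - sin2 x" .
  have "(\<Sum>d<g. ee (real d * x)) = (1 + ee x) + (\<Sum>d<h. ee (real (Suc (Suc d)) * x))"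
    unfolding h by (simp add: sum.lessThan_Suc_shift del: sum.lessThan_Suc)
  also have "norm \<dots> \<le> (2 - sin2 x) + (\<Sum>d<h. 1)"
    by (intro norm_triangle_le add_mono * sum_norm_le) simp
  also have "\<dots> = real g * (1 + (- (sin2 x / real g)))"
    using assms by (simp only: h) (simp add: right_diff_distrib)
  also have "\<dots> \<le> real g * exp (- (sin2 x / real g))"
    by (intro mult_left_mono exp_ge_add_one_self) auto
  finally show ?thesis .
qed

lemma norm_sum_ee_digit_sum_le:
  assumes "g \<ge> 2"
  shows "norm (\<Sum>n<g ^ D. ee (a * real (digit_sum g n) + t * real n))
           \<le> real g ^ D * exp (- ((\<Sum>j<D. sin2 (a + t * real g ^ j)) / real g))"
proof -
  have "norm (\<Sum>n<g ^ D. ee (a * real (digit_sum g n) + t * real n))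
      = (\<Prod>j<D. norm (\<Sum>d<g. ee (real d * (a + t * real g ^ j))))"
    by (simp add: sum_ee_digit_sum[OF assms] prod_norm)
  also have "\<dots> \<le> (\<Prod>j<D. real g * exp (- (sin2 (a + t * real g ^ j) / real g)))"
    by (intro prod_mono conjI norm_sum_ee_digits_le assms) auto
  also have "\<dots> = real g ^ D * exp (- ((\<Sum>j<D. sin2 (a + t * real g ^ j)) / real g))"
    by (simp add: prod.distrib exp_sum[symmetric] sum_negf sum_divide_distrib)
  finally show ?thesis .
qed

section \<open>The circle method bound for three summands\<close>

definition triples :: "nat \<Rightarrow> (nat \<times> nat \<times> nat) set" where
  "triples M = {(a, b, c). a + b + c = M}"

lemma triples_subset:
  assumes "M < X"
  shows "triples M \<subseteq> {..<X} \<times> {..<X} \<times> {..<X}"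
  using assms by (auto simp: triples_def)

lemma finite_triples [simp]: "finite (triples M)"
  using triples_subset[of M "Suc M"] by (rule finite_subset) auto

text \<open>Parseval on the N-th roots of unity; X \<le> N ensures that distinct indices below X are
  distinct modulo N.\<close>

lemma sum_norm_squared_ee:
  fixes f :: "nat \<Rightarrow> complex"
  assumes "X \<le> N" "N > 0"
  shows "(\<Sum>t<N. (norm (\<Sum>n<X. f n * ee (real n * (real t / real N))))\<^sup>2)
           = real N * (\<Sum>n<X. (norm (f n))\<^sup>2)"
proof -
  let ?F = "\<lambda>t. \<Sum>n<X. f n * ee (real n * (real t / real N))"
  have "complex_of_real (\<Sum>t<N. (norm (?F t))\<^sup>2) = (\<Sum>t<N. ?F t * cnj (?F t))"
    by (simp only: of_real_sum complex_norm_square)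
  also have "\<dots> = (\<Sum>t<N. \<Sum>n<X. \<Sum>m<X. f n * cnj (f m) *
                     ee (real t * (of_int (int n - int m) / real N)))"
  proof (rule sum.cong[OF refl])
    fix t
    have "?F t * cnj (?F t) = (\<Sum>n<X. \<Sum>m<X. (f n * ee (real n * (real t / real N))) *
             (cnj (f m) * ee (- (real m * (real t / real N)))))"
      by (simp add: sum_product ee_minus)
    also have "\<dots> = (\<Sum>n<X. \<Sum>m<X. f n * cnj (f m) *
             ee (real t * (of_int (int n - int m) / real N)))"
    proof (intro sum.cong refl)
      fix n m
      have "real n * (real t / real N) + - (real m * (real t / real N))
          = real t * (of_int (int n - int m) / real N)"
        by (simp add: diff_divide_distrib algebra_simps)
      from arg_cong[OF this, of ee]
      show "(f n * ee (real n * (real t / real N))) * (cnj (f m) * ee (- (real m * (real t / real N))))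
          = f n * cnj (f m) * ee (real t * (of_int (int n - int m) / real N))"
        unfolding ee_add by (simp add: mult_ac)
    qed
    finally show "?F t * cnj (?F t) = \<dots>" .
  qed
  also have "\<dots> = (\<Sum>n<X. \<Sum>m<X. f n * cnj (f m) *
                     (\<Sum>t<N. ee (real t * (of_int (int n - int m) / real N))))"
    unfolding sum_distrib_left
    by (rule trans[OF sum.swap], rule sum.cong[OF refl], rule sum.swap)
  also have "\<dots> = (\<Sum>n<X. \<Sum>m<X. if m = n then f n * cnj (f m) * of_nat N else 0)"
  proof (intro sum.cong refl)
    fix n m assume nm: "n \<in> {..<X}" "m \<in> {..<X}"
    have "int N dvd int n - int m \<longleftrightarrow> m = n"
    proof
      assume "int N dvd int n - int m"
      hence "n mod N = m mod N"
        by (metis mod_eq_dvd_iff of_nat_eq_iff zmod_int)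
      thus "m = n" using nm assms by simp
    qed simp
    thus "f n * cnj (f m) * (\<Sum>t<N. ee (real t * (of_int (int n - int m) / real N)))
        = (if m = n then f n * cnj (f m) * of_nat N else 0)"
      using sum_ee_orthogonal[OF assms(2), of "int n - int m"] by simp
  qed
  also have "\<dots> = (\<Sum>n<X. f n * cnj (f n) * of_nat N)"
    by simp
  also have "\<dots> = complex_of_real (real N * (\<Sum>n<X. (norm (f n))\<^sup>2))"
    by (simp add: complex_norm_square[symmetric] sum_distrib_left mult.commute)
  finally show ?thesis using of_real_eq_iff by blast
qed

text \<open>The modulus 3X is large enough for the discrete circle to detect equality: a+b+c and M
  are both below 3X, so congruence modulo 3X means a+b+c = M.\<close>

lemma sum_triples_eq:
  fixes f1 f2 f3 :: "nat \<Rightarrow> complex"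
  assumes "M < X"
  defines "F \<equiv> (\<lambda>f t. \<Sum>n<X. f n * ee (real n * (real t / real (3 * X))))"
  shows "of_nat (3 * X) * (\<Sum>(a, b, c)\<in>triples M. f1 a * f2 b * f3 c)
           = (\<Sum>t<3 * X. ee (- (real M * (real t / real (3 * X)))) * (F f1 t * F f2 t * F f3 t))"
proof -
  let ?N = "3 * X"
  let ?B = "{..<X} \<times> {..<X} \<times> {..<X}"
  have N: "?N > 0" using assms by simp
  have "(\<Sum>t<?N. ee (- (real M * (real t / real ?N))) * (F f1 t * F f2 t * F f3 t))
      = (\<Sum>t<?N. \<Sum>(a, b, c)\<in>?B. f1 a * f2 b * f3 c *
           ee (real t * (of_int (int a + int b + int c - int M) / real ?N)))"
  proof (rule sum.cong[OF refl])
    fix t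
    define u where "u = real t / real ?N"
    have "F f1 t * F f2 t * F f3 t
        = (\<Sum>a<X. \<Sum>b<X. \<Sum>c<X. (f1 a * ee (real a * u)) * (f2 b * ee (real b * u)) * (f3 c * ee (real c * u)))"
      unfolding F_def u_def[symmetric]
      by (simp only: sum_product)
         (simp only: sum_distrib_left sum_distrib_right, rule sum.cong[OF refl], rule sum.swap)
    also have "\<dots> = (\<Sum>(a, b, c)\<in>?B. (f1 a * ee (real a * u)) * (f2 b * ee (real b * u)) * (f3 c * ee (real c * u)))"
      by (simp add: sum.cartesian_product)
    finally have *: "ee (- (real M * u)) * (F f1 t * F f2 t * F f3 t)
        = (\<Sum>(a, b, c)\<in>?B. ee (- (real M * u)) * ((f1 a * ee (real a * u)) * (f2 b * ee (real b * u)) * (f3 c * ee (real c * u))))"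
      by (simp add: sum_distrib_left case_prod_unfold)
    also have "\<dots> = (\<Sum>(a, b, c)\<in>?B. f1 a * f2 b * f3 c *
           ee (real t * (of_int (int a + int b + int c - int M) / real ?N)))"
    proof (intro sum.cong refl, clarify)
      fix a b c
      have "real t * (of_int (int a + int b + int c - int M) / real ?N)
          = - (real M * u) + real a * u + real b * u + real c * u"
        by (simp add: u_def diff_divide_distrib add_divide_distrib algebra_simps)
      hence "ee (real t * (of_int (int a + int b + int c - int M) / real ?N))
          = ee (- (real M * u)) * ee (real a * u) * ee (real b * u) * ee (real c * u)"
        by (simp only: ee_add)
      thus "ee (- (real M * u)) * ((f1 a * ee (real a * u)) * (f2 b * ee (real b * u)) * (f3 c * ee (real c * u)))
          = f1 a * f2 b * f3 c * ee (real t * (of_int (int a + int b + int c - int M) / real ?N))"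
        by (simp add: mult_ac)
    qed
    finally show "ee (- (real M * (real t / real ?N))) * (F f1 t * F f2 t * F f3 t) = \<dots>"
      by (simp add: u_def)
  qed
  also have "\<dots> = (\<Sum>(a, b, c)\<in>?B. f1 a * f2 b * f3 c *
           (\<Sum>t<?N. ee (real t * (of_int (int a + int b + int c - int M) / real ?N))))"
    by (subst sum.swap) (simp add: sum_distrib_left case_prod_unfold)
  also have "\<dots> = (\<Sum>x\<in>?B. if x \<in> triples M then (case x of (a, b, c) \<Rightarrow> of_nat ?N * (f1 a * f2 b * f3 c)) else 0)"
  proof (intro sum.cong refl, clarify)
    fix a b c assume abc: "a < X" "b < X" "c < X"
    have "int ?N dvd int a + int b + int c - int M \<longleftrightarrow> a + b + c = M"
    proof
      assume "int ?N dvd int a + int b + int c - int M"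
      hence "(a + b + c) mod ?N = M mod ?N"
        by (metis mod_eq_dvd_iff of_nat_add of_nat_eq_iff zmod_int)
      moreover have "a + b + c < ?N" "M < ?N" using abc assms by auto
      ultimately show "a + b + c = M" by simp
    qed auto
    thus "f1 a * f2 b * f3 c * (\<Sum>t<?N. ee (real t * (of_int (int a + int b + int c - int M) / real ?N)))
        = (if (a, b, c) \<in> triples M then of_nat ?N * (f1 a * f2 b * f3 c) else 0)"
      using sum_ee_orthogonal[OF N, of "int a + int b + int c - int M"]
      by (simp add: triples_def)
  qed
  also have "\<dots> = (\<Sum>x\<in>triples M. (case x of (a, b, c) \<Rightarrow> of_nat ?N * (f1 a * f2 b * f3 c)))"
    using triples_subset[OF assms(1)]
    by (subst sum.inter_restrict[symmetric]) (auto intro!: sum.cong)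
  finally show ?thesis by (simp add: sum_distrib_left case_prod_unfold)
qed

text \<open>At each point the small factor is at most \<epsilon> X, and the product of the other two
  is at most the mean of their squares. Which factor is small may change with t, so the squares of
  all three are kept. By Parseval each square is at most X on average, which gives \<epsilon> X / 2
  times 3 X.\<close>

lemma norm_sum_triples_le:
  fixes f1 f2 f3 :: "nat \<Rightarrow> complex"
  assumes "M < X"
    and "\<And>n. norm (f1 n) \<le> 1" "\<And>n. norm (f2 n) \<le> 1" "\<And>n. norm (f3 n) \<le> 1"
    and small: "\<And>t. \<exists>f\<in>{f1, f2, f3}. norm (\<Sum>n<X. f n * ee (real n * t)) \<le> \<epsilon> * real X"
  shows "norm (\<Sum>(a, b, c)\<in>triples M. f1 a * f2 b * f3 c) \<le> 3 / 2 * \<epsilon> * (real X)\<^sup>2"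
proof -
  define F where "F = (\<lambda>f t. \<Sum>n<X. f n * ee (real n * (real t / real (3 * X))))"
  define S where "S = (\<Sum>(a, b, c)\<in>triples M. f1 a * f2 b * f3 c)"
  have X: "X > 0" using assms(1) by simp
  have eps: "\<epsilon> \<ge> 0"
  proof -
    from small[of 0] obtain f where "norm (\<Sum>n<X. f n * ee (real n * 0)) \<le> \<epsilon> * real X" by blast
    hence "0 \<le> \<epsilon> * real X" using norm_ge_zero order_trans by blast
    thus ?thesis using X by (simp add: zero_le_mult_iff)
  qed
  have pars: "(\<Sum>t<3 * X. (norm (F f t))\<^sup>2) \<le> real (3 * X) * real X" if "\<And>n. norm (f n) \<le> 1" for f
  proof -
    have "(\<Sum>t<3 * X. (norm (F f t))\<^sup>2) = real (3 * X) * (\<Sum>n<X. (norm (f n))\<^sup>2)"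
      unfolding F_def by (rule sum_norm_squared_ee) (use X in auto)
    also have "\<dots> \<le> real (3 * X) * (\<Sum>n<X. 1)"
      by (intro mult_left_mono sum_mono) (auto simp: power_le_one that)
    finally show ?thesis by simp
  qed
  have key: "norm (F f1 t * F f2 t * F f3 t)
          \<le> \<epsilon> * real X / 2 * ((norm (F f1 t))\<^sup>2 + (norm (F f2 t))\<^sup>2 + (norm (F f3 t))\<^sup>2)" for t
  proof -
    have two: "x * y \<le> (x\<^sup>2 + y\<^sup>2) / 2" for x y :: real
      using zero_le_power2[of "x - y"] by (simp add: power2_eq_square algebra_simps)
    have gen: "x * y * z \<le> \<epsilon> * real X / 2 * (x\<^sup>2 + y\<^sup>2 + z\<^sup>2)"
      if "x \<le> \<epsilon> * real X" "x \<ge> 0" "y \<ge> 0" "z \<ge> 0" for x y z :: real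
    proof -
      have "x * (y * z) \<le> (\<epsilon> * real X) * ((y\<^sup>2 + z\<^sup>2) / 2)"
        using that two[of y z] by (intro mult_mono) auto
      also have "\<dots> \<le> (\<epsilon> * real X) * ((x\<^sup>2 + y\<^sup>2 + z\<^sup>2) / 2)"
        using eps by (intro mult_left_mono) auto
      finally show ?thesis by (simp add: mult.assoc)
    qed
    from small[of "real t / real (3 * X)"] consider
        "norm (F f1 t) \<le> \<epsilon> * real X" | "norm (F f2 t) \<le> \<epsilon> * real X" | "norm (F f3 t) \<le> \<epsilon> * real X"
      unfolding F_def by blast
    thus ?thesis
    proof cases
      case 1 thus ?thesis using gen[of "norm (F f1 t)" "norm (F f2 t)" "norm (F f3 t)"]
        by (simp add: norm_mult)
    next
      case 2 thus ?thesis using gen[of "norm (F f2 t)" "norm (F f1 t)" "norm (F f3 t)"]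
        by (simp add: norm_mult algebra_simps)
    next
      case 3 thus ?thesis using gen[of "norm (F f3 t)" "norm (F f2 t)" "norm (F f1 t)"]
        by (simp add: norm_mult algebra_simps)
    qed
  qed
  have "real (3 * X) * norm S = norm (of_nat (3 * X) * S)"
    by (simp only: norm_mult norm_of_nat)
  also have "of_nat (3 * X) * S
      = (\<Sum>t<3 * X. ee (- (real M * (real t / real (3 * X)))) * (F f1 t * F f2 t * F f3 t))"
    unfolding F_def S_def by (rule sum_triples_eq[OF assms(1)])
  also have "norm \<dots> \<le> (\<Sum>t<3 * X. \<epsilon> * real X / 2 * ((norm (F f1 t))\<^sup>2 + (norm (F f2 t))\<^sup>2 + (norm (F f3 t))\<^sup>2))"
    using key by (intro sum_norm_le) (simp add: norm_mult)
  also have "\<dots> = \<epsilon> * real X / 2 * ((\<Sum>t<3 * X. (norm (F f1 t))\<^sup>2) + (\<Sum>t<3 * X. (norm (F f2 t))\<^sup>2) + (\<Sum>t<3 * X. (norm (F f3 t))\<^sup>2))"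
    by (simp add: sum_distrib_left sum.distrib algebra_simps)
  also have "\<dots> \<le> \<epsilon> * real X / 2 * (real (3 * X) * real X + real (3 * X) * real X + real (3 * X) * real X)"
    using eps assms by (intro mult_left_mono add_mono pars) auto
  also have "\<dots> = real (3 * X) * (3 / 2 * \<epsilon> * (real X)\<^sup>2)" by (simp add: power2_eq_square)
  finally have "real (3 * X) * norm S \<le> real (3 * X) * (3 / 2 * \<epsilon> * (real X)\<^sup>2)" .
  thus ?thesis using X unfolding S_def by (subst (asm) mult_le_cancel_left_pos) auto
qed

section \<open>Exponential sums over integers with prescribed digit sum\<close>

lemma of_bool_eq_sum_ee:
  assumes "\<bar>m\<bar> \<le> 2 * int R"
  shows "of_bool (m = 0) = (\<Sum>b\<in>{-int R..int R}. ee (of_int b * of_int m / real (2 * R + 1))) / of_nat (2 * R + 1)"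
  unfolding sum_ee_orthogonal_symmetric[OF assms] using of_nat_neq_0[of "2 * R"] by auto

text \<open>Subtracting the phases at places j and j+1 cancels a, so the bound is uniform in the
  digit-sum frequency. Each place is used at most twice, and E differences involve E+1
  places.\<close>

lemma sum_sin2_ge:
  assumes "g \<ge> 1"
  shows "(\<Sum>j<E. sin2 ((real g - 1) * u * real g ^ j)) \<le> 4 * (\<Sum>j<Suc E. sin2 (a + u * real g ^ j))"
proof -
  let ?x = "\<lambda>j. sin2 (a + u * real g ^ j)"
  have "(\<Sum>j<E. sin2 ((real g - 1) * u * real g ^ j)) \<le> (\<Sum>j<E. 2 * ?x (Suc j) + 2 * ?x j)"
  proof (rule sum_mono)
    fix j
    have "(real g - 1) * u * real g ^ j = (a + u * real g ^ Suc j) - (a + u * real g ^ j)"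
      by (simp add: algebra_simps)
    thus "sin2 ((real g - 1) * u * real g ^ j) \<le> 2 * ?x (Suc j) + 2 * ?x j"
      by (metis sin2_diff_le)
  qed
  also have "\<dots> = 2 * (\<Sum>j<E. ?x (Suc j)) + 2 * (\<Sum>j<E. ?x j)"
    by (simp add: sum.distrib sum_distrib_left)
  also have "(\<Sum>j<E. ?x (Suc j)) \<le> (\<Sum>j<Suc E. ?x j)"
    by (subst sum.lessThan_Suc_shift) simp
  also have "(\<Sum>j<E. ?x j) \<le> (\<Sum>j<Suc E. ?x j)"
    by simp
  finally show ?thesis by simp
qed

text \<open>The condition on the digit sum is an average over the frequencies b/Q. The bound from
  consecutive places does not depend on b, so the averaging costs nothing.\<close>

lemma norm_sum_ee_digit_set_le:
  assumes "g \<ge> 2"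
  shows "norm (\<Sum>n<g ^ Suc E. of_bool (digit_sum g n = k) * ee (\<beta> * real n) * ee (real n * t))
           \<le> real g ^ Suc E * exp (- ((\<Sum>j<E. sin2 ((real g - 1) * (t + \<beta>) * real g ^ j)) / (4 * real g)))"
    (is "norm ?S \<le> ?B")
proof -
  define R where "R = k + (g - 1) * Suc E"
  define Q where "Q = 2 * R + 1"
  let ?I = "{-int R..int R}"
  let ?s = "\<lambda>n. real (digit_sum g n)"
  have const: "(\<Sum>b\<in>?I. c) = real Q * c" for c :: real by (simp add: Q_def)
  have "?S = (\<Sum>n<g ^ Suc E. \<Sum>b\<in>?I. ee (- (of_int b * real k / real Q)) / of_nat Q *
                ee (of_int b / real Q * ?s n + (t + \<beta>) * real n))"
  proof (rule sum.cong[OF refl])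
    fix n assume "n \<in> {..<g ^ Suc E}"
    hence "digit_sum g n \<le> (g - 1) * Suc E" by (intro digit_sum_le assms) simp
    hence "digit_sum g n + k \<le> R" unfolding R_def by simp
    hence "\<bar>int (digit_sum g n) - int k\<bar> \<le> 2 * int R" by linarith
    note of_bool_eq_sum_ee[OF this]
    moreover have "(int (digit_sum g n) - int k = 0) = (digit_sum g n = k)" by auto
    ultimately have *: "of_bool (digit_sum g n = k)
        = (\<Sum>b\<in>?I. ee (of_int b * of_int (int (digit_sum g n) - int k) / real Q)) / of_nat Q"
      by (simp only: Q_def)
    show "of_bool (digit_sum g n = k) * ee (\<beta> * real n) * ee (real n * t)
        = (\<Sum>b\<in>?I. ee (- (of_int b * real k / real Q)) / of_nat Q *
                ee (of_int b / real Q * ?s n + (t + \<beta>) * real n))"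
      unfolding * sum_divide_distrib sum_distrib_right
    proof (rule sum.cong[OF refl])
      fix b :: int
      have e1: "of_int b * of_int (int (digit_sum g n) - int k) / real Q
          = - (of_int b * real k / real Q) + of_int b / real Q * ?s n"
        by (simp add: diff_divide_distrib algebra_simps)
      have e2: "of_int b / real Q * ?s n + (t + \<beta>) * real n
          = of_int b / real Q * ?s n + \<beta> * real n + real n * t"
        by (simp add: algebra_simps)
      show "ee (of_int b * of_int (int (digit_sum g n) - int k) / real Q) / of_nat Q
              * ee (\<beta> * real n) * ee (real n * t)
          = ee (- (of_int b * real k / real Q)) / of_nat Q *
                ee (of_int b / real Q * ?s n + (t + \<beta>) * real n)"
        unfolding e1 e2 ee_add by simp
    qed
  qed
  also have "\<dots> = (\<Sum>b\<in>?I. ee (- (of_int b * real k / real Q)) / of_nat Q *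
                (\<Sum>n<g ^ Suc E. ee (of_int b / real Q * ?s n + (t + \<beta>) * real n)))"
    unfolding sum_distrib_left by (rule sum.swap)
  also have "norm \<dots> \<le> real Q * (1 / real Q * ?B)"
    unfolding const[symmetric]
  proof (rule sum_norm_le)
    fix b :: int
    have "norm (\<Sum>n<g ^ Suc E. ee (of_int b / real Q * ?s n + (t + \<beta>) * real n))
        \<le> real g ^ Suc E * exp (- ((\<Sum>j<Suc E. sin2 (of_int b / real Q + (t + \<beta>) * real g ^ j)) / real g))"
      by (rule norm_sum_ee_digit_sum_le[OF assms])
    also have "\<dots> \<le> ?B"
    proof -
      have "(\<Sum>j<E. sin2 ((real g - 1) * (t + \<beta>) * real g ^ j)) / (4 * real g)
          \<le> (\<Sum>j<Suc E. sin2 (of_int b / real Q + (t + \<beta>) * real g ^ j)) / real g"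
        using sum_sin2_ge[of g "t + \<beta>" E "of_int b / real Q"] assms by (simp add: field_simps)
      thus ?thesis by (intro mult_left_mono) auto
    qed
    finally have *: "norm (\<Sum>n<g ^ Suc E. ee (of_int b / real Q * ?s n + (t + \<beta>) * real n)) \<le> ?B" .
    show "norm (ee (- (of_int b * real k / real Q)) / of_nat Q *
        (\<Sum>n<g ^ Suc E. ee (of_int b / real Q * ?s n + (t + \<beta>) * real n))) \<le> 1 / real Q * ?B"
      using mult_left_mono[OF *, of "1 / real Q"]
      by (simp only: norm_mult norm_divide norm_ee norm_of_nat zero_le_divide_1_iff of_nat_0_le_iff)
  qed
  also have "\<dots> = ?B" by (simp add: Q_def)
  finally show ?thesis .
qed

section \<open>Distance of x g^j to the integers for rational x\<close>

lemma sin2_diff_Ints: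
  assumes "m \<in> \<int>"
  shows "sin2 (x - m) = sin2 x"
proof -
  have "sin (m * pi) = 0" using assms by (simp only: sin_times_pi_eq_0)
  hence s: "sin (pi * m) = 0" by (simp only: mult.commute)
  hence c: "(cos (pi * m))\<^sup>2 = 1" by (simp add: cos_squared_eq)
  have "sin2 (x - m) = (sin (pi * x) * cos (pi * m))\<^sup>2"
    by (simp add: sin2_def right_diff_distrib sin_diff s)
  thus ?thesis by (simp add: power_mult_distrib c sin2_def)
qed

text \<open>As long as the distance of \<open>y g^i\<close> to the integers stays below \<open>1/(2g)\<close>, each
  multiplication by \<open>g\<close> multiplies that distance by exactly \<open>g\<close>.\<close>

lemma sin2_power_window:
  fixes g q L :: nat
  assumes "g \<ge> 2" "y \<notin> \<int>" "real q * y \<in> \<int>" "q \<le> g ^ L" "q > 0"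
  shows "\<exists>i\<le>L. sin2 (y * real g ^ i) \<ge> 1 / (real g)\<^sup>2"
proof (rule ccontr)
  assume "\<not> ?thesis"
  hence small: "sin2 (y * real g ^ i) < 1 / (real g)\<^sup>2" if "i \<le> L" for i
    using that by force
  define m where "m = (\<lambda>i. real_of_int (round (y * real g ^ i)))"
  define d where "d = (\<lambda>i. y * real g ^ i - m i)"
  have m: "m i \<in> \<int>" for i by (simp add: m_def)
  have d: "\<bar>d i\<bar> < 1 / (2 * real g)" if "i \<le> L" for i
  proof -
    have "\<bar>d i\<bar> \<le> 1 / 2"
      unfolding d_def m_def using of_int_round_abs_le[of "y * real g ^ i"] by (simp add: abs_minus_commute)
    hence "4 * (d i)\<^sup>2 \<le> sin2 (d i)" by (rule sin2_ge)
    also have "\<dots> < 1 / (real g)\<^sup>2"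
      unfolding d_def sin2_diff_Ints[OF m] by (rule small[OF that])
    finally have "(d i)\<^sup>2 < (1 / (2 * real g))\<^sup>2"
      by (simp add: power_divide power_mult_distrib)
    thus ?thesis using power2_less_imp_less[of "\<bar>d i\<bar>" "1 / (2 * real g)"] by simp
  qed
  have step: "d (Suc i) = real g * d i" if "Suc i \<le> L" for i
  proof -
    have "d (Suc i) - real g * d i = real g * m i - m (Suc i)"
      by (simp add: d_def algebra_simps)
    hence int: "d (Suc i) - real g * d i \<in> \<int>" using m by auto
    have "\<bar>d (Suc i) - real g * d i\<bar> \<le> \<bar>d (Suc i)\<bar> + real g * \<bar>d i\<bar>"
      using abs_triangle_ineq4[of "d (Suc i)" "real g * d i"] by (simp add: abs_mult)
    also have "\<dots> < 1 / (2 * real g) + real g * (1 / (2 * real g))"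
      using d[of i] d[of "Suc i"] that assms
      by (intro add_strict_mono mult_strict_left_mono) auto
    also have "\<dots> \<le> 1" using assms by (simp add: field_simps)
    finally have "d (Suc i) - real g * d i = 0" using int Ints_nonzero_abs_less1 by blast
    thus ?thesis by simp
  qed
  have pow: "d i = real g ^ i * d 0" if "i \<le> L" for i
    using that by (induction i) (use step in auto)
  have "d 0 \<noteq> 0"
  proof
    assume "d 0 = 0"
    hence "y = m 0" by (simp add: d_def)
    with m assms(2) show False by metis
  qed
  moreover have "real q * d 0 \<in> \<int>"
  proof -
    have "real q * d 0 = real q * y - real q * m 0" by (simp add: d_def algebra_simps)
    thus ?thesis using assms(3) m by auto
  qed
  \<comment> \<open>q times \<open>d 0\<close> is a nonzero integer, so \<open>d 0\<close> is at
    least 1/q \<ge> g^(-L) in absolute value; L multiplications by g would bring it up to 1, against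
    the bound on \<open>d L\<close>.\<close>
  ultimately have "\<bar>real q * d 0\<bar> \<ge> 1"
    using assms(5) by (intro Ints_nonzero_abs_ge1) auto
  hence "1 \<le> real q * \<bar>d 0\<bar>" by (simp add: abs_mult)
  also have "\<dots> \<le> real g ^ L * \<bar>d 0\<bar>"
    using assms(4) by (intro mult_right_mono) (auto simp flip: of_nat_power)
  also have "\<dots> = \<bar>d L\<bar>" using pow[of L] by (simp add: abs_mult)
  also have "\<dots> < 1 / (2 * real g)" by (rule d) simp
  also have "\<dots> \<le> 1 / 2" using assms(1) by (simp add: field_simps)
  finally show False by simp
qed

text \<open>The places are cut into W windows of length L+1. Multiplying x by a power of g keeps it
  non-integral with q as a denominator, so every window contributes at least 1/g^2.\<close>

lemma sum_sin2_power_ge: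
  fixes g q L :: nat
  assumes "g \<ge> 2" "\<And>j. x * real g ^ j \<notin> \<int>" "real q * x \<in> \<int>" "q \<le> g ^ L" "q > 0"
    and "W * Suc L \<le> E"
  shows "(\<Sum>j<E. sin2 (x * real g ^ j)) \<ge> real W / (real g)\<^sup>2"
proof -
  have "real W / (real g)\<^sup>2 = (\<Sum>w<W. 1 / (real g)\<^sup>2)" by simp
  also have "\<dots> \<le> (\<Sum>w<W. \<Sum>j=w * Suc L..<w * Suc L + Suc L. sin2 (x * real g ^ j))"
  proof (rule sum_mono)
    fix w
    let ?y = "x * real g ^ (w * Suc L)"
    have "real q * ?y = (real q * x) * of_nat (g ^ (w * Suc L))" by simp
    hence int: "real q * ?y \<in> \<int>" using assms(3) Ints_mult Ints_of_nat by metis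
    obtain i where i: "i \<le> L" "sin2 (?y * real g ^ i) \<ge> 1 / (real g)\<^sup>2"
      using sin2_power_window[OF assms(1) assms(2) int assms(4,5)] by blast
    have "1 / (real g)\<^sup>2 \<le> sin2 (x * real g ^ (w * Suc L + i))"
      using i(2) by (simp add: power_add mult.assoc)
    also have "\<dots> \<le> (\<Sum>j=w * Suc L..<w * Suc L + Suc L. sin2 (x * real g ^ j))"
      using i(1) by (intro member_le_sum) auto
    finally show "1 / (real g)\<^sup>2 \<le> \<dots>" .
  qed
  also have "\<dots> = (\<Sum>j<W * Suc L. sin2 (x * real g ^ j))" by (rule sum.nat_group)
  also have "\<dots> \<le> (\<Sum>j<E. sin2 (x * real g ^ j))"
    using assms(6) by (intro sum_mono2) auto
  finally show ?thesis .
qed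

section \<open>Detecting divisibility\<close>

text \<open>Averaged over \<beta> = l/k with l < k, this becomes the indicator of the n with digit
  sum k that are divisible by k.\<close>

definition digit_char :: "nat \<Rightarrow> nat \<Rightarrow> real \<Rightarrow> nat \<Rightarrow> complex" where
  "digit_char g k \<beta> n = of_bool (digit_sum g n = k) * ee (\<beta> * real n)"

lemma norm_digit_char_le: "norm (digit_char g k \<beta> n) \<le> 1"
  by (simp add: digit_char_def norm_mult)

text \<open>At equal places the two quantities differ by one that is free of t, so the two sums of
  \<open>sin2\<close> add up to at least Y/2 and one of them is at least Y/4. The 16 is this 4 times
  the 4 of \<open>sum_sin2_ge\<close>.\<close>

lemma sum_digit_char_pair:
  assumes "g \<ge> 2"
    and "(\<Sum>j<K. sin2 ((real g - 1) * (\<beta> - \<beta>') * real g ^ j)) \<ge> Y"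
  shows "\<exists>f\<in>{digit_char g k \<beta>, digit_char g k' \<beta>'}.
           norm (\<Sum>n<g ^ Suc K. f n * ee (real n * t)) \<le> exp (- (Y / (16 * real g))) * real (g ^ Suc K)"
proof -
  define A where "A = (\<lambda>\<beta>. \<Sum>j<K. sin2 ((real g - 1) * (t + \<beta>) * real g ^ j))"
  have "Y \<le> (\<Sum>j<K. 2 * sin2 ((real g - 1) * (t + \<beta>) * real g ^ j)
                + 2 * sin2 ((real g - 1) * (t + \<beta>') * real g ^ j))"
  proof (rule order.trans[OF assms(2)], rule sum_mono)
    fix j
    have "(real g - 1) * (\<beta> - \<beta>') * real g ^ j
        = (real g - 1) * (t + \<beta>) * real g ^ j - (real g - 1) * (t + \<beta>') * real g ^ j"
      by (simp add: algebra_simps)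
    thus "sin2 ((real g - 1) * (\<beta> - \<beta>') * real g ^ j)
        \<le> 2 * sin2 ((real g - 1) * (t + \<beta>) * real g ^ j) + 2 * sin2 ((real g - 1) * (t + \<beta>') * real g ^ j)"
      by (metis sin2_diff_le)
  qed
  also have "\<dots> = 2 * A \<beta> + 2 * A \<beta>'"
    by (simp add: A_def sum.distrib sum_distrib_left)
  finally have or: "A \<beta> \<ge> Y / 4 \<or> A \<beta>' \<ge> Y / 4" by linarith
  have bound: "norm (\<Sum>n<g ^ Suc K. digit_char g k \<beta> n * ee (real n * t))
                \<le> exp (- (Y / (16 * real g))) * real (g ^ Suc K)" if "A \<beta> \<ge> Y / 4" for k \<beta>
  proof -
    have "norm (\<Sum>n<g ^ Suc K. digit_char g k \<beta> n * ee (real n * t))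
        \<le> real g ^ Suc K * exp (- (A \<beta> / (4 * real g)))"
      unfolding digit_char_def A_def by (rule norm_sum_ee_digit_set_le[OF assms(1)])
    also have "\<dots> \<le> real g ^ Suc K * exp (- (Y / (16 * real g)))"
      using that assms(1) by (intro mult_left_mono) (auto simp: field_simps)
    finally show ?thesis by (simp add: mult.commute)
  qed
  from or show ?thesis using bound[of \<beta> k] bound[of \<beta>' k'] by blast
qed

text \<open>With d = gcd c k the condition reduces to k/d dividing l, since c/d is coprime to k/d;
  there are d such l below k. For c = g-1 this is the origin of the gcd factors in
  \<open>c_const\<close>.\<close>

lemma card_dvd_mult_less:
  fixes k c :: nat
  assumes "k > 0"
  shows "card {l. l < k \<and> k dvd c * l} = gcd c k"
proof -
  define d where "d = gcd c k"
  have d: "d > 0" using assms by (simp add: d_def)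
  obtain c' k' where ck: "c = d * c'" "k = d * k'" "coprime c' k'"
    using gcd_coprime_exists[of c k] d unfolding d_def by (metis gcd_eq_0_iff mult.commute neq0_conv)
  have k': "k' > 0" using assms ck by (cases k') auto
  have "k dvd c * l \<longleftrightarrow> k' dvd l" for l
  proof -
    have "k dvd c * l \<longleftrightarrow> k' dvd c' * l"
      using d by (simp add: ck mult.assoc)
    also have "\<dots> \<longleftrightarrow> k' dvd l"
      using ck(3) by (metis coprime_commute coprime_dvd_mult_right_iff)
    finally show ?thesis .
  qed
  hence "{l. l < k \<and> k dvd c * l} = (\<lambda>i. k' * i) ` {..<d}"
    using k' by (auto simp: ck mult.commute elim!: dvdE)
  also have "card \<dots> = d" using k' by (subst card_image) (auto simp: inj_on_def)
  finally show ?thesis by (simp add: d_def)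
qed

lemma of_bool_dvd_eq_sum_ee:
  assumes "k > 0"
  shows "of_nat k * of_bool (k dvd n) = (\<Sum>l<k. ee (real l / real k * real n))"
  using sum_ee_orthogonal[OF assms, of "int n"] by simp

text \<open>If the digit sum of n is k, then n = k - (g-1) t for an integer t, and l n / k = l - t
  (g-1) l / k is an integer; so the phase is 1 on the support.\<close>

lemma digit_char_eq_of_bool:
  assumes "g \<ge> 2" "k > 0" "k dvd (g - 1) * l"
  shows "digit_char g k (real l / real k) n = of_bool (digit_sum g n = k)"
proof (cases "digit_sum g n = k")
  case True
  have "int g - 1 dvd int k - int n"
    using digit_sum_cong_self[OF assms(1), of n] True by (simp add: cong_iff_dvd_diff)
  then obtain t where t: "int k - int n = (int g - 1) * t" by blast
  from assms(3) obtain u where u: "(g - 1) * l = k * u" by blast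
  have n: "int n = int k - (int g - 1) * t" using t by simp
  have "(int g - 1) * int l = int k * int u"
    using u assms(1) by (metis of_nat_1 of_nat_diff of_nat_mult le_trans one_le_numeral)
  hence "int l * int n = int k * (int l - int u * t)"
    unfolding n by (simp add: algebra_simps)
  hence "real l * real n = real k * of_int (int l - int u * t)"
    by (metis of_int_mult of_int_of_nat_eq)
  hence "real l / real k * real n = of_int (int l - int u * t)"
    using assms(2) by (simp add: field_simps)
  thus ?thesis using True by (simp add: digit_char_def ee_Ints)
qed (simp add: digit_char_def)

text \<open>After clearing denominators, the fraction with denominator k' vanishes modulo k, and
  neither k' nor a power of g can cancel any part of k. Only (g-1) l could make the number integral,
  which is excluded; the numerator l' is arbitrary.\<close>

lemma sum_sin2_fraction_ge:
  fixes g k k' l l' :: nat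
  assumes "g \<ge> 2" "k > 0" "k' > 0" "coprime k k'" "coprime k g" "\<not> k dvd (g - 1) * l"
    and "k * k' \<le> g ^ L" "W * Suc L \<le> K"
  shows "(\<Sum>j<K. sin2 ((real g - 1) * (real l / real k - real l' / real k') * real g ^ j)) \<ge> real W / (real g)\<^sup>2"
proof (rule sum_sin2_power_ge[where q = "k * k'" and L = L])
  let ?x = "(real g - 1) * (real l / real k - real l' / real k')"
  have kx: "real (k * k') * (?x * real g ^ j) = of_int ((int g - 1) * (int l * int k' - int l' * int k) * int g ^ j)" for j
    using assms(2,3) by (simp add: field_simps)
  have "real (k * k') * ?x = of_int ((int g - 1) * (int l * int k' - int l' * int k))"
    using kx[of 0] by (simp only: power_0 mult_1_right)
  thus "real (k * k') * ?x \<in> \<int>" by (simp only: Ints_of_int)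
  show "?x * real g ^ j \<notin> \<int>" for j
  proof
    assume "?x * real g ^ j \<in> \<int>"
    then obtain z where "?x * real g ^ j = of_int z" by (elim Ints_cases)
    with kx[of j] have "real_of_int (int k * int k' * z)
        = of_int ((int g - 1) * (int l * int k' - int l' * int k) * int g ^ j)" by simp
    hence "int k * int k' * z = (int g - 1) * (int l * int k' - int l' * int k) * int g ^ j"
      using of_int_eq_iff by blast
    hence "(int g - 1) * int l * int k' * int g ^ j
             = int k * (int k' * z + (int g - 1) * int l' * int g ^ j)"
      by (simp add: algebra_simps)
    hence "int k dvd (int g - 1) * int l * int k' * int g ^ j" by simp
    also have "(int g - 1) * int l * int k' * int g ^ j = int ((g - 1) * l * (k' * g ^ j))"
      using assms(1) by (simp add: of_nat_diff)
    finally have "k dvd (g - 1) * l * (k' * g ^ j)" by (simp only: of_nat_dvd_iff)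
    moreover have "coprime k (k' * g ^ j)" using assms(4,5) by simp
    ultimately have "k dvd (g - 1) * l" using coprime_dvd_mult_left_iff by blast
    with assms(6) show False by blast
  qed
qed (use assms in auto)

section \<open>Counts of representations as character sums over triples\<close>

lemma rep3_eq_sum_triples:
  assumes "M \<le> X" "\<not> P1 0" "\<not> P2 0" "\<not> P3 0"
  shows "of_nat (rep3 {n. n < X \<and> P1 n} {n. n < X \<and> P2 n} {n. n < X \<and> P3 n} M)
           = (\<Sum>(a, b, c)\<in>triples M. of_bool (P1 a) * of_bool (P2 b) * of_bool (P3 c) :: 'a :: semiring_1)"
proof -
  \<comment> \<open>M = X is allowed, so a summand stays below X only because the two others are
    positive; this is why the three predicates must fail at 0.\<close>
  have less: "a < X \<and> b < X \<and> c < X" if "a + b + c = M" "P1 a" "P2 b" "P3 c" for a b c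
  proof -
    have "a > 0" "b > 0" "c > 0" using that assms by (metis neq0_conv)+
    thus ?thesis using that(1) assms(1) by simp
  qed
  have "{(a, b, c). a \<in> {n. n < X \<and> P1 n} \<and> b \<in> {n. n < X \<and> P2 n} \<and> c \<in> {n. n < X \<and> P3 n} \<and> a + b + c = M}
      = {x \<in> triples M. case x of (a, b, c) \<Rightarrow> P1 a \<and> P2 b \<and> P3 c}" (is "?L = ?R")
    using less by (auto simp: triples_def)
  hence "of_nat (rep3 {n. n < X \<and> P1 n} {n. n < X \<and> P2 n} {n. n < X \<and> P3 n} M) = (of_nat (card ?R) :: 'a)"
    by (simp only: rep3_def)
  also have "\<dots> = (\<Sum>x\<in>?R. 1)" by (simp only: sum_constant mult_1_right)
  also have "\<dots> = (\<Sum>x\<in>triples M. if case x of (a, b, c) \<Rightarrow> P1 a \<and> P2 b \<and> P3 c then 1 else 0)"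
    by (rule sum.inter_filter) simp
  also have "\<dots> = (\<Sum>(a, b, c)\<in>triples M. of_bool (P1 a) * of_bool (P2 b) * of_bool (P3 c))"
    by (intro sum.cong) (auto simp: of_bool_def split: if_splits)
  finally show ?thesis .
qed

lemma rep3_digit_set_eq:
  assumes "g \<ge> 2" "M \<le> g ^ K" "k1 > 0" "k2 > 0" "k3 > 0"
  shows "of_nat (rep3 (digit_set g K k1) (digit_set g K k2) (digit_set g K k3) M)
           = (\<Sum>(a, b, c)\<in>triples M. of_bool (digit_sum g a = k1) * of_bool (digit_sum g b = k2)
                * of_bool (digit_sum g c = k3) :: 'a :: semiring_1)"
  unfolding digit_set_def by (rule rep3_eq_sum_triples) (use assms in auto)

lemma rep3_niven_set_eq:
  assumes "g \<ge> 2" "M \<le> g ^ K" "k1 > 0" "k2 > 0" "k3 > 0"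
  shows "of_nat (k1 * k2 * k3) * of_nat (rep3 (niven_set g K k1) (niven_set g K k2) (niven_set g K k3) M)
           = (\<Sum>(l1, l2, l3)\<in>{..<k1} \<times> {..<k2} \<times> {..<k3}. \<Sum>(a, b, c)\<in>triples M.
                digit_char g k1 (real l1 / real k1) a * digit_char g k2 (real l2 / real k2) b
                  * digit_char g k3 (real l3 / real k3) c)"
proof -
  have niven: "niven_set g K k = {n. n < g ^ K \<and> digit_sum g n = k \<and> k dvd n}" for k
    by (auto simp: niven_set_def digit_set_def)
  have ind: "of_nat k * of_bool (digit_sum g n = k \<and> k dvd n) = (\<Sum>l<k. digit_char g k (real l / real k) n)"
    if "k > 0" for k n
    unfolding digit_char_def sum_distrib_left[symmetric] of_bool_dvd_eq_sum_ee[OF that, symmetric]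
    by (simp add: of_bool_conj)
  have "of_nat (k1 * k2 * k3) * of_nat (rep3 (niven_set g K k1) (niven_set g K k2) (niven_set g K k3) M)
      = of_nat (k1 * k2 * k3) * (\<Sum>(a, b, c)\<in>triples M. of_bool (digit_sum g a = k1 \<and> k1 dvd a) *
          of_bool (digit_sum g b = k2 \<and> k2 dvd b) * of_bool (digit_sum g c = k3 \<and> k3 dvd c) :: complex)"
    unfolding niven by (subst rep3_eq_sum_triples) (use assms in auto)
  also have "\<dots> = (\<Sum>(a, b, c)\<in>triples M. (of_nat k1 * of_bool (digit_sum g a = k1 \<and> k1 dvd a)) *
          (of_nat k2 * of_bool (digit_sum g b = k2 \<and> k2 dvd b)) *
          (of_nat k3 * of_bool (digit_sum g c = k3 \<and> k3 dvd c)))"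
    unfolding sum_distrib_left by (intro sum.cong refl) (auto simp: of_nat_mult mult_ac)
  also have "\<dots> = (\<Sum>(a, b, c)\<in>triples M. \<Sum>(l1, l2, l3)\<in>{..<k1} \<times> {..<k2} \<times> {..<k3}.
                digit_char g k1 (real l1 / real k1) a * digit_char g k2 (real l2 / real k2) b
                  * digit_char g k3 (real l3 / real k3) c)"
  proof (intro sum.cong refl, clarify)
    fix a b c
    let ?d = "\<lambda>k n l. digit_char g k (real l / real k) n"
    have "(\<Sum>l<k1. ?d k1 a l) * (\<Sum>l<k2. ?d k2 b l) * (\<Sum>l<k3. ?d k3 c l)
        = (\<Sum>l1<k1. \<Sum>l2<k2. \<Sum>l3<k3. ?d k1 a l1 * ?d k2 b l2 * ?d k3 c l3)"
      by (simp only: sum_product)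
         (simp only: sum_distrib_left sum_distrib_right, rule sum.cong[OF refl], rule sum.swap)
    thus "of_nat k1 * of_bool (digit_sum g a = k1 \<and> k1 dvd a) *
          (of_nat k2 * of_bool (digit_sum g b = k2 \<and> k2 dvd b)) *
          (of_nat k3 * of_bool (digit_sum g c = k3 \<and> k3 dvd c))
        = (\<Sum>(l1, l2, l3)\<in>{..<k1} \<times> {..<k2} \<times> {..<k3}. ?d k1 a l1 * ?d k2 b l2 * ?d k3 c l3)"
      by (simp only: ind assms(3-5) sum.cartesian_product)
  qed
  also have "\<dots> = (\<Sum>(l1, l2, l3)\<in>{..<k1} \<times> {..<k2} \<times> {..<k3}. \<Sum>(a, b, c)\<in>triples M.
                digit_char g k1 (real l1 / real k1) a * digit_char g k2 (real l2 / real k2) b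
                  * digit_char g k3 (real l3 / real k3) c)"
    unfolding case_prod_unfold by (rule sum.swap)
  finally show ?thesis .
qed

text \<open>Each frequency triple in \<open>V\<close> contributes the full untwisted count, and the
  number of these triples is the product of the gcds. Each other triple contributes at most the
  stated bound, and the normalisation by k1 k2 k3 absorbs their number.\<close>

lemma rep3_niven_set_approx:
  assumes g: "g \<ge> 2" and M: "M \<le> g ^ K" and k: "k1 > 0" "k2 > 0" "k3 > 0"
    and cop: "coprime k1 k2" "coprime k1 k3" "coprime k2 k3"
    and copg: "coprime k1 g" "coprime k2 g" "coprime k3 g"
    and L: "k1 * k2 \<le> g ^ L" "k1 * k3 \<le> g ^ L" "k2 * k3 \<le> g ^ L" and W: "W * Suc L \<le> K"
  shows "\<bar>real (rep3 (niven_set g K k1) (niven_set g K k2) (niven_set g K k3) M)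
           - real (gcd (g - 1) k1 * gcd (g - 1) k2 * gcd (g - 1) k3) / (real k1 * real k2 * real k3)
               * real (rep3 (digit_set g K k1) (digit_set g K k2) (digit_set g K k3) M)\<bar>
           \<le> 3 / 2 * exp (- (real W / (real g)\<^sup>2 / (16 * real g))) * (real (g ^ Suc K))\<^sup>2"
    (is "\<bar>real ?rN - ?c * real ?rS\<bar> \<le> ?B")
proof -
  define T where "T = (\<lambda>(l1, l2, l3). \<Sum>(a, b, c)\<in>triples M.
                digit_char g k1 (real l1 / real k1) a * digit_char g k2 (real l2 / real k2) b
                  * digit_char g k3 (real l3 / real k3) c)"
  define U where "U = {..<k1} \<times> {..<k2} \<times> {..<k3}"
  define G where "G = (\<lambda>k. {l. l < k \<and> k dvd (g - 1) * l})"
  define V where "V = G k1 \<times> G k2 \<times> G k3"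
  have fin: "finite U" by (simp add: U_def)
  have VU: "V \<subseteq> U" by (auto simp: V_def U_def G_def)
  have cardV: "card V = gcd (g - 1) k1 * gcd (g - 1) k2 * gcd (g - 1) k3"
    using k by (simp add: V_def G_def card_cartesian_product card_dvd_mult_less)
  have main: "T x = of_nat ?rS" if "x \<in> V" for x
  proof -
    obtain l1 l2 l3 where x: "x = (l1, l2, l3)" by (cases x)
    have "k1 dvd (g - 1) * l1" "k2 dvd (g - 1) * l2" "k3 dvd (g - 1) * l3"
      using that by (auto simp: x V_def G_def)
    thus ?thesis unfolding rep3_digit_set_eq[OF g M k] x T_def
      by (simp only: prod.case digit_char_eq_of_bool g k)
  qed
  have rest: "norm (T x) \<le> ?B" if "x \<in> U - V" for x
  proof -
    obtain l1 l2 l3 where x: "x = (l1, l2, l3)" by (cases x)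
    \<comment> \<open>The sums run up to g^(K+1) rather than g^K because M = g^K is allowed and the
      circle method asks for M < X.\<close>
    have X: "M < g ^ Suc K"
    proof -
      have "g ^ K < g ^ Suc K" using g by simp
      thus ?thesis using M by (simp only: le_less_trans)
    qed
    let ?f1 = "digit_char g k1 (real l1 / real k1)"
    let ?f2 = "digit_char g k2 (real l2 / real k2)"
    let ?f3 = "digit_char g k3 (real l3 / real k3)"
    have "norm (\<Sum>(a, b, c)\<in>triples M. ?f1 a * ?f2 b * ?f3 c) \<le> ?B"
    proof (rule norm_sum_triples_le[OF X norm_digit_char_le norm_digit_char_le norm_digit_char_le])
      fix t
      \<comment> \<open>An index with nontrivial frequency is paired with any other index: the lower
        bound for the difference asks nothing of the second numerator.\<close>
      from that consider "\<not> k1 dvd (g - 1) * l1" | "\<not> k2 dvd (g - 1) * l2" | "\<not> k3 dvd (g - 1) * l3"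
        by (auto simp: x U_def V_def G_def)
      thus "\<exists>f\<in>{?f1, ?f2, ?f3}. norm (\<Sum>n<g ^ Suc K. f n * ee (real n * t))
          \<le> exp (- (real W / (real g)\<^sup>2 / (16 * real g))) * real (g ^ Suc K)"
      proof cases
        case 1
        note sum_sin2_fraction_ge[OF g k(1,2) cop(1) copg(1) 1 L(1) W]
        from sum_digit_char_pair[OF g this] show ?thesis by blast
      next
        case 2
        have "coprime k2 k1" "k2 * k1 \<le> g ^ L" using cop L by (auto simp: coprime_commute mult.commute)
        note sum_sin2_fraction_ge[OF g k(2,1) this(1) copg(2) 2 this(2) W]
        from sum_digit_char_pair[OF g this] show ?thesis by blast
      next
        case 3
        have "coprime k3 k1" "k3 * k1 \<le> g ^ L" using cop L by (auto simp: coprime_commute mult.commute)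
        note sum_sin2_fraction_ge[OF g k(3,1) this(1) copg(3) 3 this(2) W]
        from sum_digit_char_pair[OF g this] show ?thesis by blast
      qed
    qed
    thus ?thesis by (simp add: x T_def)
  qed
  have B: "?B \<ge> 0" by simp
  define p where "p = real k1 * real k2 * real k3"
  have p: "p > 0" using k by (simp add: p_def)
  have "complex_of_real p * of_nat ?rN = (\<Sum>x\<in>U. T x)"
    using rep3_niven_set_eq[OF g M k] unfolding T_def U_def p_def by simp
  also have "\<dots> = (\<Sum>x\<in>V. T x) + (\<Sum>x\<in>U - V. T x)"
    using sum.subset_diff[OF VU fin, of T] by (simp add: add.commute)
  also have "(\<Sum>x\<in>V. T x) = of_nat (card V) * of_nat ?rS"
    by (simp add: main)
  finally have "complex_of_real (p * real ?rN - real (card V) * real ?rS) = (\<Sum>x\<in>U - V. T x)"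
    by (simp add: algebra_simps)
  hence "\<bar>p * real ?rN - real (card V) * real ?rS\<bar> = norm (\<Sum>x\<in>U - V. T x)"
    using norm_of_real by metis
  also have "\<dots> \<le> real (card (U - V)) * ?B"
    by (rule sum_norm_bound) (rule rest)
  also have "\<dots> \<le> real (card U) * ?B"
    using card_mono[OF fin, of "U - V"] by (intro mult_right_mono B) auto
  also have "real (card U) = p" by (simp add: U_def p_def card_cartesian_product)
  finally have *: "\<bar>p * real ?rN - real (card V) * real ?rS\<bar> \<le> p * ?B" .
  have "p * \<bar>real ?rN - ?c * real ?rS\<bar> = \<bar>p * (real ?rN - ?c * real ?rS)\<bar>"
    using p by (simp add: abs_mult)
  also have "p * (real ?rN - ?c * real ?rS) = p * real ?rN - real (card V) * real ?rS"
    using p by (simp only: cardV p_def[symmetric]) (simp add: right_diff_distrib)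
  also note *
  finally show ?thesis using p by (simp only: mult_le_cancel_left_pos)
qed

section \<open>Size of the digit sums and choice of the window length\<close>

lemma eventually_digit_sum_range:
  assumes "g \<ge> 3"
  shows "eventually (\<lambda>K. \<forall>k :: nat. \<bar>real k - digit_mean g K\<bar> \<le> real (C_const g)
           \<longrightarrow> real K / 2 \<le> real k \<and> k \<le> g * K) sequentially"
proof -
  define C where "C = real (C_const g)"
  have "eventually (\<lambda>K. 2 * C \<le> real K) sequentially" by real_asymp
  thus ?thesis
  proof eventually_elim
    case (elim K)
    show ?case
    proof (intro allI impI)
      fix k :: nat assume k: "\<bar>real k - digit_mean g K\<bar> \<le> real (C_const g)"
      hence "real k \<ge> digit_mean g K - C" "real k \<le> digit_mean g K + C"
        by (auto simp: C_def)
      \<comment> \<open>Here g \<ge> 3 enters: the mean (g-1) K/2 is at least K, and the deviation C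
        is at most K/2 for large K.\<close>
      moreover have "digit_mean g K \<ge> real K"
        using assms mult_right_mono[of 2 "real g - 1" "real K"] by (simp add: digit_mean_def)
      moreover have "digit_mean g K \<le> (real g - 1) * real K"
        using assms by (simp add: digit_mean_def)
      ultimately have "real K / 2 \<le> real k" "real k \<le> (real g - 1) * real K + real K"
        using elim by linarith+
      thus "real K / 2 \<le> real k \<and> k \<le> g * K"
        by (auto simp: algebra_simps simp flip: of_nat_mult)
    qed
  qed
qed

lemma g_power_le_M:
  assumes "g \<ge> 2" "K \<ge> 1" "g ^ (K - 1) < M"
  shows "(real (g ^ Suc K))\<^sup>2 \<le> real g ^ 4 * (real M)\<^sup>2"
proof -
  have "real (g ^ Suc K) = (real g)\<^sup>2 * real (g ^ (K - 1))"
    using assms(2) by (cases K) (simp_all add: power2_eq_square)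
  also have "\<dots> \<le> (real g)\<^sup>2 * real M"
    using assms(3) by (intro mult_left_mono) auto
  finally have "(real (g ^ Suc K))\<^sup>2 \<le> ((real g)\<^sup>2 * real M)\<^sup>2"
    by (intro power_mono) auto
  thus ?thesis by (simp add: power_mult_distrib flip: power_mult)
qed

lemma rep3_niven_set_asymp:
  assumes g: "g \<ge> 3"
  shows "\<exists>A \<ge> 0. eventually (\<lambda>K. \<forall>M k1 k2 k3 :: nat.
    g ^ (K - 1) < M \<and> M \<le> g ^ K \<and>
    \<bar>real k1 - digit_mean g K\<bar> \<le> real (C_const g) \<and>
    \<bar>real k2 - digit_mean g K\<bar> \<le> real (C_const g) \<and>
    \<bar>real k3 - digit_mean g K\<bar> \<le> real (C_const g) \<and>
    gcd k1 g = 1 \<and> gcd k2 g = 1 \<and> gcd k3 g = 1 \<and>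
    gcd k1 k2 = 1 \<and> gcd k1 k3 = 1 \<and> gcd k2 k3 = 1 \<longrightarrow>
    \<bar>real (rep3 (niven_set g K k1) (niven_set g K k2) (niven_set g K k3) M)
       - real (gcd (g - 1) k1 * gcd (g - 1) k2 * gcd (g - 1) k3) / (real k1 * real k2 * real k3)
         * real (rep3 (digit_set g K k1) (digit_set g K k2) (digit_set g K k3) M)\<bar>
      \<le> A * ((real M)\<^sup>2 * real K powr (- 29 / 6))) sequentially"
    (is "\<exists>A \<ge> 0. eventually (?P A) sequentially")
proof (intro exI conjI)
  define c where "c = 1 / ((real g)\<^sup>2 * (16 * real g))"
  have c: "c > 0" using g by (simp add: c_def)
  have gpos: "real g > 0" using g by simp
  let ?A = "3 / 2 * real g ^ 4"
  show "?A \<ge> 0" by simp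
  have 1: "eventually (\<lambda>K. exp (- (c * (sqrt (real K) - 2))) \<le> real K powr (- 29 / 6)) sequentially"
    using c by real_asymp
  have 2: "eventually (\<lambda>K. (real g * real K)\<^sup>2 \<le> 2 powr (sqrt (real K) - 2)) sequentially"
    using gpos by real_asymp
  show "eventually (?P ?A) sequentially"
    using 1 2 eventually_digit_sum_range[OF g] eventually_ge_at_top[of 1]
  proof eventually_elim
    case (elim K)
    \<comment> \<open>The same W serves as window length and as number of windows: W (W+1) \<le> K,
      while g^W still exceeds (g K)^2, a bound for the products of two of the k's. The saving exp(-c
      W) with W about sqrt K beats every power of K.\<close>
    define W where "W = nat \<lfloor>sqrt (real K)\<rfloor> - 1"
    have W1: "real W \<ge> sqrt (real K) - 2" unfolding W_def by linarith
    have W2: "W * Suc W \<le> K"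
    proof -
      have "sqrt (real K) \<ge> 1" using elim(4) by simp
      hence "real (Suc W) \<le> sqrt (real K)" "real W \<le> sqrt (real K)" unfolding W_def by linarith+
      hence "real W * real (Suc W) \<le> sqrt (real K) * sqrt (real K)" by (intro mult_mono) auto
      hence "real (W * Suc W) \<le> real K" by (simp only: of_nat_mult) simp
      thus ?thesis by (simp only: of_nat_le_iff)
    qed
    have W3: "(g * K)\<^sup>2 \<le> g ^ W"
    proof -
      have "real ((g * K)\<^sup>2) \<le> 2 powr (sqrt (real K) - 2)" using elim(2) by simp
      also have "\<dots> \<le> 2 powr real W" using W1 by simp
      also have "\<dots> = 2 ^ W" by (simp add: powr_realpow)
      also have "\<dots> \<le> real g ^ W" using g by (intro power_mono) auto
      finally show ?thesis by (simp only: of_nat_le_iff flip: of_nat_power)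
    qed
    show ?case
    proof (intro allI impI, elim conjE)
      fix M k1 k2 k3 :: nat
      assume M: "g ^ (K - 1) < M" "M \<le> g ^ K"
        and k: "\<bar>real k1 - digit_mean g K\<bar> \<le> real (C_const g)"
          "\<bar>real k2 - digit_mean g K\<bar> \<le> real (C_const g)"
          "\<bar>real k3 - digit_mean g K\<bar> \<le> real (C_const g)"
        and cop: "gcd k1 g = 1" "gcd k2 g = 1" "gcd k3 g = 1"
          "gcd k1 k2 = 1" "gcd k1 k3 = 1" "gcd k2 k3 = 1"
      have pos: "k1 > 0" "k2 > 0" "k3 > 0" and le: "k1 \<le> g * K" "k2 \<le> g * K" "k3 \<le> g * K"
        using elim(3)[rule_format, OF k(1)] elim(3)[rule_format, OF k(2)]
          elim(3)[rule_format, OF k(3)] elim(4) by auto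
      have prod: "a * b \<le> g ^ W" if "a \<le> g * K" "b \<le> g * K" for a b
        using mult_le_mono[OF that] W3 by (simp add: power2_eq_square)
      have g2: "g \<ge> 2" using g by simp
      have "\<bar>real (rep3 (niven_set g K k1) (niven_set g K k2) (niven_set g K k3) M)
       - real (gcd (g - 1) k1 * gcd (g - 1) k2 * gcd (g - 1) k3) / (real k1 * real k2 * real k3)
         * real (rep3 (digit_set g K k1) (digit_set g K k2) (digit_set g K k3) M)\<bar>
         \<le> 3 / 2 * exp (- (real W / (real g)\<^sup>2 / (16 * real g))) * (real (g ^ Suc K))\<^sup>2"
        using cop by (intro rep3_niven_set_approx[where L = W] g2 M pos prod le W2)
                     (simp_all add: coprime_iff_gcd_eq_1)
      also have "\<dots> \<le> 3 / 2 * (real K powr (- 29 / 6)) * (real g ^ 4 * (real M)\<^sup>2)"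
      proof (intro mult_mono g_power_le_M g2 elim(4) M mult_left_mono)
        have "exp (- (real W / (real g)\<^sup>2 / (16 * real g))) = exp (- (c * real W))"
          by (simp add: c_def)
        also have "\<dots> \<le> exp (- (c * (sqrt (real K) - 2)))"
          using W1 c by simp
        also note elim(1)
        finally show "exp (- (real W / (real g)\<^sup>2 / (16 * real g))) \<le> real K powr (- 29 / 6)" .
      qed auto
      finally show "\<bar>real (rep3 (niven_set g K k1) (niven_set g K k2) (niven_set g K k3) M)
       - real (gcd (g - 1) k1 * gcd (g - 1) k2 * gcd (g - 1) k3) / (real k1 * real k2 * real k3)
         * real (rep3 (digit_set g K k1) (digit_set g K k2) (digit_set g K k3) M)\<bar>
         \<le> ?A * ((real M)\<^sup>2 * real K powr (- 29 / 6))"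
        by (simp only: mult_ac)
    qed
  qed
qed

section \<open>Gaussian sums\<close>

text \<open>The tail beyond y is dominated by the integral of x^(-2), which is 1/y, because x^2
  \<le> exp(x^2).\<close>

lemma integral_gaussian_bounds:
  assumes "y > 0"
  shows "integral {0..y} (\<lambda>x. exp (- x\<^sup>2)) \<le> sqrt pi / 2"
    and "integral {0..y} (\<lambda>x. exp (- x\<^sup>2)) \<ge> sqrt pi / 2 - 1 / y"
proof -
  let ?f = "\<lambda>x::real. exp (- x\<^sup>2)"
  have "set_integrable lborel {0..} ?f" "(LINT x:{0..}|lborel. ?f x) = sqrt pi / 2"
    using gaussian_moment_0 by (auto simp: set_integrable_def set_lebesgue_integral_def has_bochner_integral_iff)
  hence full: "(?f has_integral (sqrt pi / 2)) {0..}"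
    using set_borel_integral_eq_integral[of "{0..}" ?f] by (metis has_integral_integral)
  have cont: "continuous_on A ?f" for A by (intro continuous_intros)
  have int: "(?f has_integral integral {0..y} ?f) {0..y}"
    by (intro integrable_integral integrable_continuous_real cont)
  show "integral {0..y} ?f \<le> sqrt pi / 2"
    by (rule has_integral_subset_le[OF _ int full]) auto
  have tail: "((\<lambda>x. x powr -2) has_integral (1 / y)) {y..}"
    using has_integral_powr_to_inf[of "-2" y] assms by (simp add: powr_minus_divide)
  have ind1: "((\<lambda>x. if x \<in> {0..y} then ?f x else 0) has_integral integral {0..y} ?f) {0..}"
    using int by (subst has_integral_restrict) auto
  have ind2: "((\<lambda>x. if x \<in> {y..} then x powr -2 else 0) has_integral (1 / y)) {0..}"
    using tail assms by (subst has_integral_restrict) auto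
  have "sqrt pi / 2 \<le> integral {0..y} ?f + 1 / y"
  proof (rule has_integral_le[OF full has_integral_add[OF ind1 ind2]])
    fix x :: real assume x: "x \<in> {0..}"
    show "?f x \<le> (if x \<in> {0..y} then ?f x else 0) + (if x \<in> {y..} then x powr -2 else 0)"
    proof (cases "x \<le> y")
      case False
      hence "x > 0" using assms by simp
      have "x\<^sup>2 \<le> exp (x\<^sup>2)" using exp_ge_add_one_self[of "x\<^sup>2"] by linarith
      hence "inverse (exp (x\<^sup>2)) \<le> inverse (x\<^sup>2)"
        using \<open>x > 0\<close> by (intro le_imp_inverse_le) auto
      hence "?f x \<le> x powr -2"
        using \<open>x > 0\<close> by (simp add: exp_minus powr_minus)
      thus ?thesis using False by simp
    qed (use x in auto)
  qed
  thus "integral {0..y} ?f \<ge> sqrt pi / 2 - 1 / y" by simp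
qed

text \<open>For a decreasing f the sum A over 0..R exceeds the integral I by an amount between 0 and
  f(0) = 1. The two-sided sum is 2A - 1 as 0 is counted once, and 2(A - I) - 1 lies between -1 and
  1, whence the error s; truncating the Gaussian integral at s R costs 2/(s R).\<close>

lemma gaussian_sum_approx:
  fixes s :: real and R :: nat
  assumes s: "s > 0" and R: "R > 0"
  shows "\<bar>s * (\<Sum>b\<in>{-int R..int R}. exp (- (s * of_int b)\<^sup>2)) - sqrt pi\<bar> \<le> s + 2 / (s * real R)"
proof -
  define f where "f = (\<lambda>x::real. exp (- (s * x)\<^sup>2))"
  define A where "A = (\<Sum>k\<le>R. f (real k))"
  define I where "I = integral {0..real R} f"
  interpret antimono_fun_sum_integral_diff f
  proof
    fix x y :: real assume "0 \<le> x" "x \<le> y"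
    thus "f y \<le> f x" using s unfolding f_def by (simp add: power_mono)
  qed (auto simp: f_def intro!: continuous_intros)
  have f0: "f 0 = 1" by (simp add: f_def)
  have AI: "A - I \<ge> 0" "A - I \<le> 1"
    using sum_integral_diff_series_nonneg[of R] sum_integral_diff_series_antimono[of 0 R]
    unfolding sum_integral_diff_series_def by (simp_all add: A_def I_def f0)
  have sI: "s * I = integral {0..s * real R} (\<lambda>x. exp (- x\<^sup>2))"
  proof -
    have "((\<lambda>x. exp (- x\<^sup>2)) has_integral integral {0..s * real R} (\<lambda>x. exp (- x\<^sup>2))) (cbox 0 (s * real R))"
      unfolding box_real by (intro integrable_integral integrable_continuous_real continuous_intros)
    from has_integral_affinity[OF this, of s 0] s
    have "(f has_integral (1 / s) * integral {0..s * real R} (\<lambda>x. exp (- x\<^sup>2))) {0..real R}"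
      by (simp add: f_def image_affinity_atLeastAtMost_div field_simps)
    hence "I = (1 / s) * integral {0..s * real R} (\<lambda>x. exp (- x\<^sup>2))"
      unfolding I_def by (rule integral_unique)
    thus ?thesis using s by simp
  qed
  have "s * real R > 0" using s R by simp
  note I_bounds = integral_gaussian_bounds[OF this]
  have "(\<Sum>b\<in>{-int R..int R}. f (of_int b)) = 2 * A - 1"
  proof -
    have "{-int R..int R} = {0..int R} \<union> {-int R..-1}" by auto
    hence "(\<Sum>b\<in>{-int R..int R}. f (of_int b)) = (\<Sum>b\<in>{0..int R}. f (of_int b)) + (\<Sum>b\<in>{-int R..-1}. f (of_int b))"
      by (simp add: sum.union_disjoint)
    also have "(\<Sum>b\<in>{0..int R}. f (of_int b)) = A"
      unfolding A_def by (rule sum.reindex_bij_witness[of _ int nat]) auto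
    also have "(\<Sum>b\<in>{-int R..-1}. f (of_int b)) = (\<Sum>k\<in>{1..R}. f (real k))"
      by (rule sum.reindex_bij_witness[of _ "\<lambda>k. - int k" "\<lambda>b. nat (- b)"]) (auto simp: f_def)
    also have "\<dots> = A - 1"
    proof -
      have "{..R} = insert 0 {1..R}" by auto
      hence "A = f 0 + (\<Sum>k\<in>{1..R}. f (real k))" unfolding A_def by simp
      thus ?thesis by (simp add: f_def)
    qed
    finally show ?thesis by simp
  qed
  hence "s * (\<Sum>b\<in>{-int R..int R}. exp (- (s * of_int b)\<^sup>2)) = s * (2 * A - 1)"
    by (simp only: f_def)
  hence "s * (\<Sum>b\<in>{-int R..int R}. exp (- (s * of_int b)\<^sup>2)) = 2 * (s * I) + 2 * (s * (A - I)) - s"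
    by (simp only: algebra_simps mult_1_right)
  moreover have "0 \<le> s * (A - I)" "s * (A - I) \<le> s"
    using AI s mult_left_mono[of "A - I" 1 s] by auto
  moreover have "2 / (s * real R) = 2 * (1 / (s * real R))" "1 / (s * real R) \<ge> 0"
    using s by auto
  ultimately show ?thesis using I_bounds[folded sI] by linarith
qed

section \<open>Digit triples with prescribed sum modulo \<open>g\<close>\<close>

definition cdigit :: "nat \<Rightarrow> int \<Rightarrow> real" where
  "cdigit g d = of_int d - (real g - 1) / 2"

lemma sum_cdigit: "(\<Sum>d\<in>{0..<int g}. cdigit g d) = 0"
proof -
  have "(\<Sum>d\<in>{0..<int g}. cdigit g d) = (\<Sum>d<g. real d - (real g - 1) / 2)"
    by (rule sum.reindex_bij_witness[of _ int nat]) (auto simp: cdigit_def)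
  moreover have "2 * (\<Sum>d<n. real d) = real n * (real n - 1)" for n
    by (induction n) (auto simp: algebra_simps)
  from this[of g] show ?thesis unfolding calculation by (simp add: sum_subtractf)
qed

lemma sum_cdigit_squared: "(\<Sum>d\<in>{0..<int g}. (cdigit g d)\<^sup>2) = real g * digit_var g"
proof -
  have "(\<Sum>d\<in>{0..<int g}. (cdigit g d)\<^sup>2) = (\<Sum>d<g. (real d - (real g - 1) / 2)\<^sup>2)"
    by (rule sum.reindex_bij_witness[of _ int nat]) (auto simp: cdigit_def)
  also have "12 * (\<Sum>d<n. (real d - c)\<^sup>2) = 2 * (real n - 1) * real n * (2 * real n - 1)
      - 12 * c * real n * (real n - 1) + 12 * real n * c\<^sup>2" for n c
    by (induction n) (auto simp: algebra_simps power2_eq_square)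
  from this[of "(real g - 1) / 2" g]
  have "(\<Sum>d<g. (real d - (real g - 1) / 2)\<^sup>2) = real g * digit_var g"
    by (simp add: digit_var_def field_simps power2_eq_square)
  finally show ?thesis .
qed

lemma sum_mod_reflect:
  fixes g :: nat and h :: "int \<Rightarrow> 'a :: comm_monoid_add"
  assumes "g > 0"
  shows "(\<Sum>d\<in>{0..<int g}. h ((m - d) mod int g)) = (\<Sum>d\<in>{0..<int g}. h d)"
  using assms
  by (intro sum.reindex_bij_witness[of _ "\<lambda>d. (m - d) mod int g" "\<lambda>d. (m - d) mod int g"])
     (auto simp: mod_diff_right_eq)

text \<open>The three digits are pairwise independent and uniformly distributed, so the linear and
  quadratic statistics below do not depend on \<open>m\<close>.\<close>

lemma sum_triple_digits:
  fixes g :: nat and b1 b2 b3 :: real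
  assumes "g > 0"
  defines "z \<equiv> (\<lambda>m d1 d2. b1 * cdigit g d1 + b2 * cdigit g d2 + b3 * cdigit g ((m - d1 - d2) mod int g))"
  shows "(\<Sum>d1\<in>{0..<int g}. \<Sum>d2\<in>{0..<int g}. z m d1 d2) = 0"
    and "(\<Sum>d1\<in>{0..<int g}. \<Sum>d2\<in>{0..<int g}. (z m d1 d2)\<^sup>2)
           = (real g)\<^sup>2 * digit_var g * (b1\<^sup>2 + b2\<^sup>2 + b3\<^sup>2)"
proof -
  let ?D = "{0..<int g}"
  let ?y = "cdigit g"
  define y3 where "y3 = (\<lambda>d1 d2. ?y ((m - d1 - d2) mod int g))"
  have r1: "(\<Sum>d2\<in>?D. y3 d1 d2) = 0" for d1
    unfolding y3_def using sum_mod_reflect[OF assms(1), of ?y "m - d1"] sum_cdigit by simp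
  have r2: "(\<Sum>d1\<in>?D. y3 d1 d2) = 0" for d2
    unfolding y3_def using sum_mod_reflect[OF assms(1), of ?y "m - d2"] sum_cdigit
    by (simp add: algebra_simps)
  have q: "(\<Sum>d2\<in>?D. (y3 d1 d2)\<^sup>2) = real g * digit_var g" for d1
    unfolding y3_def using sum_mod_reflect[OF assms(1), of "\<lambda>d. (?y d)\<^sup>2" "m - d1"] sum_cdigit_squared by simp
  have inner: "(\<Sum>d2\<in>?D. z m d1 d2) = real g * (b1 * ?y d1)" for d1
    using r1[unfolded y3_def]
    by (simp add: z_def sum.distrib sum_distrib_left[symmetric] sum_cdigit)
  show "(\<Sum>d1\<in>?D. \<Sum>d2\<in>?D. z m d1 d2) = 0"
    by (simp add: inner sum_distrib_left[symmetric] sum_cdigit)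
  have sq: "(z m d1 d2)\<^sup>2 = b1\<^sup>2 * (?y d1)\<^sup>2 + b2\<^sup>2 * (?y d2)\<^sup>2 + b3\<^sup>2 * (y3 d1 d2)\<^sup>2
      + 2 * b1 * b2 * ?y d1 * ?y d2 + 2 * b1 * b3 * ?y d1 * y3 d1 d2 + 2 * b2 * b3 * (?y d2 * y3 d1 d2)" for d1 d2
    by (simp add: z_def y3_def power2_eq_square algebra_simps)
  have "(\<Sum>d2\<in>?D. (z m d1 d2)\<^sup>2) = real g * b1\<^sup>2 * (?y d1)\<^sup>2 + b2\<^sup>2 * (real g * digit_var g)
      + b3\<^sup>2 * (real g * digit_var g) + 2 * b2 * b3 * (\<Sum>d2\<in>?D. ?y d2 * y3 d1 d2)" for d1
    unfolding sq by (simp add: sum.distrib sum_distrib_left[symmetric] sum_cdigit r1 q sum_cdigit_squared)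
  hence "(\<Sum>d1\<in>?D. \<Sum>d2\<in>?D. (z m d1 d2)\<^sup>2) = real g * b1\<^sup>2 * (real g * digit_var g)
      + real g * (b2\<^sup>2 * (real g * digit_var g)) + real g * (b3\<^sup>2 * (real g * digit_var g))
      + 2 * b2 * b3 * (\<Sum>d1\<in>?D. \<Sum>d2\<in>?D. ?y d2 * y3 d1 d2)"
    by (simp add: sum.distrib sum_distrib_left[symmetric] sum_cdigit_squared)
  \<comment> \<open>Both factors of this cross term depend on d2, so the sum over d1 is taken first:
    for fixed d2 the third digit then runs through all residues.\<close>
  also have "(\<Sum>d1\<in>?D. \<Sum>d2\<in>?D. ?y d2 * y3 d1 d2) = 0"
    by (subst sum.swap) (simp add: sum_distrib_left[symmetric] r2)
  finally show "(\<Sum>d1\<in>?D. \<Sum>d2\<in>?D. (z m d1 d2)\<^sup>2)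
      = (real g)\<^sup>2 * digit_var g * (b1\<^sup>2 + b2\<^sup>2 + b3\<^sup>2)"
    by (simp add: power2_eq_square algebra_simps)
qed

lemma digit_var_bounds:
  assumes "g \<ge> 2"
  shows "digit_var g > 0" "digit_var g \<le> (real g)\<^sup>2 / 12" "digit_var g \<ge> 1 / 4"
proof -
  have "(real g)\<^sup>2 \<ge> 2\<^sup>2" using assms by (intro power_mono) auto
  thus "digit_var g > 0" "digit_var g \<le> (real g)\<^sup>2 / 12" "digit_var g \<ge> 1 / 4"
    by (auto simp: digit_var_def)
qed

lemma pi_less: "pi < 16 / 5"
  using pi_approx by simp

lemma pi_squared_less: "pi\<^sup>2 < 12"
proof -
  have "pi\<^sup>2 < (16 / 5)\<^sup>2" using pi_less by (intro power_strict_mono) auto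
  thus ?thesis by (simp add: power2_eq_square)
qed

text \<open>Second-order model for the average of e(b1 d1 + b2 d2 + b3 d3) over the g^2 admissible
  digit triples at one place: the phase comes from the mean digit (g-1)/2, the Gaussian factor from
  the variance.\<close>

definition step_char :: "nat \<Rightarrow> real \<Rightarrow> real \<Rightarrow> real \<Rightarrow> complex" where
  "step_char g b1 b2 b3 = ee ((real g - 1) / 2 * (b1 + b2 + b3)) *
     of_real (exp (- (2 * pi\<^sup>2 * digit_var g * (b1\<^sup>2 + b2\<^sup>2 + b3\<^sup>2))))"

lemma norm_step_char_le:
  assumes "g \<ge> 2"
  shows "norm (step_char g b1 b2 b3) \<le> 1"
  using digit_var_bounds(1)[OF assms] by (simp add: step_char_def norm_mult)

text \<open>After centring the digits, the Taylor terms of order 0, 1 and 2 sum to g^2 (1 - v)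
  whatever m is, so the dependence on the carry is confined to the cubic remainder. Replacing 1 - v
  by exp(-v) costs at most v^2/2, of order \<delta>^4, weakened to \<delta>^3 by \<delta> \<le>
  1.\<close>

lemma step_char_approx:
  fixes g :: nat
  assumes g: "g \<ge> 2" and b: "\<bar>b1\<bar> \<le> \<delta>" "\<bar>b2\<bar> \<le> \<delta>" "\<bar>b3\<bar> \<le> \<delta>" and \<delta>: "\<delta> \<le> 1"
  shows "norm ((\<Sum>d1\<in>{0..<int g}. \<Sum>d2\<in>{0..<int g}.
             ee (b1 * of_int d1 + b2 * of_int d2 + b3 * of_int ((m - d1 - d2) mod int g)))
           - (real g)\<^sup>2 * step_char g b1 b2 b3) \<le> (real g)\<^sup>2 * (200 * real g ^ 4 * \<delta> ^ 3)"
proof -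
  let ?D = "{0..<int g}"
  define z where "z = (\<lambda>d1 d2. b1 * cdigit g d1 + b2 * cdigit g d2 + b3 * cdigit g ((m - d1 - d2) mod int g))"
  define p where "p = (real g - 1) / 2 * (b1 + b2 + b3)"
  define v where "v = 2 * pi\<^sup>2 * digit_var g * (b1\<^sup>2 + b2\<^sup>2 + b3\<^sup>2)"
  have \<delta>0: "\<delta> \<ge> 0" using b(1) by linarith
  have gpos: "g > 0" using g by simp
  have dist: "(\<Sum>d1\<in>?D. \<Sum>d2\<in>?D. c * F d1 d2) = c * (\<Sum>d1\<in>?D. \<Sum>d2\<in>?D. F d1 d2)"
    for c :: complex and F by (simp only: sum_distrib_left)
  have "b1 * of_int d1 + b2 * of_int d2 + b3 * of_int ((m - d1 - d2) mod int g) = p + z d1 d2" for d1 d2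
    by (simp add: p_def z_def cdigit_def field_simps)
  hence split: "(\<Sum>d1\<in>?D. \<Sum>d2\<in>?D. ee (b1 * of_int d1 + b2 * of_int d2 + b3 * of_int ((m - d1 - d2) mod int g)))
      = ee p * (\<Sum>d1\<in>?D. \<Sum>d2\<in>?D. ee (z d1 d2))"
    by (simp only: ee_add dist)
  \<comment> \<open>Three centred digits of size at most g/2, frequencies at most \<delta> and 2 pi
    < 32/5 give 9.6 g \<delta>.\<close>
  have zb: "\<bar>2 * pi * z d1 d2\<bar> \<le> 10 * real g * \<delta>" if "d1 \<in> ?D" "d2 \<in> ?D" for d1 d2
  proof -
    have y: "\<bar>cdigit g d\<bar> \<le> real g / 2" if "d \<in> ?D" for d
    proof -
      have "0 \<le> real_of_int d" "real_of_int d \<le> real g - 1" using that by auto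
      thus ?thesis unfolding cdigit_def by (simp add: abs_le_iff field_simps)
    qed
    have bd: "\<bar>b * cdigit g d\<bar> \<le> \<delta> * (real g / 2)" if "\<bar>b\<bar> \<le> \<delta>" "d \<in> ?D" for b d
      unfolding abs_mult by (intro mult_mono that y \<delta>0) simp
    have "(m - d1 - d2) mod int g \<in> ?D" using gpos by simp
    hence "\<bar>b1 * cdigit g d1\<bar> \<le> \<delta> * (real g / 2)" "\<bar>b2 * cdigit g d2\<bar> \<le> \<delta> * (real g / 2)"
      "\<bar>b3 * cdigit g ((m - d1 - d2) mod int g)\<bar> \<le> \<delta> * (real g / 2)"
      using that b by (blast intro: bd)+
    hence "\<bar>z d1 d2\<bar> \<le> 3 * (\<delta> * (real g / 2))" unfolding z_def by linarith
    hence "2 * pi * \<bar>z d1 d2\<bar> \<le> 2 * (16 / 5) * (3 * (\<delta> * (real g / 2)))"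
      using pi_less \<delta>0 by (intro mult_mono) auto
    also have "\<dots> \<le> 10 * real g * \<delta>" using \<delta>0 by simp
    finally show ?thesis by (simp add: abs_mult)
  qed
  have "norm ((\<Sum>d1\<in>?D. \<Sum>d2\<in>?D. ee (z d1 d2)) - of_real ((real g)\<^sup>2 * (1 - v)))
      = norm (\<Sum>d1\<in>?D. \<Sum>d2\<in>?D. ee (z d1 d2) - (1 + \<i> * of_real (2 * pi * z d1 d2) - of_real ((2 * pi * z d1 d2)\<^sup>2 / 2)))"
  proof -
    have "(\<Sum>d1\<in>?D. \<Sum>d2\<in>?D. 1 + \<i> * complex_of_real (2 * pi * z d1 d2) - of_real ((2 * pi * z d1 d2)\<^sup>2 / 2))
       = of_nat (g * g) + \<i> * of_real (2 * pi * (\<Sum>d1\<in>?D. \<Sum>d2\<in>?D. z d1 d2))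
          - of_real (2 * pi\<^sup>2 * (\<Sum>d1\<in>?D. \<Sum>d2\<in>?D. (z d1 d2)\<^sup>2))"
      by (simp add: sum.distrib sum_subtractf sum_distrib_left power_mult_distrib mult.assoc)
    also have "\<dots> = of_real ((real g)\<^sup>2 * (1 - v))"
      unfolding z_def sum_triple_digits[OF gpos] v_def by (simp add: power2_eq_square algebra_simps)
    finally show ?thesis by (simp only: sum_subtractf)
  qed
  also have "\<dots> \<le> (\<Sum>d1\<in>?D. \<Sum>d2\<in>?D. (10 * real g * \<delta>) ^ 3 / 6)"
  proof (intro sum_norm_le)
    fix d1 d2 assume d: "d1 \<in> ?D" "d2 \<in> ?D"
    define w where "w = 2 * pi * z d1 d2"
    have "(\<Sum>k\<le>2. (\<i> * complex_of_real w) ^ k / fact k) = 1 + \<i> * of_real w - of_real (w\<^sup>2 / 2)"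
      by (simp add: numeral_2_eq_2 power_mult_distrib)
    hence "norm (ee (z d1 d2) - (1 + \<i> * of_real w - of_real (w\<^sup>2 / 2))) \<le> \<bar>w\<bar> ^ 3 / 6"
      using iexp_approx1[of w 2] by (simp add: ee_def cis_conv_exp w_def fact_numeral eval_nat_numeral)
    also have "\<dots> \<le> (10 * real g * \<delta>) ^ 3 / 6"
      using zb[OF d] by (intro divide_right_mono power_mono) (auto simp: w_def)
    finally show "norm (ee (z d1 d2) - (1 + \<i> * of_real (2 * pi * z d1 d2) - of_real ((2 * pi * z d1 d2)\<^sup>2 / 2)))
        \<le> (10 * real g * \<delta>) ^ 3 / 6" by (simp only: w_def)
  qed
  also have "\<dots> = (real g)\<^sup>2 * ((10 * real g * \<delta>) ^ 3 / 6)" by (simp add: power2_eq_square)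
  finally have e1: "norm ((\<Sum>d1\<in>?D. \<Sum>d2\<in>?D. ee (z d1 d2)) - of_real ((real g)\<^sup>2 * (1 - v)))
      \<le> (real g)\<^sup>2 * ((10 * real g * \<delta>) ^ 3 / 6)" .
  have v0: "v \<ge> 0" using digit_var_bounds(1)[OF g] by (simp add: v_def)
  have vb: "v \<le> 6 * (real g)\<^sup>2 * \<delta>\<^sup>2"
  proof -
    have "b\<^sup>2 \<le> \<delta>\<^sup>2" if "\<bar>b\<bar> \<le> \<delta>" for b using power_mono[OF that, of 2] by simp
    hence "b1\<^sup>2 + b2\<^sup>2 + b3\<^sup>2 \<le> 3 * \<delta>\<^sup>2" using b by (smt (verit))
    hence "v \<le> 2 * 12 * ((real g)\<^sup>2 / 12) * (3 * \<delta>\<^sup>2)"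
      unfolding v_def using pi_squared_less digit_var_bounds[OF g] by (intro mult_mono) auto
    thus ?thesis by simp
  qed
  have e2: "\<bar>exp (- v) - (1 - v)\<bar> \<le> 18 * real g ^ 4 * \<delta> ^ 3"
  proof -
    have "\<bar>exp (- v) - (1 - v)\<bar> \<le> v\<^sup>2 / 2"
    proof -
      have "exp (- v) \<ge> 1 - v" using exp_ge_add_one_self[of "- v"] by simp
      moreover have "exp (- v) \<le> 1 - v + v\<^sup>2 / 2"
      proof -
        have d: "((\<lambda>x. 1 - x + x\<^sup>2 / 2 - exp (- x)) has_real_derivative (-1 + x + exp (- x))) (at x)" for x :: real
          by (auto intro!: derivative_eq_intros)
        have "1 - 0 + 0\<^sup>2 / 2 - exp (- 0) \<le> 1 - v + v\<^sup>2 / 2 - exp (- v)"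
        proof (rule DERIV_nonneg_imp_nondecreasing[OF v0])
          fix x :: real
          show "\<exists>y. ((\<lambda>x. 1 - x + x\<^sup>2 / 2 - exp (- x)) has_real_derivative y) (at x) \<and> 0 \<le> y"
            using d[of x] exp_ge_add_one_self[of "- x"] by (intro exI[of _ "-1 + x + exp (- x)"]) auto
        qed
        thus ?thesis by simp
      qed
      ultimately show ?thesis by simp
    qed
    also have "\<dots> \<le> (6 * (real g)\<^sup>2 * \<delta>\<^sup>2)\<^sup>2 / 2"
      using v0 vb by (intro divide_right_mono power_mono) auto
    also have "\<dots> = 18 * real g ^ 4 * (\<delta> ^ 3 * \<delta>)" by (simp add: power2_eq_square eval_nat_numeral)
    also have "\<dots> \<le> 18 * real g ^ 4 * (\<delta> ^ 3 * 1)"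
      using \<delta> \<delta>0 by (intro mult_left_mono) auto
    finally show ?thesis by simp
  qed
  have "(\<Sum>d1\<in>?D. \<Sum>d2\<in>?D. ee (b1 * of_int d1 + b2 * of_int d2 + b3 * of_int ((m - d1 - d2) mod int g)))
           - (real g)\<^sup>2 * step_char g b1 b2 b3
      = ee p * (((\<Sum>d1\<in>?D. \<Sum>d2\<in>?D. ee (z d1 d2)) - of_real ((real g)\<^sup>2 * (1 - v)))
                + of_real ((real g)\<^sup>2 * ((1 - v) - exp (- v))))"
    unfolding split by (simp add: step_char_def p_def v_def algebra_simps)
  also have "norm \<dots> \<le> norm ((\<Sum>d1\<in>?D. \<Sum>d2\<in>?D. ee (z d1 d2)) - of_real ((real g)\<^sup>2 * (1 - v)))
      + norm (complex_of_real ((real g)\<^sup>2 * ((1 - v) - exp (- v))))"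
    unfolding norm_mult[of "ee p"] by (simp only: norm_ee mult_1_left norm_triangle_ineq)
  also have "\<dots> \<le> (real g)\<^sup>2 * ((10 * real g * \<delta>) ^ 3 / 6) + (real g)\<^sup>2 * (18 * real g ^ 4 * \<delta> ^ 3)"
  proof (rule add_mono[OF e1])
    have "norm (complex_of_real ((real g)\<^sup>2 * ((1 - v) - exp (- v)))) = (real g)\<^sup>2 * \<bar>exp (- v) - (1 - v)\<bar>"
      by (simp only: norm_of_real abs_mult abs_minus_commute) simp
    also have "\<dots> \<le> (real g)\<^sup>2 * (18 * real g ^ 4 * \<delta> ^ 3)"
      by (intro mult_left_mono e2) simp
    finally show "norm (complex_of_real ((real g)\<^sup>2 * ((1 - v) - exp (- v)))) \<le> \<dots>" .
  qed
  also have "\<dots> = (real g)\<^sup>2 * (1000 / 6 * (real g ^ 3 * \<delta> ^ 3) + 18 * real g ^ 4 * \<delta> ^ 3)"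
    by (simp add: power_mult_distrib algebra_simps)
  also have "\<dots> \<le> (real g)\<^sup>2 * (200 * real g ^ 4 * \<delta> ^ 3)"
  proof (rule mult_left_mono)
    have "real g ^ 3 * \<delta> ^ 3 \<le> real g ^ 4 * \<delta> ^ 3"
      using g \<delta>0 by (intro mult_right_mono power_increasing) auto
    moreover have "real g ^ 4 * \<delta> ^ 3 \<ge> 0" using \<delta>0 by simp
    ultimately show "1000 / 6 * (real g ^ 3 * \<delta> ^ 3) + 18 * real g ^ 4 * \<delta> ^ 3 \<le> 200 * real g ^ 4 * \<delta> ^ 3"
      by linarith
  qed simp
  finally show ?thesis .
qed

section \<open>The transfer recursion\<close>

text \<open>Integer targets are needed because removing the last digits replaces m by (m - d1 - d2)
  div g, which may be negative; the set is then empty.\<close>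

definition itriples :: "int \<Rightarrow> (nat \<times> nat \<times> nat) set" where
  "itriples m = {(a, b, c). int a + int b + int c = m}"

lemma itriples_of_nat: "itriples (int M) = triples M"
  by (auto simp: itriples_def triples_def)

lemma finite_itriples [simp]: "finite (itriples m)"
proof -
  have "itriples m \<subseteq> triples (nat m)" by (auto simp: itriples_def triples_def)
  thus ?thesis by (rule finite_subset) simp
qed

definition triple_sum :: "nat \<Rightarrow> real \<Rightarrow> real \<Rightarrow> real \<Rightarrow> int \<Rightarrow> complex" where
  "triple_sum g b1 b2 b3 m = (\<Sum>(a, b, c)\<in>itriples m.
     ee (b1 * real (digit_sum g a) + b2 * real (digit_sum g b) + b3 * real (digit_sum g c)))"

text \<open>The last digits of a and b are free, that of c is forced to be the residue of m - d1 -
  d2 modulo g, and the three quotients by g add up to (m - d1 - d2) div g, which incorporates the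
  carry.\<close>

lemma triple_sum_rec:
  assumes g: "g \<ge> 2"
  shows "triple_sum g b1 b2 b3 m = (\<Sum>d1\<in>{0..<int g}. \<Sum>d2\<in>{0..<int g}.
           ee (b1 * of_int d1 + b2 * of_int d2 + b3 * of_int ((m - d1 - d2) mod int g))
             * triple_sum g b1 b2 b3 ((m - d1 - d2) div int g))"
proof -
  let ?D = "{0..<int g}"
  let ?s = "\<lambda>n. real (digit_sum g n)"
  let ?e = "\<lambda>d1 d2. ee (b1 * of_int d1 + b2 * of_int d2 + b3 * of_int ((m - d1 - d2) mod int g))"
  let ?w = "\<lambda>(a, b, c). ee (b1 * ?s a + b2 * ?s b + b3 * ?s c)"
  define \<Omega> where "\<Omega> = (SIGMA d:?D \<times> ?D. itriples ((m - fst d - snd d) div int g))"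
  define enc where "enc = (\<lambda>(a, b, c). ((int (a mod g), int (b mod g)), (a div g, b div g, c div g)))"
  define dec where "dec = (\<lambda>((d1 :: int, d2 :: int), (a, b, c)).
     (nat d1 + g * a, nat d2 + g * b, nat ((m - d1 - d2) mod int g) + g * c))"
  have gpos: "g > 0" using g by simp
  have carry: "(m - int (a mod g) - int (b mod g)) mod int g = int (c mod g) \<and>
      (m - int (a mod g) - int (b mod g)) div int g = int (a div g) + int (b div g) + int (c div g)"
    if "int a + int b + int c = m" for a b c
  proof -
    define A where "A = int (a div g) + int (b div g) + int (c div g)"
    have "int n = int (n mod g) + int g * int (n div g)" for n
      by (metis mod_mult_div_eq of_nat_add of_nat_mult)
    from this[of a] this[of b] this[of c]
    have eq: "m - int (a mod g) - int (b mod g) = int (c mod g) + A * int g"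
      unfolding that[symmetric] A_def by (simp add: algebra_simps)
    have "0 \<le> int (c mod g)" "int (c mod g) < int g" using gpos by auto
    thus ?thesis unfolding eq A_def[symmetric] by simp
  qed
  have digits: "digit_sum g (nat d + g * n) = nat d + digit_sum g n" if "d \<in> ?D" for d n
    using that by (intro digit_sum_step g) auto
  have "triple_sum g b1 b2 b3 m = (\<Sum>x\<in>itriples m. ?w x)" by (simp add: triple_sum_def)
  also have "\<dots> = (\<Sum>(d, x)\<in>\<Omega>. ?e (fst d) (snd d) * ?w x)"
  proof (rule sum.reindex_bij_witness[of _ dec enc])
    fix x assume "x \<in> itriples m"
    then obtain a b c where x: "x = (a, b, c)" and sum: "int a + int b + int c = m"
      by (auto simp: itriples_def)
    note car = carry[OF sum]
    show "dec (enc x) = x"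
      using car by (simp add: x enc_def dec_def)
    show "enc x \<in> \<Omega>"
      using car gpos by (simp add: x enc_def \<Omega>_def itriples_def)
    have "b1 * ?s a + b2 * ?s b + b3 * ?s c
        = (b1 * of_int (int (a mod g)) + b2 * of_int (int (b mod g)) + b3 * of_int (int (c mod g)))
          + (b1 * ?s (a div g) + b2 * ?s (b div g) + b3 * ?s (c div g))"
    proof -
      have "?s n = real (n mod g) + ?s (n div g)" for n
        using digit_sum_step[OF g, of "n mod g" "n div g"] gpos by simp
      from this[of a] this[of b] this[of c] show ?thesis
        by (simp only: distrib_left of_int_of_nat_eq add_ac)
    qed
    thus "(case enc x of (d, x) \<Rightarrow> ?e (fst d) (snd d) * ?w x) = ?w x"
      using car by (simp add: x enc_def flip: ee_add)
  next
    fix y assume "y \<in> \<Omega>"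
    then obtain d1 d2 a b c where y: "y = ((d1, d2), (a, b, c))"
      and d: "d1 \<in> ?D" "d2 \<in> ?D" and abc: "int a + int b + int c = (m - d1 - d2) div int g"
      by (auto simp: \<Omega>_def itriples_def)
    define d3 where "d3 = (m - d1 - d2) mod int g"
    have d3: "d3 \<in> ?D" using gpos by (simp add: d3_def)
    have md: "int ((nat e + g * n) mod g) = e" "(nat e + g * n) div g = n" if "e \<in> ?D" for e n
    proof -
      have "nat e < g" using that by (auto simp: nat_less_iff)
      thus "int ((nat e + g * n) mod g) = e" "(nat e + g * n) div g = n" using that by auto
    qed
    show "enc (dec y) = y"
      using d d3 by (simp only: y enc_def dec_def d3_def[symmetric] md prod.case)
    have "m - d1 - d2 = int g * (int a + int b + int c) + d3"
      unfolding abc d3_def by simp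
    hence "int (nat d1 + g * a) + int (nat d2 + g * b) + int (nat d3 + g * c) = m"
      using d d3 by (simp add: distrib_left)
    thus "dec y \<in> itriples m"
      by (simp only: y dec_def itriples_def d3_def[symmetric] prod.case mem_Collect_eq)
  qed
  also have "\<dots> = (\<Sum>d\<in>?D \<times> ?D. \<Sum>x\<in>itriples ((m - fst d - snd d) div int g). ?e (fst d) (snd d) * ?w x)"
    unfolding \<Omega>_def by (subst sum.Sigma) auto
  also have "\<dots> = (\<Sum>d1\<in>?D. \<Sum>d2\<in>?D. \<Sum>x\<in>itriples ((m - d1 - d2) div int g). ?e d1 d2 * ?w x)"
    by (simp add: sum.cartesian_product case_prod_unfold)
  also have "\<dots> = (\<Sum>d1\<in>?D. \<Sum>d2\<in>?D. ?e d1 d2 * triple_sum g b1 b2 b3 ((m - d1 - d2) div int g))"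
    by (simp only: triple_sum_def sum_distrib_left)
  finally show ?thesis .
qed

text \<open>The transfer operators map the constant function to a nearly constant one and do not
  increase the supremum norm, so the errors of the individual digits merely add up.\<close>

lemma triple_sum_approx_scale:
  fixes A B m :: int and \<phi> T :: complex
  assumes g: "g \<ge> 2" and \<phi>: "norm \<phi> \<le> 1"
    and step: "\<And>m. norm ((\<Sum>d1\<in>{0..<int g}. \<Sum>d2\<in>{0..<int g}.
             ee (b1 * of_int d1 + b2 * of_int d2 + b3 * of_int ((m - d1 - d2) mod int g)))
           - (real g)\<^sup>2 * \<phi>) \<le> (real g)\<^sup>2 * \<epsilon>"
    and top: "\<And>m. A \<le> m \<Longrightarrow> m \<le> B \<Longrightarrow> norm (triple_sum g b1 b2 b3 m - T) \<le> E"
    and m: "int g ^ J * A + 2 * (int g ^ J - 1) \<le> m" "m < int g ^ J * (B + 1)"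
  shows "norm (triple_sum g b1 b2 b3 m - (real g)\<^sup>2 ^ J * \<phi> ^ J * T)
           \<le> (real g)\<^sup>2 ^ J * (E + real J * \<epsilon> * norm T)"
  using m
proof (induction J arbitrary: m)
  case 0
  thus ?case using top[of m] by simp
next
  case (Suc J)
  let ?D = "{0..<int g}"
  let ?e = "\<lambda>d1 d2. ee (b1 * of_int d1 + b2 * of_int d2 + b3 * of_int ((m - d1 - d2) mod int g))"
  let ?V = "triple_sum g b1 b2 b3"
  define X where "X = (real g)\<^sup>2 ^ J * \<phi> ^ J * T"
  define F where "F = (real g)\<^sup>2 ^ J * (E + real J * \<epsilon> * norm T)"
  have gpos: "int g > 0" using g by simp
  have eps: "\<epsilon> \<ge> 0"
  proof -
    have "0 \<le> (real g)\<^sup>2 * \<epsilon>" using step norm_ge_zero order_trans by blast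
    thus ?thesis using g by (simp add: zero_le_mult_iff)
  qed
  have IH: "norm (?V ((m - d1 - d2) div int g) - X) \<le> F" if "d1 \<in> ?D" "d2 \<in> ?D" for d1 d2
    unfolding X_def F_def
  proof (rule Suc.IH)
    \<comment> \<open>Removing two digits lowers m by at most 2(g-1) before the division by g. Over
      J steps this amounts to 2(g-1)(1 + g + ... + g^(J-1)) = 2(g^J - 1), the margin in the
      hypothesis, so the argument ends up between A and B.\<close>
    have "(int g ^ J * A + 2 * (int g ^ J - 1)) * int g \<le> m - d1 - d2"
    proof -
      have "(int g ^ J * A + 2 * (int g ^ J - 1)) * int g
          = int g ^ Suc J * A + 2 * (int g ^ Suc J - 1) - 2 * (int g - 1)"
        by (simp add: algebra_simps)
      thus ?thesis using Suc.prems(1) that by auto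
    qed
    thus "int g ^ J * A + 2 * (int g ^ J - 1) \<le> (m - d1 - d2) div int g"
      using gpos zdiv_mono1[of "(int g ^ J * A + 2 * (int g ^ J - 1)) * int g" "m - d1 - d2" "int g"] by simp
    have "m - d1 - d2 < (int g ^ J * (B + 1)) * int g"
      using Suc.prems(2) that by (simp add: algebra_simps)
    moreover have "(m - d1 - d2) div int g * int g \<le> m - d1 - d2"
      using gpos by (simp flip: minus_mod_eq_div_mult)
    ultimately have "(m - d1 - d2) div int g * int g < (int g ^ J * (B + 1)) * int g"
      by (rule order.strict_trans1[rotated])
    thus "(m - d1 - d2) div int g < int g ^ J * (B + 1)"
      using gpos by (simp only: mult_less_cancel_right_pos)
  qed
  have const: "(\<Sum>d1\<in>?D. \<Sum>d2\<in>?D. c) = (real g)\<^sup>2 * c" for c :: real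
    by (simp add: power2_eq_square)
  have expand: "(\<Sum>d1\<in>?D. \<Sum>d2\<in>?D. ?e d1 d2 * (?V ((m - d1 - d2) div int g) - X))
      = ?V m - (\<Sum>d1\<in>?D. \<Sum>d2\<in>?D. ?e d1 d2) * X"
    unfolding triple_sum_rec[OF g, of b1 b2 b3 m]
    by (simp only: right_diff_distrib sum_subtractf sum_distrib_right)
  \<comment> \<open>The first part is the transfer operator applied to the error of the shorter
    problem; the second measures how far the constant function is from being an eigenfunction with
    eigenvalue g^2 \<phi>.\<close>
  have "?V m - (real g)\<^sup>2 ^ Suc J * \<phi> ^ Suc J * T
      = (\<Sum>d1\<in>?D. \<Sum>d2\<in>?D. ?e d1 d2 * (?V ((m - d1 - d2) div int g) - X))
        + ((\<Sum>d1\<in>?D. \<Sum>d2\<in>?D. ?e d1 d2) - (real g)\<^sup>2 * \<phi>) * X"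
    unfolding expand left_diff_distrib by (simp add: X_def)
  also have "norm \<dots> \<le> (real g)\<^sup>2 * F + (real g)\<^sup>2 * \<epsilon> * norm X"
  proof (intro norm_triangle_le add_mono)
    show "norm (\<Sum>d1\<in>?D. \<Sum>d2\<in>?D. ?e d1 d2 * (?V ((m - d1 - d2) div int g) - X)) \<le> (real g)\<^sup>2 * F"
      unfolding const[symmetric] using IH by (intro sum_norm_le) (simp add: norm_mult)
    show "norm (((\<Sum>d1\<in>?D. \<Sum>d2\<in>?D. ?e d1 d2) - (real g)\<^sup>2 * \<phi>) * X) \<le> (real g)\<^sup>2 * \<epsilon> * norm X"
      unfolding norm_mult by (intro mult_right_mono step) auto
  qed
  also have "\<dots> \<le> (real g)\<^sup>2 * F + (real g)\<^sup>2 * \<epsilon> * ((real g)\<^sup>2 ^ J * norm T)"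
  proof -
    have "norm X = (real g)\<^sup>2 ^ J * (norm \<phi> ^ J * norm T)"
      by (simp add: X_def norm_mult norm_power)
    also have "\<dots> \<le> (real g)\<^sup>2 ^ J * (1 * norm T)"
      using \<phi> by (intro mult_left_mono mult_right_mono power_le_one) auto
    finally show ?thesis using eps by (intro add_left_mono mult_left_mono) auto
  qed
  also have "\<dots> = (real g)\<^sup>2 ^ Suc J * (E + real (Suc J) * \<epsilon> * norm T)"
    by (simp add: F_def algebra_simps)
  finally show ?case .
qed

section \<open>Starting values of the recursion and the region near the origin\<close>

lemma card_triples: "2 * card (triples m) = (m + 1) * (m + 2)"
proof -
  have eq: "triples m = (SIGMA a:{..m}. (\<lambda>b. (b, m - a - b)) ` {..m - a})"
    by (auto simp: triples_def image_iff)
  have "card (triples m) = (\<Sum>a\<le>m. card ((\<lambda>b. (b, m - a - b)) ` {..m - a}))"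
    unfolding eq by (subst card_SigmaI) auto
  also have "\<dots> = (\<Sum>a\<le>m. m - a + 1)"
    by (intro sum.cong refl, subst card_image) (auto simp: inj_on_def)
  also have "\<dots> = (\<Sum>a\<le>m. a + 1)"
    by (rule sum.reindex_bij_witness[of _ "\<lambda>a. m - a" "\<lambda>a. m - a"]) auto
  also have "2 * (\<Sum>a\<le>m. a + 1) = (m + 1) * (m + 2)"
    by (induction m) auto
  finally show ?thesis .
qed

text \<open>No cancellation is sought in the leading digits: the digit sums are at most g u, so
  every phase is 1 up to 20 g u \<delta>, and the number of triples is about B^2/2. The range from
  B-2 to B covers every carry that three summands can send into this block.\<close>

lemma triple_sum_top:
  fixes B :: nat
  assumes g: "g \<ge> 2" and b: "\<bar>b1\<bar> \<le> \<delta>" "\<bar>b2\<bar> \<le> \<delta>" "\<bar>b3\<bar> \<le> \<delta>"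
    and B: "B \<ge> 2" "B < g ^ u" and m: "int B - 2 \<le> m" "m \<le> int B"
  shows "norm (triple_sum g b1 b2 b3 m - of_real ((real B)\<^sup>2 / 2))
           \<le> 3 * real B + 60 * real g * real u * \<delta> * (real B)\<^sup>2"
proof -
  define n where "n = nat m"
  have n: "m = int n" "n \<le> B" "B \<le> n + 2" using m B by (auto simp: n_def)
  have \<delta>0: "\<delta> \<ge> 0" using b(1) by linarith
  define c where "c = real (card (triples n))"
  have c: "2 * c = (real n + 1) * (real n + 2)"
  proof -
    have "real (2 * card (triples n)) = real ((n + 1) * (n + 2))" by (simp only: card_triples)
    thus ?thesis by (simp add: c_def algebra_simps)
  qed
  have c1: "c \<le> 3 * (real B)\<^sup>2"
  proof -
    have "(real n + 1) * (real n + 2) \<le> (2 * real B) * (3 * real B)"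
      using n B by (intro mult_mono) auto
    thus ?thesis using c by (simp add: power2_eq_square)
  qed
  have c2: "\<bar>c - (real B)\<^sup>2 / 2\<bar> \<le> 3 * real B"
  proof -
    consider "B = n" | "B = n + 1" | "B = n + 2" using n by linarith
    hence "2 * c = (real B)\<^sup>2 + 3 * real B + 2 \<or> 2 * c = (real B)\<^sup>2 + real B \<or> 2 * c = (real B)\<^sup>2 - real B"
      unfolding c by cases (simp_all add: power2_eq_square algebra_simps)
    thus ?thesis using B(1) by (auto simp: abs_le_iff)
  qed
  have "triple_sum g b1 b2 b3 m - of_real c = (\<Sum>(x, y, z)\<in>triples n.
      ee (b1 * real (digit_sum g x) + b2 * real (digit_sum g y) + b3 * real (digit_sum g z)) - 1)"
    by (simp add: triple_sum_def n(1) itriples_of_nat c_def case_prod_unfold sum_subtractf)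
  also have "norm \<dots> \<le> (\<Sum>x\<in>triples n. 20 * real g * real u * \<delta>)"
  proof (rule sum_norm_le, clarify)
    fix x y z assume xyz: "(x, y, z) \<in> triples n"
    have s: "real (digit_sum g w) \<le> real g * real u" if "w \<le> n" for w
    proof -
      have "digit_sum g w \<le> (g - 1) * u" using that n B by (intro digit_sum_le g) auto
      also have "\<dots> \<le> g * u" by simp
      finally show ?thesis by (simp flip: of_nat_mult)
    qed
    have bs: "\<bar>b * real (digit_sum g w)\<bar> \<le> \<delta> * (real g * real u)" if "\<bar>b\<bar> \<le> \<delta>" "w \<le> n" for b w
      unfolding abs_mult using that s \<delta>0 by (intro mult_mono) auto
    have "x \<le> n" "y \<le> n" "z \<le> n" using xyz by (auto simp: triples_def)
    hence "\<bar>b1 * real (digit_sum g x) + b2 * real (digit_sum g y) + b3 * real (digit_sum g z)\<bar>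
        \<le> 3 * (\<delta> * (real g * real u))"
      using bs[OF b(1), of x] bs[OF b(2), of y] bs[OF b(3), of z] by linarith
    hence "2 * pi * \<bar>b1 * real (digit_sum g x) + b2 * real (digit_sum g y) + b3 * real (digit_sum g z) - 0\<bar>
        \<le> 2 * (10 / 3) * (3 * (\<delta> * (real g * real u)))"
      using pi_less \<delta>0 by (intro mult_mono) auto
    from order.trans[OF norm_ee_diff_le this]
    show "norm (ee (b1 * real (digit_sum g x) + b2 * real (digit_sum g y) + b3 * real (digit_sum g z)) - 1)
        \<le> 20 * real g * real u * \<delta>" by (simp add: mult_ac)
  qed
  also have "\<dots> = c * (20 * real g * real u * \<delta>)" by (simp add: c_def)
  also have "\<dots> \<le> (3 * (real B)\<^sup>2) * (20 * real g * real u * \<delta>)"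
    using c1 \<delta>0 by (intro mult_right_mono) auto
  finally have "norm (triple_sum g b1 b2 b3 m - of_real c) \<le> 60 * real g * real u * \<delta> * (real B)\<^sup>2"
    by (simp add: mult_ac)
  moreover have "norm (complex_of_real c - of_real ((real B)\<^sup>2 / 2)) \<le> 3 * real B"
    using c2 by (metis norm_of_real of_real_diff)
  ultimately show ?thesis
    using norm_triangle_ineq[of "triple_sum g b1 b2 b3 m - of_real c" "of_real c - of_real ((real B)\<^sup>2 / 2)"]
    by simp
qed

text \<open>The J = K - t lower digits go through the recursion; the top block, with B = M div g^J,
  is counted. The term 5 g / g^t collects errors of order g^(2J) B, from the count of top triples
  and from replacing g^J B by M; their relative size is 1/B \<le> g / g^t.\<close>

lemma triple_sum_major:
  assumes g: "g \<ge> 2" and b: "\<bar>b1\<bar> \<le> \<delta>" "\<bar>b2\<bar> \<le> \<delta>" "\<bar>b3\<bar> \<le> \<delta>" and \<delta>: "\<delta> \<le> 1"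
    and t: "t \<ge> 2" "t \<le> K" and M: "g ^ (K - 1) < M" "M \<le> g ^ K"
  shows "norm (triple_sum g b1 b2 b3 (int M) - step_char g b1 b2 b3 ^ (K - t) * of_real ((real M)\<^sup>2 / 2))
           \<le> (real M)\<^sup>2 * (5 * real g / real g ^ t + 60 * real g * real (Suc t) * \<delta>
                + 100 * real g ^ 4 * (real K * \<delta> ^ 3))"
proof -
  define J where "J = K - t"
  define B where "B = M div g ^ J"
  define r where "r = M mod g ^ J"
  define G where "G = real g ^ J"
  define \<phi> where "\<phi> = step_char g b1 b2 b3"
  define \<epsilon> where "\<epsilon> = 200 * real g ^ 4 * \<delta> ^ 3"
  define E where "E = 3 * real B + 60 * real g * real (Suc t) * \<delta> * (real B)\<^sup>2"
  have \<delta>0: "\<delta> \<ge> 0" using b(1) by linarith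
  have gpos: "g > 0" using g by simp
  have K: "K - 1 = J + (t - 1)" "K = J + t" using t by (auto simp: J_def)
  have M_eq: "M = g ^ J * B + r" by (simp add: B_def r_def)
  have r: "r < g ^ J" using gpos by (simp add: r_def)
  have Blo: "g ^ (t - 1) \<le> B"
  proof -
    have "g ^ (t - 1) = (g ^ J * g ^ (t - 1)) div g ^ J" using gpos by simp
    also have "\<dots> \<le> B" unfolding B_def using M(1) by (intro div_le_mono) (simp only: K(1) power_add less_imp_le)
    finally show ?thesis .
  qed
  have Bhi: "B < g ^ Suc t"
  proof -
    have "B \<le> (g ^ J * g ^ t) div g ^ J"
      unfolding B_def using M(2) by (intro div_le_mono) (simp add: K(2) power_add)
    also have "\<dots> = g ^ t" using gpos by simp
    also have "\<dots> < g ^ Suc t" using g by simp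
    finally show ?thesis .
  qed
  have B2: "B \<ge> 2"
  proof -
    have "g ^ 1 \<le> g ^ (t - 1)" using t gpos by (intro power_increasing) auto
    thus ?thesis using Blo g by simp
  qed
  have GJ: "(real g)\<^sup>2 ^ J = G\<^sup>2" by (simp add: G_def power2_eq_square power_mult_distrib)
  have MG: "real M = G * real B + real r" "real r < G"
    using M_eq r by (auto simp: G_def simp flip: of_nat_power of_nat_mult of_nat_add)
  have G0: "G > 0" using gpos by (simp add: G_def)
  have GB: "G * real B \<le> real M" using MG(1) by simp
  have bound1: "norm (triple_sum g b1 b2 b3 (int M) - (real g)\<^sup>2 ^ J * \<phi> ^ J * of_real ((real B)\<^sup>2 / 2))
      \<le> (real g)\<^sup>2 ^ J * (E + real J * \<epsilon> * norm (complex_of_real ((real B)\<^sup>2 / 2)))"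
  proof (rule triple_sum_approx_scale[OF g, where A = "int B - 2" and B = "int B"])
    show "norm \<phi> \<le> 1" unfolding \<phi>_def by (rule norm_step_char_le[OF g])
    show "norm ((\<Sum>d1\<in>{0..<int g}. \<Sum>d2\<in>{0..<int g}.
             ee (b1 * of_int d1 + b2 * of_int d2 + b3 * of_int ((m - d1 - d2) mod int g)))
           - (real g)\<^sup>2 * \<phi>) \<le> (real g)\<^sup>2 * \<epsilon>" for m
      unfolding \<phi>_def \<epsilon>_def by (rule step_char_approx[OF g b \<delta>])
    show "norm (triple_sum g b1 b2 b3 m - of_real ((real B)\<^sup>2 / 2)) \<le> E"
      if "int B - 2 \<le> m" "m \<le> int B" for m
      unfolding E_def by (rule triple_sum_top[OF g b B2 Bhi that])
    have Mi: "int M = int g ^ J * int B + int r" unfolding M_eq by simp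
    \<comment> \<open>The left-hand side is g^J B - 2, so any remainder r is allowed.\<close>
    show "int g ^ J * (int B - 2) + 2 * (int g ^ J - 1) \<le> int M"
      unfolding Mi by (simp add: algebra_simps)
    have "int r < int g ^ J" using r by (metis of_nat_less_iff of_nat_power)
    thus "int M < int g ^ J * (int B + 1)" unfolding Mi by (simp add: algebra_simps)
  qed
  have diff: "0 \<le> (real M)\<^sup>2 - G\<^sup>2 * (real B)\<^sup>2" "(real M)\<^sup>2 - G\<^sup>2 * (real B)\<^sup>2 \<le> 3 * (G\<^sup>2 * real B)"
  proof -
    have "(G * real B)\<^sup>2 \<le> (real M)\<^sup>2" using GB G0 by (intro power_mono) auto
    thus "0 \<le> (real M)\<^sup>2 - G\<^sup>2 * (real B)\<^sup>2" by (simp add: power_mult_distrib)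
    have "(real M)\<^sup>2 \<le> (G * real B + G)\<^sup>2" using MG by (intro power_mono) auto
    also have "\<dots> = G\<^sup>2 * (real B)\<^sup>2 + G\<^sup>2 * (2 * real B + 1)" by (simp add: power2_eq_square algebra_simps)
    also have "\<dots> \<le> G\<^sup>2 * (real B)\<^sup>2 + G\<^sup>2 * (3 * real B)"
      using B2 by (intro add_left_mono mult_left_mono) auto
    finally show "(real M)\<^sup>2 - G\<^sup>2 * (real B)\<^sup>2 \<le> 3 * (G\<^sup>2 * real B)" by simp
  qed
  have bound2: "norm ((real g)\<^sup>2 ^ J * \<phi> ^ J * of_real ((real B)\<^sup>2 / 2) - \<phi> ^ J * of_real ((real M)\<^sup>2 / 2))
      \<le> 3 / 2 * (G\<^sup>2 * real B)"
  proof -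
    have "(real g)\<^sup>2 ^ J * \<phi> ^ J * of_real ((real B)\<^sup>2 / 2) - \<phi> ^ J * of_real ((real M)\<^sup>2 / 2)
        = - (\<phi> ^ J * of_real (((real M)\<^sup>2 - G\<^sup>2 * (real B)\<^sup>2) / 2))"
      unfolding GJ by (simp add: algebra_simps diff_divide_distrib)
    also have "norm \<dots> = norm \<phi> ^ J * (((real M)\<^sup>2 - G\<^sup>2 * (real B)\<^sup>2) / 2)"
      using diff(1) unfolding norm_minus_cancel norm_mult norm_power norm_of_real by simp
    also have "\<dots> \<le> 1 * (3 * (G\<^sup>2 * real B) / 2)"
      using diff norm_step_char_le[OF g, of b1 b2 b3] unfolding \<phi>_def
      by (intro mult_mono power_le_one divide_right_mono) auto
    finally show ?thesis by simp
  qed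
  have "norm (triple_sum g b1 b2 b3 (int M) - \<phi> ^ J * of_real ((real M)\<^sup>2 / 2))
      \<le> G\<^sup>2 * (E + real J * \<epsilon> * ((real B)\<^sup>2 / 2)) + 3 / 2 * (G\<^sup>2 * real B)"
    using norm_triangle_mono[OF bound1 bound2] unfolding GJ norm_of_real by simp
  also have "\<dots> = 9 / 2 * (G\<^sup>2 * real B) + (G\<^sup>2 * (real B)\<^sup>2) * (60 * real g * real (Suc t) * \<delta> + real J * \<epsilon> / 2)"
    by (simp add: E_def algebra_simps)
  also have "\<dots> \<le> (real M)\<^sup>2 * (5 * real g / real g ^ t)
      + (real M)\<^sup>2 * (60 * real g * real (Suc t) * \<delta> + 100 * real g ^ 4 * (real K * \<delta> ^ 3))"
  proof (rule add_mono)
    have "real g ^ t = real g * real g ^ (t - 1)" using t by (cases t) auto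
    also have "\<dots> \<le> real g * real B"
      using Blo by (intro mult_left_mono) (auto simp flip: of_nat_power)
    finally have "real g ^ t * (G\<^sup>2 * real B) \<le> (real g * real B) * (G\<^sup>2 * real B)"
      by (intro mult_right_mono) auto
    also have "\<dots> = real g * (G\<^sup>2 * (real B)\<^sup>2)" by (simp add: power2_eq_square)
    also have "\<dots> \<le> real g * (real M)\<^sup>2" using diff(1) by (intro mult_left_mono) auto
    finally have "G\<^sup>2 * real B \<le> real g * (real M)\<^sup>2 / real g ^ t"
      using gpos by (simp add: field_simps)
    moreover have "0 \<le> real g * (real M)\<^sup>2 / real g ^ t" by simp
    ultimately have "9 / 2 * (G\<^sup>2 * real B) \<le> 5 * (real g * (real M)\<^sup>2 / real g ^ t)"
      by (intro mult_mono) auto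
    thus "9 / 2 * (G\<^sup>2 * real B) \<le> (real M)\<^sup>2 * (5 * real g / real g ^ t)" by (simp add: mult_ac)
    have "real J * \<epsilon> / 2 = 100 * real g ^ 4 * (real J * \<delta> ^ 3)" by (simp add: \<epsilon>_def)
    also have "\<dots> \<le> 100 * real g ^ 4 * (real K * \<delta> ^ 3)"
      using \<delta>0 by (intro mult_left_mono mult_right_mono) (auto simp: J_def)
    finally have "60 * real g * real (Suc t) * \<delta> + real J * \<epsilon> / 2
        \<le> 60 * real g * real (Suc t) * \<delta> + 100 * real g ^ 4 * (real K * \<delta> ^ 3)"
      by (rule add_left_mono)
    moreover have "0 \<le> 60 * real g * real (Suc t) * \<delta> + real J * \<epsilon> / 2"
      using \<delta>0 by (simp add: \<epsilon>_def)
    ultimately show "G\<^sup>2 * (real B)\<^sup>2 * (60 * real g * real (Suc t) * \<delta> + real J * \<epsilon> / 2)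
        \<le> (real M)\<^sup>2 * (60 * real g * real (Suc t) * \<delta> + 100 * real g ^ 4 * (real K * \<delta> ^ 3))"
      using diff(1) by (intro mult_mono) auto
  qed
  finally show ?thesis by (simp add: \<phi>_def J_def distrib_left)
qed

lemma exp_minus_diff_le:
  fixes a b :: real
  assumes "0 \<le> a" "a \<le> b"
  shows "\<bar>exp (- a) - exp (- b)\<bar> \<le> b - a"
proof -
  have "exp (- a) - exp (- b) = exp (- a) * (1 - exp (- (b - a)))"
    by (simp add: right_diff_distrib flip: exp_add)
  also have "\<dots> \<le> 1 * (b - a)"
  proof (rule mult_mono)
    show "1 - exp (- (b - a)) \<le> b - a" using exp_ge_add_one_self[of "- (b - a)"] by linarith
  qed (use assms in auto)
  finally show ?thesis using assms by simp
qed

text \<open>The phase of \<open>step_char\<close> raised to the power K - t nearly cancels the one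
  from k1, k2, k3, because (K - t)(g-1)/2 differs from each of them by at most C + t g. In the
  Gaussian factor, passing from K - t to K changes the exponent by t \<nu>, where \<nu> \<le> 6 g^2
  \<delta>.\<close>

lemma step_char_power_approx:
  assumes g: "g \<ge> 2" and b: "\<bar>b1\<bar> \<le> \<delta>" "\<bar>b2\<bar> \<le> \<delta>" "\<bar>b3\<bar> \<le> \<delta>" and \<delta>: "\<delta> \<le> 1"
    and t: "t \<ge> 1" "t \<le> K"
    and k: "\<bar>k1 - digit_mean g K\<bar> \<le> C" "\<bar>k2 - digit_mean g K\<bar> \<le> C" "\<bar>k3 - digit_mean g K\<bar> \<le> C"
  shows "norm (ee (- (b1 * k1 + b2 * k2 + b3 * k3)) * step_char g b1 b2 b3 ^ (K - t)
           - of_real (exp (- (2 * pi\<^sup>2 * digit_var g * real K * (b1\<^sup>2 + b2\<^sup>2 + b3\<^sup>2)))))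
         \<le> (20 * C + 26 * (real g)\<^sup>2) * (\<delta> * real t)"
proof -
  define J where "J = K - t"
  define \<nu> where "\<nu> = 2 * pi\<^sup>2 * digit_var g * (b1\<^sup>2 + b2\<^sup>2 + b3\<^sup>2)"
  define h where "h = (real g - 1) / 2"
  define x where "x = b1 * (real J * h - k1) + b2 * (real J * h - k2) + b3 * (real J * h - k3)"
  have \<delta>0: "\<delta> \<ge> 0" using b(1) by linarith
  have C0: "C \<ge> 0" using k(1) by linarith
  have J: "real J = real K - real t" using t by (simp add: J_def of_nat_diff)
  have h: "h \<ge> 0" "h \<le> real g" using g by (auto simp: h_def)
  have "ee (- (b1 * k1 + b2 * k2 + b3 * k3)) * step_char g b1 b2 b3 ^ J
      = ee (- (b1 * k1 + b2 * k2 + b3 * k3)) * ee (real J * (h * (b1 + b2 + b3))) * of_real (exp (- \<nu>) ^ J)"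
    by (simp add: step_char_def power_mult_distrib ee_power h_def \<nu>_def)
  also have "\<dots> = ee x * of_real (exp (- (real J * \<nu>)))"
    unfolding ee_add[symmetric] by (simp add: x_def algebra_simps flip: exp_of_nat_mult)
  finally have eq: "ee (- (b1 * k1 + b2 * k2 + b3 * k3)) * step_char g b1 b2 b3 ^ J
      = ee x * of_real (exp (- (real J * \<nu>)))" .
  have \<nu>0: "\<nu> \<ge> 0" using digit_var_bounds(1)[OF g] by (simp add: \<nu>_def)
  have \<nu>b: "\<nu> \<le> 6 * (real g)\<^sup>2 * \<delta>"
  proof -
    have "b\<^sup>2 \<le> \<delta>" if "\<bar>b\<bar> \<le> \<delta>" for b
      using mult_mono[of "\<bar>b\<bar>" \<delta> "\<bar>b\<bar>" 1] that \<delta> by (simp add: power2_eq_square)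
    hence "b1\<^sup>2 + b2\<^sup>2 + b3\<^sup>2 \<le> 3 * \<delta>" using b by (smt (verit))
    hence "\<nu> \<le> 2 * 12 * ((real g)\<^sup>2 / 12) * (3 * \<delta>)"
      unfolding \<nu>_def using pi_squared_less digit_var_bounds[OF g] by (intro mult_mono) auto
    thus ?thesis by simp
  qed
  have kb: "\<bar>b * (real J * h - k)\<bar> \<le> \<delta> * ((C + real g) * real t)"
    if "\<bar>b\<bar> \<le> \<delta>" "\<bar>k - digit_mean g K\<bar> \<le> C" for b k
  proof -
    have "real J * h - k = (digit_mean g K - k) - real t * h"
      by (simp add: J h_def digit_mean_def field_simps)
    hence "\<bar>real J * h - k\<bar> \<le> C + real t * h"
      using that(2) h by (smt (verit) mult_nonneg_nonneg of_nat_0_le_iff)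
    also have "\<dots> \<le> C * real t + real t * real g"
      using C0 t h mult_left_mono[of 1 "real t" C] by (intro add_mono mult_left_mono) auto
    finally have "\<bar>real J * h - k\<bar> \<le> (C + real g) * real t" by (simp add: algebra_simps)
    thus ?thesis unfolding abs_mult using that(1) \<delta>0 by (intro mult_mono) auto
  qed
  have xb: "norm (ee x - 1) \<le> 20 * (C + real g) * (\<delta> * real t)"
  proof -
    have "\<bar>x\<bar> \<le> 3 * (\<delta> * ((C + real g) * real t))"
      using kb[OF b(1) k(1)] kb[OF b(2) k(2)] kb[OF b(3) k(3)] unfolding x_def by linarith
    hence "2 * pi * \<bar>x - 0\<bar> \<le> 2 * (10 / 3) * (3 * (\<delta> * ((C + real g) * real t)))"
      using pi_less \<delta>0 C0 by (intro mult_mono) auto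
    also have "\<dots> = 20 * (C + real g) * (\<delta> * real t)" by simp
    finally show ?thesis using norm_ee_diff_le[of x 0] by simp
  qed
  have eb: "\<bar>exp (- (real J * \<nu>)) - exp (- (real K * \<nu>))\<bar> \<le> 6 * (real g)\<^sup>2 * (\<delta> * real t)"
  proof -
    have "\<bar>exp (- (real J * \<nu>)) - exp (- (real K * \<nu>))\<bar> \<le> real K * \<nu> - real J * \<nu>"
      using \<nu>0 by (intro exp_minus_diff_le mult_right_mono) (auto simp: J_def)
    also have "\<dots> = real t * \<nu>" by (simp add: J algebra_simps)
    also have "\<dots> \<le> real t * (6 * (real g)\<^sup>2 * \<delta>)" using \<nu>b by (intro mult_left_mono) auto
    finally show ?thesis by (simp add: mult_ac)
  qed
  have "ee x * of_real (exp (- (real J * \<nu>))) - of_real (exp (- (real K * \<nu>)))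
      = (ee x - 1) * of_real (exp (- (real J * \<nu>))) + of_real (exp (- (real J * \<nu>)) - exp (- (real K * \<nu>)))"
    by (simp add: algebra_simps)
  also have "norm \<dots> \<le> norm (ee x - 1) * 1 + \<bar>exp (- (real J * \<nu>)) - exp (- (real K * \<nu>))\<bar>"
    using \<nu>0 unfolding norm_of_real[symmetric, where 'a = complex]
    by (intro norm_triangle_le add_mono) (auto simp: norm_mult mult_left_le)
  also have "\<dots> \<le> 20 * (C + real g) * (\<delta> * real t) * 1 + 6 * (real g)\<^sup>2 * (\<delta> * real t)"
    by (intro add_mono mult_right_mono xb eb) auto
  also have "\<dots> = (20 * C + (20 * real g + 6 * (real g)\<^sup>2)) * (\<delta> * real t)" by (simp add: algebra_simps)
  also have "\<dots> \<le> (20 * C + 26 * (real g)\<^sup>2) * (\<delta> * real t)"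
    using g \<delta>0 by (intro mult_right_mono add_left_mono) (auto simp: power2_eq_square)
  finally have "norm (ee x * of_real (exp (- (real J * \<nu>))) - of_real (exp (- (real K * \<nu>))))
      \<le> (20 * C + 26 * (real g)\<^sup>2) * (\<delta> * real t)" .
  moreover have "real K * \<nu> = 2 * pi\<^sup>2 * digit_var g * real K * (b1\<^sup>2 + b2\<^sup>2 + b3\<^sup>2)"
    by (simp add: \<nu>_def)
  ultimately show ?thesis by (simp only: eq flip: J_def)
qed

section \<open>The minor region\<close>

text \<open>g times the phase at place j minus the phase at place j+1 equals (g-1) a whatever t is,
  so a sum with (g-1) a away from the integers is small on the whole circle. Multiplication by g
  costs g^2 in \<open>sin2\<close>.\<close>

lemma norm_sum_ee_digit_sum_le_sin2:
  assumes g: "g \<ge> 2"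
  shows "norm (\<Sum>n<g ^ Suc K. ee (a * real (digit_sum g n)) * ee (real n * t))
           \<le> exp (- (real K * sin2 ((real g - 1) * a) / (real g * (2 * (real g)\<^sup>2 + 2)))) * real (g ^ Suc K)"
proof -
  let ?x = "\<lambda>j. sin2 (a + t * real g ^ j)"
  define Y where "Y = (\<Sum>j<Suc K. ?x j)"
  have "real K * sin2 ((real g - 1) * a) = (\<Sum>j<K. sin2 ((real g - 1) * a))" by simp
  also have "\<dots> \<le> (\<Sum>j<K. 2 * (real g)\<^sup>2 * ?x j + 2 * ?x (Suc j))"
  proof (rule sum_mono)
    fix j
    have "(real g - 1) * a = real g * (a + t * real g ^ j) - (a + t * real g ^ Suc j)"
      by (simp add: algebra_simps)
    hence "sin2 ((real g - 1) * a) \<le> 2 * sin2 (real g * (a + t * real g ^ j)) + 2 * ?x (Suc j)"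
      by (metis sin2_diff_le)
    thus "sin2 ((real g - 1) * a) \<le> 2 * (real g)\<^sup>2 * ?x j + 2 * ?x (Suc j)"
      using sin2_of_nat_mult_le[of g "a + t * real g ^ j"] by linarith
  qed
  also have "\<dots> = 2 * (real g)\<^sup>2 * (\<Sum>j<K. ?x j) + 2 * (\<Sum>j<K. ?x (Suc j))"
    by (simp only: sum.distrib sum_distrib_left)
  also have "\<dots> \<le> 2 * (real g)\<^sup>2 * Y + 2 * Y"
  proof (intro add_mono mult_left_mono)
    show "(\<Sum>j<K. ?x j) \<le> Y" by (simp add: Y_def)
    show "(\<Sum>j<K. ?x (Suc j)) \<le> Y" unfolding Y_def by (subst sum.lessThan_Suc_shift) simp
  qed auto
  finally have Y: "real K * sin2 ((real g - 1) * a) \<le> (2 * (real g)\<^sup>2 + 2) * Y"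
    by (simp only: distrib_right)
  have pos: "2 * (real g)\<^sup>2 + 2 > 0" by (simp add: add_nonneg_pos)
  have "(\<Sum>n<g ^ Suc K. ee (a * real (digit_sum g n)) * ee (real n * t))
      = (\<Sum>n<g ^ Suc K. ee (a * real (digit_sum g n) + t * real n))"
    by (simp only: ee_add mult.commute[of t])
  hence "norm (\<Sum>n<g ^ Suc K. ee (a * real (digit_sum g n)) * ee (real n * t))
      \<le> real g ^ Suc K * exp (- (Y / real g))"
    unfolding Y_def using norm_sum_ee_digit_sum_le[OF g, where D = "Suc K" and a = a and t = t] by (simp only:)
  also have "\<dots> \<le> real g ^ Suc K * exp (- (real K * sin2 ((real g - 1) * a) / (real g * (2 * (real g)\<^sup>2 + 2))))"
  proof (intro mult_left_mono)
    have "real K * sin2 ((real g - 1) * a) / (2 * (real g)\<^sup>2 + 2) \<le> Y"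
      using Y pos by (simp add: pos_divide_le_eq mult.commute)
    hence "real K * sin2 ((real g - 1) * a) / (2 * (real g)\<^sup>2 + 2) / real g \<le> Y / real g"
      by (rule divide_right_mono) simp
    thus "exp (- (Y / real g)) \<le> exp (- (real K * sin2 ((real g - 1) * a) / (real g * (2 * (real g)\<^sup>2 + 2))))"
      by (simp add: mult.commute)
  qed auto
  finally show ?thesis by (simp add: mult.commute)
qed

text \<open>At equal places the two phases differ by a - a', independently of t, so at each t one of
  the two sums collects at least a quarter of K sin2 (a - a').\<close>

lemma sum_ee_digit_sum_pair:
  assumes g: "g \<ge> 2"
  shows "\<exists>c\<in>{a, a'}. norm (\<Sum>n<g ^ Suc K. ee (c * real (digit_sum g n)) * ee (real n * t))
           \<le> exp (- (real K * sin2 (a - a') / (real g * 4))) * real (g ^ Suc K)"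
proof -
  define Y where "Y = (\<lambda>a. \<Sum>j<Suc K. sin2 (a + t * real g ^ j))"
  have "real K * sin2 (a - a') \<le> (\<Sum>j<Suc K. sin2 (a - a'))"
    by (simp add: distrib_right)
  also have "\<dots> \<le> (\<Sum>j<Suc K. 2 * sin2 (a + t * real g ^ j) + 2 * sin2 (a' + t * real g ^ j))"
  proof (rule sum_mono)
    fix j
    show "sin2 (a - a') \<le> 2 * sin2 (a + t * real g ^ j) + 2 * sin2 (a' + t * real g ^ j)"
      using sin2_diff_le[of "a + t * real g ^ j" "a' + t * real g ^ j"] by simp
  qed
  also have "\<dots> = 2 * Y a + 2 * Y a'"
    by (simp only: Y_def sum.distrib sum_distrib_left)
  finally have "Y a \<ge> real K * sin2 (a - a') / 4 \<or> Y a' \<ge> real K * sin2 (a - a') / 4" by linarith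
  moreover have "norm (\<Sum>n<g ^ Suc K. ee (c * real (digit_sum g n)) * ee (real n * t))
      \<le> exp (- (real K * sin2 (a - a') / (real g * 4))) * real (g ^ Suc K)"
    if "Y c \<ge> real K * sin2 (a - a') / 4" for c
  proof -
    have "(\<Sum>n<g ^ Suc K. ee (c * real (digit_sum g n)) * ee (real n * t))
        = (\<Sum>n<g ^ Suc K. ee (c * real (digit_sum g n) + t * real n))"
      by (simp only: ee_add mult.commute[of t])
    hence "norm (\<Sum>n<g ^ Suc K. ee (c * real (digit_sum g n)) * ee (real n * t))
        \<le> real g ^ Suc K * exp (- (Y c / real g))"
      unfolding Y_def using norm_sum_ee_digit_sum_le[OF g, where D = "Suc K" and a = c and t = t] by (simp only:)
    also have "\<dots> \<le> real g ^ Suc K * exp (- (real K * sin2 (a - a') / (real g * 4)))"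
    proof (intro mult_left_mono)
      have "real K * sin2 (a - a') / 4 / real g \<le> Y c / real g"
        using that by (rule divide_right_mono) simp
      thus "exp (- (Y c / real g)) \<le> exp (- (real K * sin2 (a - a') / (real g * 4)))"
        by (simp add: mult.commute)
    qed auto
    finally show ?thesis by (simp add: mult.commute)
  qed
  ultimately show ?thesis by blast
qed

text \<open>Either the third sum is small everywhere, or at each t one member of a pair is; both are
  what the circle method asks for. The two rates are weakened to a common one by 4 \<le> 2 g^2 +
  2.\<close>

lemma triple_sum_minor:
  assumes g: "g \<ge> 2" and M: "M \<le> g ^ K" and \<rho>: "\<rho> \<ge> 0"
    and minor: "sin2 ((real g - 1) * a3) \<ge> \<rho> \<or> sin2 (a1 - a3) \<ge> \<rho> \<or> sin2 (a2 - a3) \<ge> \<rho>"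
  shows "norm (triple_sum g a1 a2 a3 (int M))
           \<le> 3 / 2 * exp (- (real K * \<rho> / (real g * (2 * (real g)\<^sup>2 + 2)))) * (real (g ^ Suc K))\<^sup>2"
proof -
  define f where "f = (\<lambda>a n. ee (a * real (digit_sum g n)))"
  let ?\<epsilon> = "exp (- (real K * \<rho> / (real g * (2 * (real g)\<^sup>2 + 2))))"
  have gpos: "real g > 0" using g by simp
  have X: "M < g ^ Suc K"
  proof -
    have "g ^ K < g ^ Suc K" using g by simp
    thus ?thesis using M by (simp only: le_less_trans)
  qed
  have four: "4 \<le> 2 * (real g)\<^sup>2 + 2"
  proof -
    have "1\<^sup>2 \<le> (real g)\<^sup>2" using g by (intro power_mono) auto
    thus ?thesis by simp
  qed
  have mono: "exp (- (real K * r / (real g * q))) \<le> ?\<epsilon>"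
    if "r \<ge> \<rho>" "q \<le> 2 * (real g)\<^sup>2 + 2" "q > 0" for r q
  proof -
    have "real K * \<rho> / (real g * (2 * (real g)\<^sup>2 + 2)) \<le> real K * r / (real g * q)"
      using that \<rho> gpos by (intro frac_le mult_left_mono mult_nonneg_nonneg) auto
    thus ?thesis by simp
  qed
  have pair: "\<exists>c\<in>{a, a3}. norm (\<Sum>n<g ^ Suc K. f c n * ee (real n * t)) \<le> ?\<epsilon> * real (g ^ Suc K)"
    if "sin2 (a - a3) \<ge> \<rho>" for a t
  proof -
    obtain c where c: "c \<in> {a, a3}" and le: "norm (\<Sum>n<g ^ Suc K. f c n * ee (real n * t))
        \<le> exp (- (real K * sin2 (a - a3) / (real g * 4))) * real (g ^ Suc K)"
      using sum_ee_digit_sum_pair[OF g, where a = a and a' = a3 and K = K and t = t] unfolding f_def by blast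
    have "exp (- (real K * sin2 (a - a3) / (real g * 4))) * real (g ^ Suc K) \<le> ?\<epsilon> * real (g ^ Suc K)"
      using that four by (intro mult_right_mono mono) auto
    with le c show ?thesis by (meson order_trans)
  qed
  have "norm (\<Sum>(a, b, c)\<in>triples M. f a1 a * f a2 b * f a3 c) \<le> 3 / 2 * ?\<epsilon> * (real (g ^ Suc K))\<^sup>2"
  proof (rule norm_sum_triples_le[OF X])
    fix t
    show "\<exists>h\<in>{f a1, f a2, f a3}. norm (\<Sum>n<g ^ Suc K. h n * ee (real n * t)) \<le> ?\<epsilon> * real (g ^ Suc K)"
    proof (cases "sin2 ((real g - 1) * a3) \<ge> \<rho>")
      case True
      have "norm (\<Sum>n<g ^ Suc K. f a3 n * ee (real n * t))
          \<le> exp (- (real K * sin2 ((real g - 1) * a3) / (real g * (2 * (real g)\<^sup>2 + 2)))) * real (g ^ Suc K)"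
        unfolding f_def by (rule norm_sum_ee_digit_sum_le_sin2[OF g])
      also have "\<dots> \<le> ?\<epsilon> * real (g ^ Suc K)"
        using True four by (intro mult_right_mono mono) auto
      finally show ?thesis by blast
    next
      case False
      with minor consider "sin2 (a1 - a3) \<ge> \<rho>" | "sin2 (a2 - a3) \<ge> \<rho>" by blast
      thus ?thesis using pair by cases blast+
    qed
  qed (auto simp: f_def)
  also have "(\<Sum>(a, b, c)\<in>triples M. f a1 a * f a2 b * f a3 c) = triple_sum g a1 a2 a3 (int M)"
    by (simp only: triple_sum_def itriples_of_nat f_def ee_add)
  finally show ?thesis .
qed

text \<open>The three expressions vanish together only if a1, a2, a3 agree modulo 1 and (g-1) a3 is
  an integer; restricting a3 to |a3| \<le> 1/(2(g-1)) leaves only the origin among these points. If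
  |a3| \<le> \<delta>/2 and \<delta> < |b| \<le> 1/2, then b - a3 is at distance at least \<delta>/2
  from 0 and, as \<delta> \<le> 1/2, also from 1 and -1.\<close>

lemma sin2_minor:
  assumes \<delta>: "0 < \<delta>" "\<delta> \<le> 1 / 2" and g: "g \<ge> (2 :: nat)"
    and a: "\<bar>a1\<bar> \<le> 1 / 2" "\<bar>a2\<bar> \<le> 1 / 2" "\<bar>(real g - 1) * a3\<bar> \<le> 1 / 2"
    and minor: "\<bar>a1\<bar> > \<delta> \<or> \<bar>a2\<bar> > \<delta> \<or> \<bar>a3\<bar> > \<delta>"
  shows "sin2 ((real g - 1) * a3) \<ge> \<delta>\<^sup>2 \<or> sin2 (a1 - a3) \<ge> \<delta>\<^sup>2 \<or> sin2 (a2 - a3) \<ge> \<delta>\<^sup>2"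
proof (cases "\<bar>a3\<bar> > \<delta> / 2")
  case True
  have "\<delta>\<^sup>2 = 4 * (\<delta> / 2)\<^sup>2" by (simp add: power2_eq_square)
  also have "\<dots> \<le> 4 * \<bar>a3\<bar>\<^sup>2" using True \<delta> by (intro mult_left_mono power_mono) auto
  also have "\<dots> \<le> 4 * \<bar>(real g - 1) * a3\<bar>\<^sup>2"
  proof (intro mult_left_mono power_mono)
    have "1 * \<bar>a3\<bar> \<le> (real g - 1) * \<bar>a3\<bar>" using g by (intro mult_right_mono) auto
    thus "\<bar>a3\<bar> \<le> \<bar>(real g - 1) * a3\<bar>" using g by (simp add: abs_mult)
  qed auto
  also have "\<dots> \<le> sin2 ((real g - 1) * a3)" using sin2_ge[OF a(3)] by simp
  finally show ?thesis by blast
next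
  case False
  have gen: "sin2 (b - a3) \<ge> \<delta>\<^sup>2" if b: "\<bar>b\<bar> \<le> 1 / 2" "\<bar>b\<bar> > \<delta>" for b
  proof -
    define x where "x = b - a3"
    have x: "\<bar>x\<bar> \<ge> \<delta> / 2" "\<bar>x\<bar> \<le> 1 - \<delta> / 2" using b False \<delta> unfolding x_def by linarith+
    have key: "sin2 y \<ge> \<delta>\<^sup>2" if "\<bar>y\<bar> \<ge> \<delta> / 2" "\<bar>y\<bar> \<le> 1 / 2" for y
    proof -
      have "\<delta>\<^sup>2 = 4 * (\<delta> / 2)\<^sup>2" by (simp add: power2_eq_square)
      also have "\<dots> \<le> 4 * \<bar>y\<bar>\<^sup>2" using that \<delta> by (intro mult_left_mono power_mono) auto
      also have "\<dots> \<le> sin2 y" using sin2_ge[OF that(2)] by simp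
      finally show ?thesis .
    qed
    consider "\<bar>x\<bar> \<le> 1 / 2" | "x > 1 / 2" | "x < - 1 / 2" by linarith
    thus ?thesis unfolding x_def[symmetric]
    proof cases
      case 1
      thus "sin2 x \<ge> \<delta>\<^sup>2" using key x by simp
    next
      case 2
      hence "sin2 (x - 1) \<ge> \<delta>\<^sup>2" using x \<delta> by (intro key) linarith+
      thus "sin2 x \<ge> \<delta>\<^sup>2" using sin2_diff_Ints[of 1 x] by simp
    next
      case 3
      hence "sin2 (x - (-1)) \<ge> \<delta>\<^sup>2" using x \<delta> by (intro key) linarith+
      thus "sin2 x \<ge> \<delta>\<^sup>2" using sin2_diff_Ints[of "-1" x] by simp
    qed
  qed
  from minor False \<delta> have "\<bar>a1\<bar> > \<delta> \<or> \<bar>a2\<bar> > \<delta>" by linarith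
  thus ?thesis using gen a by blast
qed

section \<open>Fourier expansion of the number of representations\<close>

text \<open>Once the first two digit sums are correct, the third one is automatically correct modulo
  \<open>g - 1\<close>; hence its frequency only has to run through a \<open>1/(g - 1)\<close>-th of a full period.\<close>

lemma rep3_digit_set_fourier:
  fixes R :: nat
  assumes g: "g \<ge> 2" and M: "M \<le> g ^ K" and k: "k1 > 0" "k2 > 0" "k3 > 0"
    and cong: "[k1 + k2 + k3 = M] (mod (g - 1))"
    and R: "(g - 1) * Suc K + k1 \<le> R" "(g - 1) * Suc K + k2 \<le> R" "(g - 1) * Suc K + k3 \<le> R"
  defines "I \<equiv> {-int R..int R}" and "Q \<equiv> real (2 * R + 1)"
  shows "of_real (Q ^ 3) * of_nat (rep3 (digit_set g K k1) (digit_set g K k2) (digit_set g K k3) M)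
    = (\<Sum>(x, y, z)\<in>I \<times> I \<times> I.
        ee (- (of_int x / Q * real k1 + of_int y / Q * real k2 + of_int z / ((real g - 1) * Q) * real k3))
          * triple_sum g (of_int x / Q) (of_int y / Q) (of_int z / ((real g - 1) * Q)) (int M))"
proof -
  let ?s = "\<lambda>n. real (digit_sum g n)"
  \<comment> \<open>Up to the factor Q, \<open>U\<close> detects digit sum k. For q = 1 the
    frequencies cover a full period; for q = g-1 their spacing is 1/((g-1) Q), which works once the
    difference to k is known to be a multiple of g-1.\<close>
  define U where "U = (\<lambda>q n k. \<Sum>x\<in>I. ee (of_int x * (?s n - real k) / (q * Q)))"
  have g1: "real g - 1 > 0" using g by simp
  have Q0: "Q > 0" by (simp add: Q_def)
  have QC: "of_nat (2 * R + 1) = complex_of_real Q" unfolding Q_def by (simp only: of_real_of_nat_eq)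
  have sum_le: "digit_sum g n \<le> (g - 1) * Suc K" if "n \<le> M" for n
  proof (rule digit_sum_le[OF g])
    have "g ^ K < g ^ Suc K" using g by simp
    thus "n < g ^ Suc K" using that M by linarith
  qed
  have U_eq: "U 1 n k = of_real Q * of_bool (digit_sum g n = k)" if "n \<le> M" "(g - 1) * Suc K + k \<le> R" for n k
  proof -
    have "digit_sum g n + k \<le> R" using sum_le[OF that(1)] that(2) by linarith
    hence "\<bar>int (digit_sum g n) - int k\<bar> \<le> 2 * int R" by linarith
    from sum_ee_orthogonal_symmetric[OF this]
    show ?thesis unfolding U_def I_def QC by (simp add: Q_def)
  qed
  have U3: "U (real g - 1) n k3 = of_real Q * of_bool (digit_sum g n = k3)"
    if n: "n \<le> M" and dvd: "int g - 1 dvd int (digit_sum g n) - int k3" for n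
  proof -
    obtain m where m: "int (digit_sum g n) - int k3 = (int g - 1) * m" using dvd by blast
    have "?s n - real k3 = (real g - 1) * of_int m"
      using arg_cong[OF m, of real_of_int] by simp
    hence "of_int x * (?s n - real k3) / ((real g - 1) * Q) = of_int x * of_int m / real (2 * R + 1)" for x
      using g1 by (simp add: Q_def)
    hence U: "U (real g - 1) n k3 = (\<Sum>x\<in>I. ee (of_int x * of_int m / real (2 * R + 1)))"
      unfolding U_def by (simp only:)
    have "digit_sum g n + k3 \<le> R" using sum_le[OF n] R(3) by linarith
    hence "\<bar>int (digit_sum g n) - int k3\<bar> \<le> 2 * int R" by linarith
    moreover have "\<bar>m\<bar> \<le> \<bar>(int g - 1) * m\<bar>"
      using g mult_right_mono[of 1 "int g - 1" "\<bar>m\<bar>"] by (simp add: abs_mult)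
    ultimately have "\<bar>m\<bar> \<le> 2 * int R" unfolding m by linarith
    from sum_ee_orthogonal_symmetric[OF this] have "U (real g - 1) n k3 = of_real Q * of_bool (m = 0)"
      unfolding U I_def QC by simp
    moreover have "m = 0 \<longleftrightarrow> digit_sum g n = k3"
    proof -
      have "int g - 1 \<noteq> 0" using g by simp
      hence "m = 0 \<longleftrightarrow> (int g - 1) * m = 0" by simp
      also have "\<dots> \<longleftrightarrow> digit_sum g n = k3" unfolding m[symmetric] by simp
      finally show ?thesis .
    qed
    ultimately show ?thesis by simp
  qed
  have prod: "of_real (Q ^ 3) * (of_bool (digit_sum g a = k1) * of_bool (digit_sum g b = k2) * of_bool (digit_sum g c = k3))
      = U 1 a k1 * U 1 b k2 * U (real g - 1) c k3" if "(a, b, c) \<in> triples M" for a b c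
  proof -
    have abc: "a + b + c = M" using that by (simp add: triples_def)
    hence le: "a \<le> M" "b \<le> M" "c \<le> M" by auto
    note U12 = U_eq[OF le(1) R(1)] U_eq[OF le(2) R(2)]
    \<comment> \<open>If one of the first two digit sums is wrong, both sides vanish; so the third
      factor has to be evaluated only when its difference is divisible by g-1.\<close>
    show ?thesis
    proof (cases "digit_sum g a = k1 \<and> digit_sum g b = k2")
      case True
      have "[int (k1 + k2 + k3) = int M] (mod int (g - 1))" using cong by (simp only: cong_int_iff)
      hence d0: "int g - 1 dvd int (k1 + k2 + k3) - int M"
        using g by (simp add: cong_iff_dvd_diff of_nat_diff)
      have ds: "int g - 1 dvd int (digit_sum g n) - int n" for n
        using digit_sum_cong_self[OF g] by (simp add: cong_iff_dvd_diff)
      have "int g - 1 dvd ((int (digit_sum g a) - int a) + (int (digit_sum g b) - int b)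
          + (int (digit_sum g c) - int c)) - (int (k1 + k2 + k3) - int M)"
        by (rule dvd_diff[OF dvd_add[OF dvd_add[OF ds ds] ds] d0])
      also have "\<dots> = int (digit_sum g c) - int k3" using True abc by auto
      finally have "U (real g - 1) c k3 = of_real Q * of_bool (digit_sum g c = k3)"
        by (rule U3[OF le(3)])
      thus ?thesis unfolding U12 by (simp add: power3_eq_cube)
    qed (auto simp: U12)
  qed
  have fourier: "U 1 a k1 * U 1 b k2 * U (real g - 1) c k3 = (\<Sum>(x, y, z)\<in>I \<times> I \<times> I.
        ee (- (of_int x / Q * real k1 + of_int y / Q * real k2 + of_int z / ((real g - 1) * Q) * real k3))
        * ee (of_int x / Q * ?s a + of_int y / Q * ?s b + of_int z / ((real g - 1) * Q) * ?s c))" for a b c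
  proof -
    let ?u = "\<lambda>q n k x. ee (of_int x * (?s n - real k) / (q * Q))"
    have "U 1 a k1 * U 1 b k2 * U (real g - 1) c k3
        = (\<Sum>x\<in>I. \<Sum>y\<in>I. \<Sum>z\<in>I. ?u 1 a k1 x * ?u 1 b k2 y * ?u (real g - 1) c k3 z)"
      unfolding U_def
      by (simp only: sum_product)
         (simp only: sum_distrib_left sum_distrib_right, rule sum.cong[OF refl], rule sum.swap)
    also have "\<dots> = (\<Sum>(x, y, z)\<in>I \<times> I \<times> I. ?u 1 a k1 x * ?u 1 b k2 y * ?u (real g - 1) c k3 z)"
      by (simp only: sum.cartesian_product)
    also have "\<dots> = (\<Sum>(x, y, z)\<in>I \<times> I \<times> I.
        ee (- (of_int x / Q * real k1 + of_int y / Q * real k2 + of_int z / ((real g - 1) * Q) * real k3))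
        * ee (of_int x / Q * ?s a + of_int y / Q * ?s b + of_int z / ((real g - 1) * Q) * ?s c))"
    proof (intro sum.cong refl, clarify)
      fix x y z :: int
      have "- (of_int x / Q * real k1 + of_int y / Q * real k2 + of_int z / ((real g - 1) * Q) * real k3)
         + (of_int x / Q * ?s a + of_int y / Q * ?s b + of_int z / ((real g - 1) * Q) * ?s c)
         = of_int x * (?s a - real k1) / (1 * Q) + of_int y * (?s b - real k2) / (1 * Q)
           + of_int z * (?s c - real k3) / ((real g - 1) * Q)"
        by (simp add: right_diff_distrib diff_divide_distrib)
      thus "?u 1 a k1 x * ?u 1 b k2 y * ?u (real g - 1) c k3 z
         = ee (- (of_int x / Q * real k1 + of_int y / Q * real k2 + of_int z / ((real g - 1) * Q) * real k3))
        * ee (of_int x / Q * ?s a + of_int y / Q * ?s b + of_int z / ((real g - 1) * Q) * ?s c)"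
        by (simp only: flip: ee_add)
    qed
    finally show ?thesis .
  qed
  have "of_real (Q ^ 3) * of_nat (rep3 (digit_set g K k1) (digit_set g K k2) (digit_set g K k3) M)
      = (\<Sum>(a, b, c)\<in>triples M. U 1 a k1 * U 1 b k2 * U (real g - 1) c k3)"
    unfolding rep3_digit_set_eq[OF g M k] sum_distrib_left
    by (intro sum.cong refl) (auto simp only: prod prod.case split: prod.split)
  also have "\<dots> = (\<Sum>w\<in>triples M. \<Sum>(x, y, z)\<in>I \<times> I \<times> I.
        ee (- (of_int x / Q * real k1 + of_int y / Q * real k2 + of_int z / ((real g - 1) * Q) * real k3))
        * (case w of (a, b, c) \<Rightarrow> ee (of_int x / Q * ?s a + of_int y / Q * ?s b + of_int z / ((real g - 1) * Q) * ?s c)))"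
    by (intro sum.cong refl) (auto simp only: fourier prod.case split: prod.split)
  also have "\<dots> = (\<Sum>(x, y, z)\<in>I \<times> I \<times> I.
        ee (- (of_int x / Q * real k1 + of_int y / Q * real k2 + of_int z / ((real g - 1) * Q) * real k3))
          * triple_sum g (of_int x / Q) (of_int y / Q) (of_int z / ((real g - 1) * Q)) (int M))"
    by (subst sum.swap) (simp add: triple_sum_def itriples_of_nat sum_distrib_left case_prod_unfold)
  finally show ?thesis .
qed

section \<open>The number of representations by integers with prescribed digit sums\<close>

lemma gaussian_sum_coordinate:
  fixes h \<nu> :: real
  assumes "\<nu> > 0" "h > 0" "R > 0"
  shows "\<bar>h * (\<Sum>b\<in>{-int R..int R}. exp (- (\<nu> * (h * of_int b)\<^sup>2))) - sqrt (pi / \<nu>)\<bar>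
           \<le> h + 2 / (h * real R * \<nu>)"
proof -
  define s where "s = h * sqrt \<nu>"
  define S where "S = (\<Sum>b\<in>{-int R..int R}. exp (- (\<nu> * (h * of_int b)\<^sup>2)))"
  have s: "s > 0" using assms by (simp add: s_def)
  have "(s * of_int b)\<^sup>2 = \<nu> * (h * of_int b)\<^sup>2" for b
    using assms by (simp add: s_def power_mult_distrib)
  hence "\<bar>s * S - sqrt pi\<bar> \<le> s + 2 / (s * real R)"
    using gaussian_sum_approx[OF s assms(3)] by (simp add: S_def)
  moreover have "s * S - sqrt pi = sqrt \<nu> * (h * S - sqrt (pi / \<nu>))"
    using assms by (simp add: s_def real_sqrt_divide field_simps)
  moreover have "s + 2 / (s * real R) = sqrt \<nu> * (h + 2 / (h * real R * \<nu>))"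
    using assms by (simp add: s_def field_simps)
  ultimately have "sqrt \<nu> * \<bar>h * S - sqrt (pi / \<nu>)\<bar> \<le> sqrt \<nu> * (h + 2 / (h * real R * \<nu>))"
    using assms by (simp add: abs_mult)
  thus ?thesis using assms unfolding S_def by (simp only: mult_le_cancel_left_pos real_sqrt_gt_zero)
qed

lemma card_int_abs_le:
  assumes "y \<ge> 0"
  shows "real (card {b \<in> {-int R..int R}. \<bar>real_of_int b\<bar> \<le> y}) \<le> 2 * y + 1"
proof -
  have "{b \<in> {-int R..int R}. \<bar>real_of_int b\<bar> \<le> y} \<subseteq> {-\<lfloor>y\<rfloor>..\<lfloor>y\<rfloor>}"
  proof
    fix b assume "b \<in> {b \<in> {-int R..int R}. \<bar>real_of_int b\<bar> \<le> y}"
    hence "of_int b \<le> y" "of_int (- b) \<le> y" by auto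
    hence "b \<le> \<lfloor>y\<rfloor>" "- b \<le> \<lfloor>y\<rfloor>" by (simp_all only: le_floor_iff)
    thus "b \<in> {-\<lfloor>y\<rfloor>..\<lfloor>y\<rfloor>}" by simp
  qed
  hence "card {b \<in> {-int R..int R}. \<bar>real_of_int b\<bar> \<le> y} \<le> card {-\<lfloor>y\<rfloor>..\<lfloor>y\<rfloor>}"
    by (intro card_mono) auto
  also have "\<dots> = nat (2 * \<lfloor>y\<rfloor> + 1)" by simp
  finally have "real (card {b \<in> {-int R..int R}. \<bar>real_of_int b\<bar> \<le> y}) \<le> real (nat (2 * \<lfloor>y\<rfloor> + 1))"
    by (simp only: of_nat_le_iff)
  also have "\<dots> = 2 * of_int \<lfloor>y\<rfloor> + 1" using assms by simp
  also have "\<dots> \<le> 2 * y + 1" by simp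
  finally show ?thesis .
qed

text \<open>The Fourier terms, normalised by 2/M^2, are compared one by one with a Gaussian, whose
  sum factors into three one-dimensional sums. On the box \<open>Maj\<close>, with at most 27 g
  \<delta>^3 Q^3 points, the near-origin estimates apply; outside it both terms are exponentially
  small. Division by Q^3 turns the number of points into a volume.\<close>

lemma rep3_digit_set_approx:
  fixes g K M k1 k2 k3 t R :: nat and \<delta> C :: real
  assumes g: "g \<ge> 3" and K: "K \<ge> 1" and t: "t \<ge> 2" "t \<le> K"
    and \<delta>: "0 < \<delta>" "\<delta> \<le> 1 / 2" "\<delta> * real (2 * R + 1) \<ge> 1"
    and M: "g ^ (K - 1) < M" "M \<le> g ^ K"
    and cong: "[k1 + k2 + k3 = M] (mod (g - 1))" and k: "k1 > 0" "k2 > 0" "k3 > 0"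
    and kC: "\<bar>real k1 - digit_mean g K\<bar> \<le> C" "\<bar>real k2 - digit_mean g K\<bar> \<le> C" "\<bar>real k3 - digit_mean g K\<bar> \<le> C"
    and R: "(g - 1) * Suc K + k1 \<le> R" "(g - 1) * Suc K + k2 \<le> R" "(g - 1) * Suc K + k3 \<le> R"
  defines "I \<equiv> {-int R..int R}" and "Q \<equiv> real (2 * R + 1)"
    and "\<nu> \<equiv> 2 * pi\<^sup>2 * digit_var g * real K"
  defines "S \<equiv> (\<lambda>h. \<Sum>b\<in>I. exp (- (\<nu> * (h * of_int b)\<^sup>2)))"
  shows "\<bar>2 / (real M)\<^sup>2 * real (rep3 (digit_set g K k1) (digit_set g K k2) (digit_set g K k3) M)
            - S (1 / Q) * S (1 / Q) * S (1 / ((real g - 1) * Q)) / Q ^ 3\<bar>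
         \<le> 27 * real g * \<delta> ^ 3 * (2 * (5 * real g / real g ^ t + 60 * real g * real (Suc t) * \<delta>
              + 100 * real g ^ 4 * (real K * \<delta> ^ 3)) + (20 * C + 26 * (real g)\<^sup>2) * (\<delta> * real t))
           + (3 * real g ^ 4 + 1) * exp (- (real K * \<delta>\<^sup>2 / (real g * (2 * (real g)\<^sup>2 + 2))))"
    (is "\<bar>2 / (real M)\<^sup>2 * real ?r - _\<bar> \<le> 27 * real g * \<delta> ^ 3 * ?E1 + ?E2")
proof -
  define p where "p = real g - 1"
  have g2: "g \<ge> 2" using g by simp
  have p: "p \<ge> 2" "p \<le> real g" using g by (auto simp: p_def)
  have Q: "Q \<ge> 1" "real R \<le> Q / 2" by (auto simp: Q_def)
  have Mpos: "real M > 0" using M(1) by simp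
  have C0: "C \<ge> 0" using kC(1) by linarith
  have \<nu>K: "\<nu> \<ge> real K"
  proof -
    have "3\<^sup>2 \<le> pi\<^sup>2" using pi_gt3 by (intro power_mono) auto
    hence "2 * 3\<^sup>2 * (1 / 4) \<le> 2 * pi\<^sup>2 * digit_var g"
      using digit_var_bounds(3)[OF g2] by (intro mult_mono) auto
    hence "1 * real K \<le> 2 * pi\<^sup>2 * digit_var g * real K" by (intro mult_right_mono) auto
    thus ?thesis by (simp add: \<nu>_def)
  qed
  have E1: "?E1 \<ge> 0" using \<delta> C0 by simp
  define V where "V = (\<lambda>(x, y, z). ee (- (of_int x / Q * real k1 + of_int y / Q * real k2 + of_int z / (p * Q) * real k3))
          * triple_sum g (of_int x / Q) (of_int y / Q) (of_int z / (p * Q)) (int M))"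
  define N where "N = (\<lambda>w. of_real (2 / (real M)\<^sup>2) * V w)"
  define H where "H = (\<lambda>(x, y, z). exp (- (\<nu> * ((of_int x / Q)\<^sup>2 + (of_int y / Q)\<^sup>2 + (of_int z / (p * Q))\<^sup>2))))"
  define A where "A = (\<lambda>y. {b \<in> I. \<bar>real_of_int b\<bar> \<le> y})"
  define Maj where "Maj = A (\<delta> * Q) \<times> A (\<delta> * Q) \<times> A (\<delta> * (p * Q))"
  have sumV: "(\<Sum>w\<in>I \<times> I \<times> I. V w) = of_real (Q ^ 3) * of_nat ?r"
    unfolding V_def I_def Q_def p_def by (rule rep3_digit_set_fourier[OF g2 M(2) k cong R, symmetric])
  have sumN: "(\<Sum>w\<in>I \<times> I \<times> I. N w) = of_real (Q ^ 3 * (2 / (real M)\<^sup>2 * real ?r))"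
    unfolding N_def sum_distrib_left[symmetric] sumV by simp
  have sumH: "(\<Sum>w\<in>I \<times> I \<times> I. H w) = S (1 / Q) * S (1 / Q) * S (1 / (p * Q))"
  proof -
    let ?h = "\<lambda>h b. exp (- (\<nu> * (h * of_int b)\<^sup>2))"
    have "(\<Sum>w\<in>I \<times> I \<times> I. H w) = (\<Sum>(x, y, z)\<in>I \<times> I \<times> I. ?h (1 / Q) x * ?h (1 / Q) y * ?h (1 / (p * Q)) z)"
      by (intro sum.cong refl) (auto simp: H_def distrib_left simp flip: exp_add)
    also have "\<dots> = (\<Sum>x\<in>I. \<Sum>y\<in>I. \<Sum>z\<in>I. ?h (1 / Q) x * ?h (1 / Q) y * ?h (1 / (p * Q)) z)"
      by (simp only: sum.cartesian_product)
    also have "\<dots> = S (1 / Q) * S (1 / Q) * S (1 / (p * Q))"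
      unfolding S_def
      by (simp only: sum_product)
         (simp only: sum_distrib_left sum_distrib_right, rule sum.cong[OF refl], rule sum.swap)
    finally show ?thesis .
  qed
  have key: "norm (N w - of_real (H w)) \<le> ?E1 * of_bool (w \<in> Maj) + ?E2" if w: "w \<in> I \<times> I \<times> I" for w
  proof -
    obtain x y z where xyz: "w = (x, y, z)" by (cases w)
    define a1 a2 a3 where "a1 = of_int x / Q" and "a2 = of_int y / Q" and "a3 = of_int z / (p * Q)"
    define T where "T = triple_sum g a1 a2 a3 (int M)"
    define \<theta> where "\<theta> = ee (- (a1 * real k1 + a2 * real k2 + a3 * real k3))"
    have Nw: "N w = of_real (2 / (real M)\<^sup>2) * (\<theta> * T)"
      by (simp add: N_def V_def xyz T_def \<theta>_def a1_def a2_def a3_def)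
    have Hw: "H w = exp (- (2 * pi\<^sup>2 * digit_var g * real K * (a1\<^sup>2 + a2\<^sup>2 + a3\<^sup>2)))"
      by (simp add: H_def xyz a1_def a2_def a3_def \<nu>_def)
    show ?thesis
    proof (cases "\<bar>a1\<bar> \<le> \<delta> \<and> \<bar>a2\<bar> \<le> \<delta> \<and> \<bar>a3\<bar> \<le> \<delta>")
      case True
      hence a: "\<bar>a1\<bar> \<le> \<delta>" "\<bar>a2\<bar> \<le> \<delta>" "\<bar>a3\<bar> \<le> \<delta>" by auto
      have "w \<in> Maj"
        using a w Q p by (auto simp: xyz Maj_def A_def a1_def a2_def a3_def abs_divide abs_mult pos_divide_le_eq)
      define e where "e = 5 * real g / real g ^ t + 60 * real g * real (Suc t) * \<delta> + 100 * real g ^ 4 * (real K * \<delta> ^ 3)"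
      define X where "X = step_char g a1 a2 a3 ^ (K - t)"
      have \<delta>1: "\<delta> \<le> 1" using \<delta> by simp
      have 1: "norm (T - X * of_real ((real M)\<^sup>2 / 2)) \<le> (real M)\<^sup>2 * e"
        unfolding T_def X_def e_def by (rule triple_sum_major[OF g2 a \<delta>1 t M])
      have 2: "norm (\<theta> * X - of_real (H w)) \<le> (20 * C + 26 * (real g)\<^sup>2) * (\<delta> * real t)"
        unfolding \<theta>_def X_def Hw using t by (intro step_char_power_approx g2 a \<delta>1 kC) auto
      have "N w - of_real (H w) = of_real (2 / (real M)\<^sup>2) * (\<theta> * (T - X * of_real ((real M)\<^sup>2 / 2)))
              + (\<theta> * X - of_real (H w))"
        using Mpos unfolding Nw by (simp add: field_simps)
      also have "norm \<dots> \<le> 2 / (real M)\<^sup>2 * ((real M)\<^sup>2 * e) + (20 * C + 26 * (real g)\<^sup>2) * (\<delta> * real t)"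
      proof (intro norm_triangle_le add_mono 2)
        have "norm (of_real (2 / (real M)\<^sup>2) * (\<theta> * (T - X * of_real ((real M)\<^sup>2 / 2))))
            = 2 / (real M)\<^sup>2 * norm (T - X * of_real ((real M)\<^sup>2 / 2))"
          by (simp only: norm_mult \<theta>_def norm_ee norm_of_real mult_1_left) simp
        also have "\<dots> \<le> 2 / (real M)\<^sup>2 * ((real M)\<^sup>2 * e)" by (intro mult_left_mono 1) simp
        finally show "norm (of_real (2 / (real M)\<^sup>2) * (\<theta> * (T - X * of_real ((real M)\<^sup>2 / 2)))) \<le> \<dots>" .
      qed
      also have "\<dots> = ?E1" using Mpos by (simp add: e_def)
      also have "\<dots> \<le> ?E1 * of_bool (w \<in> Maj) + ?E2" using \<open>w \<in> Maj\<close> by simp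
      finally show ?thesis .
    next
      case False
      have \<rho>: "\<delta>\<^sup>2 \<ge> 0" by simp
      let ?\<epsilon> = "exp (- (real K * \<delta>\<^sup>2 / (real g * (2 * (real g)\<^sup>2 + 2))))"
      have xb: "\<bar>real_of_int b / Q\<bar> \<le> 1 / 2" if "b \<in> I" for b
      proof -
        have "\<bar>real_of_int b\<bar> \<le> real R" using that by (auto simp: I_def abs_le_iff)
        thus ?thesis using Q by (simp add: abs_divide pos_divide_le_eq)
      qed
      have pa3: "(real g - 1) * a3 = of_int z / Q" using p by (simp add: a3_def p_def)
      have "sin2 ((real g - 1) * a3) \<ge> \<delta>\<^sup>2 \<or> sin2 (a1 - a3) \<ge> \<delta>\<^sup>2 \<or> sin2 (a2 - a3) \<ge> \<delta>\<^sup>2"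
      proof (rule sin2_minor[OF \<delta>(1,2) g2])
        show "\<bar>a1\<bar> \<le> 1 / 2" "\<bar>a2\<bar> \<le> 1 / 2" "\<bar>(real g - 1) * a3\<bar> \<le> 1 / 2"
          unfolding pa3 a1_def a2_def using w by (auto simp only: xyz mem_Times_iff fst_conv snd_conv intro!: xb)
      qed (use False in auto)
      hence "norm T \<le> 3 / 2 * ?\<epsilon> * (real (g ^ Suc K))\<^sup>2"
        unfolding T_def by (rule triple_sum_minor[OF g2 M(2) \<rho>])
      also have "\<dots> \<le> 3 / 2 * ?\<epsilon> * (real g ^ 4 * (real M)\<^sup>2)"
        by (intro mult_left_mono g_power_le_M g2 K M) simp
      finally have T: "norm T \<le> 3 / 2 * ?\<epsilon> * (real g ^ 4 * (real M)\<^sup>2)" .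
      have "norm (N w) = 2 / (real M)\<^sup>2 * norm T"
        unfolding Nw by (simp only: norm_mult \<theta>_def norm_ee norm_of_real mult_1_left) simp
      also have "\<dots> \<le> 2 / (real M)\<^sup>2 * (3 / 2 * ?\<epsilon> * (real g ^ 4 * (real M)\<^sup>2))"
        by (intro mult_left_mono T) simp
      also have "\<dots> = 3 * real g ^ 4 * ?\<epsilon>" using Mpos by (simp add: field_simps)
      finally have nN: "norm (N w) \<le> 3 * real g ^ 4 * ?\<epsilon>" .
      have nH: "H w \<le> ?\<epsilon>"
      proof -
        have sq: "\<delta>\<^sup>2 \<le> a1\<^sup>2 + a2\<^sup>2 + a3\<^sup>2"
        proof -
          have "\<delta>\<^sup>2 \<le> c\<^sup>2" if "\<not> \<bar>c\<bar> \<le> \<delta>" for c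
            using power_mono[of \<delta> "\<bar>c\<bar>" 2] that \<delta> by simp
          hence "\<delta>\<^sup>2 \<le> a1\<^sup>2 \<or> \<delta>\<^sup>2 \<le> a2\<^sup>2 \<or> \<delta>\<^sup>2 \<le> a3\<^sup>2" using False by blast
          moreover have "a1\<^sup>2 \<ge> 0" "a2\<^sup>2 \<ge> 0" "a3\<^sup>2 \<ge> 0" by auto
          ultimately show ?thesis by linarith
        qed
        have "real K * \<delta>\<^sup>2 / (real g * (2 * (real g)\<^sup>2 + 2)) \<le> real K * \<delta>\<^sup>2 / 1"
        proof (rule divide_left_mono)
          have "1 * 1 \<le> real g * (2 * (real g)\<^sup>2 + 2)" using g by (intro mult_mono) auto
          thus "1 \<le> real g * (2 * (real g)\<^sup>2 + 2)" by simp
          thus "0 < real g * (2 * (real g)\<^sup>2 + 2) * 1" by simp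
        qed auto
        also have "\<dots> \<le> \<nu> * (a1\<^sup>2 + a2\<^sup>2 + a3\<^sup>2)"
          using \<nu>K sq by (simp add: mult_mono)
        finally show ?thesis unfolding Hw \<nu>_def by simp
      qed
      have "norm (N w - of_real (H w)) \<le> norm (N w) + H w"
        using norm_triangle_ineq4[of "N w" "of_real (H w)"] by (simp add: Hw)
      also have "\<dots> \<le> 3 * real g ^ 4 * ?\<epsilon> + ?\<epsilon>" by (intro add_mono nN nH)
      also have "\<dots> = ?E2" by (simp add: distrib_right)
      also have "\<dots> \<le> ?E1 * of_bool (w \<in> Maj) + ?E2"
        using mult_nonneg_nonneg[OF E1, of "of_bool (w \<in> Maj)"] by simp
      finally show ?thesis .
    qed
  qed
  \<comment> \<open>The bound 2y + 1 \<le> 3y requires y \<ge> 1; this is the purpose of the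
    hypothesis that \<delta> Q is at least 1.\<close>
  have cardA: "real (card (A y)) \<le> 3 * y" if "y \<ge> 1" for y
    using card_int_abs_le[of y R] that unfolding A_def I_def by simp
  have finA: "finite (A y)" for y unfolding A_def I_def by (rule finite_Collect_conjI) simp
  have cardMaj: "real (card Maj) \<le> 27 * real g * \<delta> ^ 3 * Q ^ 3"
  proof -
    have dQ: "1 \<le> \<delta> * Q" using \<delta>(3) by (simp only: Q_def)
    have "\<delta> * Q * 1 \<le> \<delta> * Q * p" using p dQ by (intro mult_left_mono) auto
    hence dpQ: "1 \<le> \<delta> * (p * Q)" using dQ by (simp add: mult_ac)
    have "real (card Maj) = real (card (A (\<delta> * Q))) * (real (card (A (\<delta> * Q))) * real (card (A (\<delta> * (p * Q)))))"
      by (simp add: Maj_def card_cartesian_product)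
    also have "\<dots> \<le> (3 * (\<delta> * Q)) * ((3 * (\<delta> * Q)) * (3 * (\<delta> * (p * Q))))"
      using cardA dQ dpQ by (intro mult_mono) auto
    also have "\<dots> = p * (27 * \<delta> ^ 3 * Q ^ 3)" by (simp add: power3_eq_cube)
    also have "\<dots> \<le> real g * (27 * \<delta> ^ 3 * Q ^ 3)"
      using p \<delta> Q by (intro mult_right_mono) auto
    finally show ?thesis by (simp add: mult_ac)
  qed
  have cardI: "real (card (I \<times> I \<times> I)) = Q ^ 3"
  proof -
    have "real (card I) = Q" by (simp add: I_def Q_def)
    thus ?thesis by (simp only: card_cartesian_product of_nat_mult power3_eq_cube mult.assoc)
  qed
  have finI: "finite (I \<times> I \<times> I)" by (simp add: I_def)
  have sum_ind: "(\<Sum>w\<in>I \<times> I \<times> I. a * of_bool (w \<in> Maj) + b)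
      = a * real (card (I \<times> I \<times> I \<inter> Maj)) + Q ^ 3 * b" for a b :: real
  proof -
    have "(\<Sum>w\<in>I \<times> I \<times> I. of_bool (w \<in> Maj)) = real (card (I \<times> I \<times> I \<inter> Maj))"
      using finI by simp
    thus ?thesis by (simp only: sum.distrib sum_distrib_left[symmetric] sum_constant cardI)
  qed
  have "Q ^ 3 * (2 / (real M)\<^sup>2 * real ?r) - S (1 / Q) * S (1 / Q) * S (1 / (p * Q))
      = Q ^ 3 * (2 / (real M)\<^sup>2 * real ?r - S (1 / Q) * S (1 / Q) * S (1 / (p * Q)) / Q ^ 3)"
    using Q by (simp add: right_diff_distrib)
  hence "Q ^ 3 * \<bar>2 / (real M)\<^sup>2 * real ?r - S (1 / Q) * S (1 / Q) * S (1 / (p * Q)) / Q ^ 3\<bar>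
      = \<bar>Q ^ 3 * (2 / (real M)\<^sup>2 * real ?r) - S (1 / Q) * S (1 / Q) * S (1 / (p * Q))\<bar>"
    using Q by (simp add: abs_mult)
  also have "\<dots> = norm (\<Sum>w\<in>I \<times> I \<times> I. N w - of_real (H w))"
    unfolding sum_subtractf sumN of_real_sum[symmetric] sumH of_real_diff[symmetric] norm_of_real ..
  also have "\<dots> \<le> (\<Sum>w\<in>I \<times> I \<times> I. ?E1 * of_bool (w \<in> Maj) + ?E2)"
    by (rule sum_norm_le) (rule key)
  also have "\<dots> = ?E1 * real (card (I \<times> I \<times> I \<inter> Maj)) + Q ^ 3 * ?E2"
    by (rule sum_ind)
  also have "\<dots> \<le> ?E1 * (27 * real g * \<delta> ^ 3 * Q ^ 3) + Q ^ 3 * ?E2"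
  proof (intro add_right_mono mult_left_mono E1)
    have "card (I \<times> I \<times> I \<inter> Maj) \<le> card Maj"
      by (intro card_mono) (auto simp: Maj_def finA)
    thus "real (card (I \<times> I \<times> I \<inter> Maj)) \<le> 27 * real g * \<delta> ^ 3 * Q ^ 3"
      using cardMaj by linarith
  qed
  also have "\<dots> = Q ^ 3 * (27 * real g * \<delta> ^ 3 * ?E1 + ?E2)" by (simp add: algebra_simps)
  finally have *: "Q ^ 3 * \<bar>2 / (real M)\<^sup>2 * real ?r - S (1 / Q) * S (1 / Q) * S (1 / (p * Q)) / Q ^ 3\<bar>
      \<le> Q ^ 3 * (27 * real g * \<delta> ^ 3 * ?E1 + ?E2)" .
  have "Q ^ 3 > 0" using Q by simp
  from mult_left_le_imp_le[OF * this] show ?thesis by (simp only: p_def)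
qed

lemma abs_triple_product_diff_le:
  fixes a b p \<eta> d :: real
  assumes "\<bar>a - p\<bar> \<le> \<eta>" "\<bar>b - p\<bar> \<le> \<eta>" "\<bar>p\<bar> + \<eta> \<le> d"
  shows "\<bar>a * a * b - p ^ 3\<bar> \<le> 3 * \<eta> * d\<^sup>2"
proof -
  have \<eta>: "\<eta> \<ge> 0" using assms(1) by linarith
  have d: "\<bar>a\<bar> \<le> d" "\<bar>b\<bar> \<le> d" "\<bar>p\<bar> \<le> d" using assms \<eta> by linarith+
  have d0: "d \<ge> 0" using d(1) by linarith
  have "a * a * b - p ^ 3 = (a - p) * (a * b) + (a - p) * (p * b) + (b - p) * (p * p)"
    by (simp add: power3_eq_cube algebra_simps)
  also have "\<bar>\<dots>\<bar> \<le> \<bar>a - p\<bar> * (\<bar>a\<bar> * \<bar>b\<bar>) + \<bar>a - p\<bar> * (\<bar>p\<bar> * \<bar>b\<bar>) + \<bar>b - p\<bar> * (\<bar>p\<bar> * \<bar>p\<bar>)"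
    unfolding abs_mult[symmetric] by linarith
  also have "\<dots> \<le> \<eta> * (d * d) + \<eta> * (d * d) + \<eta> * (d * d)"
    using assms d d0 \<eta> by (intro add_mono mult_mono) auto
  finally show ?thesis by (simp add: power2_eq_square)
qed

text \<open>Each coordinate is a Riemann sum for a Gaussian integral with value sqrt(pi/\<nu>), the
  power -1/2 of 2 pi K \<open>digit_var g\<close>. The third step length is 1/((g-1) Q) while the
  normalisation is 1/Q, which leaves the factor g-1 in the main term. The constant is 1344 = 3 * 7 *
  8^2.\<close>

lemma gaussian_triple_product_approx:
  fixes R :: nat and g K :: nat
  assumes g: "g \<ge> 2" and K: "K \<ge> 1" "K \<le> R"
  defines "I \<equiv> {-int R..int R}" and "Q \<equiv> real (2 * R + 1)"
    and "\<nu> \<equiv> 2 * pi\<^sup>2 * digit_var g * real K"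
  defines "S \<equiv> (\<lambda>h. \<Sum>b\<in>I. exp (- (\<nu> * (h * of_int b)\<^sup>2)))"
  shows "\<bar>S (1 / Q) * S (1 / Q) * S (1 / ((real g - 1) * Q)) / Q ^ 3
           - (real g - 1) / ((2 * pi * digit_var g) powr (3 / 2) * real K powr (3 / 2))\<bar>
         \<le> 1344 * real g ^ 4 / (real K)\<^sup>2"
proof -
  define p where "p = real g - 1"
  define P where "P = sqrt (pi / \<nu>)"
  define v where "v = 2 * pi * digit_var g"
  have p: "p \<ge> 1" "p \<le> real g" using g by (auto simp: p_def)
  have Kr: "real K \<ge> 1" "real K \<le> Q" "real R \<ge> 1" "Q \<le> 3 * real R" "Q > 0" using K by (auto simp: Q_def)
  have v: "v \<ge> 1"
  proof -
    have "2 * 3 * (1 / 4) \<le> v"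
      unfolding v_def using pi_gt3 digit_var_bounds(3)[OF g] by (intro mult_mono) auto
    thus ?thesis by simp
  qed
  have \<nu>: "\<nu> = pi * (v * real K)" by (simp add: \<nu>_def v_def power2_eq_square)
  have vK: "v * real K \<ge> real K" using v Kr by (simp add: mult_le_cancel_right1)
  have \<nu>K: "\<nu> \<ge> real K"
  proof -
    have "1 * real K \<le> pi * (v * real K)" using vK pi_gt3 by (intro mult_mono) auto
    thus ?thesis by (simp add: \<nu>)
  qed
  have \<nu>0: "\<nu> > 0" using \<nu>K Kr by linarith
  have P2: "P = 1 / sqrt (v * real K)" by (simp add: P_def \<nu> real_sqrt_divide)
  have P3: "P ^ 3 = 1 / (v powr (3 / 2) * real K powr (3 / 2))"
  proof -
    have "P = (v * real K) powr (-1 / 2)"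
      unfolding P2 using v Kr by (simp add: powr_minus_divide powr_half_sqrt)
    hence "P ^ 3 = (v * real K) powr (- (3 / 2))"
      using v Kr by (simp add: powr_powr flip: powr_numeral)
    also have "\<dots> = 1 / (v * real K) powr (3 / 2)" by (rule powr_minus_divide)
    also have "(v * real K) powr (3 / 2) = v powr (3 / 2) * real K powr (3 / 2)"
      using v Kr by (simp add: powr_mult)
    finally show ?thesis .
  qed
  have Ple: "P \<le> 1 / sqrt (real K)"
    unfolding P2 using vK Kr by (intro divide_left_mono) auto
  have P0: "P \<ge> 0" unfolding P2 using v Kr by simp
  have coord: "\<bar>h * S h - P\<bar> \<le> 7 * real g / real K" if h: "h > 0" "h \<le> 1 / Q" "h \<ge> 1 / (real g * Q)" for h
  proof -
    have "\<bar>h * S h - P\<bar> \<le> h + 2 / (h * real R * \<nu>)"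
      unfolding S_def P_def I_def using \<nu>0 h K by (intro gaussian_sum_coordinate) auto
    \<comment> \<open>The step h is at most g/K; together with Q \<le> 3R and \<nu> \<ge> K its
      lower bound makes the truncation error at most 6 g/K.\<close>
    also have "\<dots> \<le> real g * (1 / real K) + 2 / (1 / (3 * real g) * real K)"
    proof (rule add_mono)
      have "1 * h \<le> real g * (1 / real K)"
        using h Kr g by (intro mult_mono order.trans[OF h(2)] divide_left_mono) auto
      thus "h \<le> real g * (1 / real K)" by simp
      have "1 / (3 * real g) = 1 / (real g * (3 * real R)) * real R" using Kr by simp
      also have "\<dots> \<le> 1 / (real g * Q) * real R"
        using Kr g by (intro mult_right_mono divide_left_mono mult_left_mono) auto
      also have "\<dots> \<le> h * real R" using h by (intro mult_right_mono) auto
      finally have "1 / (3 * real g) * real K \<le> h * real R * \<nu>"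
        using \<nu>K h by (intro mult_mono) auto
      thus "2 / (h * real R * \<nu>) \<le> 2 / (1 / (3 * real g) * real K)"
        using Kr g h \<nu>0 by (intro divide_left_mono mult_pos_pos) auto
    qed
    also have "\<dots> = 7 * real g / real K" using Kr g by (simp add: field_simps)
    finally show ?thesis .
  qed
  define a b where "a = 1 / Q * S (1 / Q)" and "b = 1 / (p * Q) * S (1 / (p * Q))"
  have coord': "\<bar>1 / (c * Q) * S (1 / (c * Q)) - P\<bar> \<le> 7 * real g / real K" if c: "1 \<le> c" "c \<le> real g" for c
  proof (rule coord)
    have cQ: "Q \<le> c * Q" "c * Q \<le> real g * Q" "c * Q > 0" using c Kr by auto
    show "1 / (c * Q) > 0" using cQ by simp
    show "1 / (c * Q) \<le> 1 / Q" using cQ Kr by (intro divide_left_mono) auto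
    show "1 / (real g * Q) \<le> 1 / (c * Q)" using cQ Kr c by (intro divide_left_mono) auto
  qed
  have ab: "\<bar>a - P\<bar> \<le> 7 * real g / real K" "\<bar>b - P\<bar> \<le> 7 * real g / real K"
    unfolding a_def b_def using coord'[of 1] coord'[of p] p g by simp_all
  have "real K \<ge> sqrt (real K)" using Kr by (simp add: real_sqrt_le_iff' sqrt_le_D real_le_lsqrt power2_eq_square)
  hence "7 * real g / real K \<le> 7 * real g / sqrt (real K)"
    using Kr by (intro divide_left_mono) auto
  moreover have "1 / sqrt (real K) \<le> real g / sqrt (real K)" using g by (intro divide_right_mono) auto
  ultimately have "\<bar>P\<bar> + 7 * real g / real K \<le> 8 * real g / sqrt (real K)"
    using Ple P0 by (simp add: add_divide_distrib[symmetric])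
  from abs_triple_product_diff_le[OF ab this]
  have "\<bar>a * a * b - P ^ 3\<bar> \<le> 3 * (7 * real g / real K) * (8 * real g / sqrt (real K))\<^sup>2" .
  also have "\<dots> = 1344 * real g ^ 3 / (real K)\<^sup>2"
    using Kr by (simp add: power_divide power_mult_distrib power2_eq_square power3_eq_cube)
  finally have *: "\<bar>a * a * b - P ^ 3\<bar> \<le> 1344 * real g ^ 3 / (real K)\<^sup>2" .
  have "S (1 / Q) * S (1 / Q) * S (1 / (p * Q)) / Q ^ 3 - p / (v powr (3 / 2) * real K powr (3 / 2))
      = p * (a * a * b - P ^ 3)"
    unfolding P3 a_def b_def using p Kr by (simp add: power3_eq_cube right_diff_distrib)
  hence "\<bar>S (1 / Q) * S (1 / Q) * S (1 / (p * Q)) / Q ^ 3 - p / (v powr (3 / 2) * real K powr (3 / 2))\<bar>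
      = p * \<bar>a * a * b - P ^ 3\<bar>" using p by (simp add: abs_mult)
  also have "\<dots> \<le> real g * (1344 * real g ^ 3 / (real K)\<^sup>2)"
    using p by (intro mult_mono *) auto
  also have "\<dots> = 1344 * real g ^ 4 / (real K)\<^sup>2" by (simp add: eval_nat_numeral)
  finally show ?thesis by (simp only: p_def v_def)
qed

text \<open>The main term has order K^(-3/2), so the relative error is of order K^(-1/4); division
  by k1 k2 k3, of order K^3, later turns K^(-7/4) into K^(-19/4).\<close>

lemma rep3_digit_set_asymp:
  assumes g: "g \<ge> 3"
  shows "\<exists>B \<ge> 0. eventually (\<lambda>K. \<forall>M k1 k2 k3 :: nat.
    g ^ (K - 1) < M \<and> M \<le> g ^ K \<and>
    \<bar>real k1 - digit_mean g K\<bar> \<le> real (C_const g) \<and>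
    \<bar>real k2 - digit_mean g K\<bar> \<le> real (C_const g) \<and>
    \<bar>real k3 - digit_mean g K\<bar> \<le> real (C_const g) \<and>
    [k1 + k2 + k3 = M] (mod (g - 1)) \<longrightarrow>
    \<bar>2 / (real M)\<^sup>2 * real (rep3 (digit_set g K k1) (digit_set g K k2) (digit_set g K k3) M)
       - (real g - 1) / ((2 * pi * digit_var g) powr (3 / 2) * real K powr (3 / 2))\<bar>
      \<le> B * real K powr (- 7 / 4)) sequentially"
    (is "\<exists>B \<ge> 0. eventually (?P B) sequentially")
proof (intro exI conjI)
  define C where "C = real (C_const g)"
  define G where "G = real g"
  define c where "c = 1 / (G * (2 * G\<^sup>2 + 2))"
  define B where "B = 27 * G * (2 * (5 * G + 240 * G + 100 * G ^ 4) + 3 * (20 * C + 26 * G\<^sup>2))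
                       + (3 * G ^ 4 + 1) + 1344 * G ^ 4"
  have G: "G \<ge> 3" using g by (simp add: G_def)
  have C: "C \<ge> 0" by (simp add: C_def)
  have c: "c > 0" using G by (simp add: c_def add_pos_pos)
  show "B \<ge> 0" using G C by (simp add: B_def)
  have ev1: "eventually (\<lambda>K. 2 powr (- (real K powr (1 / 24))) \<le> real K powr (- 7 / 4)) sequentially"
    by real_asymp
  have ev2: "eventually (\<lambda>K. exp (- (c * real K powr (1 / 12))) \<le> real K powr (- 7 / 4)) sequentially"
    using c by real_asymp
  have ev3: "eventually (\<lambda>K. 3 * real K powr (1 / 24) \<le> real K) sequentially" by real_asymp
  have ev4: "eventually (\<lambda>K. real K powr (- 11 / 24) \<le> 1 / 2) sequentially" by real_asymp
  show "eventually (?P B) sequentially"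
    using ev1 ev2 ev3 ev4 eventually_digit_sum_range[OF g] eventually_ge_at_top[of 1]
  proof eventually_elim
    case (elim K)
    define x where "x = real K"
    define y where "y = x powr (1 / 24)"
    \<comment> \<open>The box has to be wider than K^(-1/2), so that K \<delta>^2 = K^(1/12) still
      tends to infinity, and narrow enough for the accumulated cubic error: its volume \<delta>^3
      times K \<delta>^3 is exactly K^(-7/4). The errors \<delta>^3 * \<delta> t are of order
      K^(-43/24).\<close>
    define \<delta> where "\<delta> = x powr (- 11 / 24)"
    \<comment> \<open>About K^(1/24) top digits make g^(-t) smaller than any power of K while
      costing only this factor in the terms linear in \<delta>.\<close>
    define t where "t = nat \<lceil>y\<rceil> + 1"
    \<comment> \<open>(g-1)(K+1) \<le> 2 g K and k \<le> g K add up to 3 g K; being of order K, this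
      also keeps the frequency spacing 1/(2R+1) below \<delta>.\<close>
    define R where "R = 3 * g * K"
    define Z where "Z = x powr (- 7 / 4)"
    have x: "x \<ge> 1" using elim(6) by (simp add: x_def)
    have y: "y \<ge> 1" using x by (simp add: y_def ge_one_powr_ge_zero)
    have \<delta>: "0 < \<delta>" "\<delta> \<le> 1 / 2" using x elim(4) by (auto simp: \<delta>_def x_def)
    have t: "t \<ge> 2" "real t \<le> 3 * y" "real (Suc t) \<le> 4 * y" "y \<le> real t" using y unfolding t_def by linarith+
    have tK: "t \<le> K" using t(2) elim(3) by (simp add: y_def x_def)
    have Z0: "Z \<ge> 0" by (simp add: Z_def)
    have \<delta>4: "\<delta> ^ 4 * y \<le> Z"
    proof -
      have "\<delta> ^ 4 * y = x powr (- 43 / 24)"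
        using x by (simp add: \<delta>_def y_def powr_powr flip: powr_numeral powr_add)
      also have "\<dots> \<le> Z" unfolding Z_def using x by (intro powr_mono) auto
      finally show ?thesis .
    qed
    have \<delta>6: "x * \<delta> ^ 6 = Z"
    proof -
      have "x * \<delta> ^ 6 = x powr 1 * x powr (- 11 / 4)"
        using x by (simp add: \<delta>_def powr_powr flip: powr_numeral)
      also have "\<dots> = Z" unfolding Z_def powr_add[symmetric] by simp
      finally show ?thesis .
    qed
    have \<delta>2: "x * \<delta>\<^sup>2 = x powr (1 / 12)"
    proof -
      have "x * \<delta>\<^sup>2 = x powr 1 * x powr (- 11 / 12)"
        using x by (simp add: \<delta>_def powr_powr flip: powr_numeral)
      also have "\<dots> = x powr (1 / 12)" unfolding powr_add[symmetric] by simp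
      finally show ?thesis .
    qed
    have \<delta>1: "\<delta> ^ 3 \<le> 1" using \<delta> by (intro power_le_one) auto
    have gt: "1 / G ^ t \<le> Z"
    proof -
      have "2 powr y \<le> 2 powr real t" using t(4) by simp
      also have "\<dots> = 2 ^ t" by (simp add: powr_realpow)
      also have "\<dots> \<le> G ^ t" using G by (intro power_mono) auto
      finally have "1 / G ^ t \<le> 1 / 2 powr y" using G by (intro divide_left_mono) auto
      also have "\<dots> = 2 powr (- y)" by (simp add: powr_minus_divide)
      also have "\<dots> \<le> Z" using elim(1) by (simp add: y_def x_def Z_def)
      finally show ?thesis .
    qed
    have RQ: "\<delta> * real (2 * R + 1) \<ge> 1"
    proof -
      have "1 \<le> x powr (13 / 24)" using x by (simp add: ge_one_powr_ge_zero)
      also have "\<dots> = \<delta> * x powr 1" unfolding \<delta>_def powr_add[symmetric] by simp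
      also have "\<dots> = \<delta> * real K" using x by (simp add: x_def)
      also have "\<dots> \<le> \<delta> * real (2 * R + 1)"
      proof (rule mult_left_mono)
        have "1 * K \<le> g * K" using g by (intro mult_le_mono1) simp
        hence "K \<le> 2 * R + 1" unfolding R_def by linarith
        thus "real K \<le> real (2 * R + 1)" by (simp only: of_nat_le_iff)
      qed (use \<delta> in simp)
      finally show ?thesis .
    qed
    show ?case
    proof (intro allI impI, elim conjE)
      fix M k1 k2 k3 :: nat
      assume M: "g ^ (K - 1) < M" "M \<le> g ^ K"
        and kC: "\<bar>real k1 - digit_mean g K\<bar> \<le> real (C_const g)"
          "\<bar>real k2 - digit_mean g K\<bar> \<le> real (C_const g)"
          "\<bar>real k3 - digit_mean g K\<bar> \<le> real (C_const g)"
        and cong: "[k1 + k2 + k3 = M] (mod (g - 1))"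
      have k: "k1 > 0" "k2 > 0" "k3 > 0" and le: "k1 \<le> g * K" "k2 \<le> g * K" "k3 \<le> g * K"
        using elim(5)[rule_format, OF kC(1)] elim(5)[rule_format, OF kC(2)]
          elim(5)[rule_format, OF kC(3)] elim(6) by auto
      have Rk: "(g - 1) * Suc K + k \<le> R" if "k \<le> g * K" for k
      proof -
        have "(g - 1) * Suc K \<le> g * (2 * K)" using elim(6) by (intro mult_le_mono) auto
        thus ?thesis using that by (simp add: R_def)
      qed
      let ?r = "real (rep3 (digit_set g K k1) (digit_set g K k2) (digit_set g K k3) M)"
      define Q where "Q = real (2 * R + 1)"
      define S where "S = (\<lambda>h. \<Sum>b\<in>{-int R..int R}. exp (- (2 * pi\<^sup>2 * digit_var g * real K * (h * of_int b)\<^sup>2)))"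
      define Y where "Y = S (1 / Q) * S (1 / Q) * S (1 / ((G - 1) * Q)) / Q ^ 3"
      define X0 where "X0 = (G - 1) / ((2 * pi * digit_var g) powr (3 / 2) * x powr (3 / 2))"
      have g2: "g \<ge> 2" using g by simp
      have KR: "K \<le> R" using g by (simp add: R_def)
      have a1: "\<bar>2 / (real M)\<^sup>2 * ?r - Y\<bar>
          \<le> 27 * G * \<delta> ^ 3 * (2 * (5 * G / G ^ t + 60 * G * real (Suc t) * \<delta>
              + 100 * G ^ 4 * (x * \<delta> ^ 3)) + (20 * C + 26 * G\<^sup>2) * (\<delta> * real t))
           + (3 * G ^ 4 + 1) * exp (- (x * \<delta>\<^sup>2 / (G * (2 * G\<^sup>2 + 2))))"
        unfolding Y_def S_def Q_def G_def x_def C_def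
        by (rule rep3_digit_set_approx[OF g elim(6) t(1) tK \<delta> RQ M cong k kC Rk[OF le(1)] Rk[OF le(2)] Rk[OF le(3)]])
      have a2: "\<bar>Y - X0\<bar> \<le> 1344 * G ^ 4 / x\<^sup>2"
        unfolding Y_def S_def Q_def G_def x_def X0_def
        by (rule gaussian_triple_product_approx[OF g2 elim(6) KR])
      have b1: "27 * G * \<delta> ^ 3 * (2 * (5 * G / G ^ t + 60 * G * real (Suc t) * \<delta>
              + 100 * G ^ 4 * (x * \<delta> ^ 3)) + (20 * C + 26 * G\<^sup>2) * (\<delta> * real t))
          \<le> 27 * G * ((2 * (5 * G + 240 * G + 100 * G ^ 4) + 3 * (20 * C + 26 * G\<^sup>2)) * Z)"
      proof -
        have u1: "\<delta> ^ 3 * (1 / G ^ t) \<le> Z"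
          using mult_mono[OF \<delta>1 gt] \<delta> G by simp
        have u2: "\<delta> ^ 4 * real (Suc t) \<le> 4 * Z"
          using mult_left_mono[OF t(3), of "\<delta> ^ 4"] \<delta>4 by simp
        have u3: "\<delta> ^ 4 * real t \<le> 3 * Z"
          using mult_left_mono[OF t(2), of "\<delta> ^ 4"] \<delta>4 by simp
        have "27 * G * \<delta> ^ 3 * (2 * (5 * G / G ^ t + 60 * G * real (Suc t) * \<delta>
              + 100 * G ^ 4 * (x * \<delta> ^ 3)) + (20 * C + 26 * G\<^sup>2) * (\<delta> * real t))
            = 27 * G * (2 * (5 * G * (\<delta> ^ 3 * (1 / G ^ t)) + 60 * G * (\<delta> ^ 4 * real (Suc t))
              + 100 * G ^ 4 * (x * \<delta> ^ 6)) + (20 * C + 26 * G\<^sup>2) * (\<delta> ^ 4 * real t))"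
          by (simp add: eval_nat_numeral distrib_left mult_ac)
        also have "\<dots> \<le> 27 * G * (2 * (5 * G * Z + 60 * G * (4 * Z)
              + 100 * G ^ 4 * Z) + (20 * C + 26 * G\<^sup>2) * (3 * Z))"
          using G C u1 u2 u3 \<delta>6 by (intro mult_left_mono add_mono) auto
        also have "\<dots> = 27 * G * ((2 * (5 * G + 240 * G + 100 * G ^ 4) + 3 * (20 * C + 26 * G\<^sup>2)) * Z)"
          by (simp add: algebra_simps)
        finally show ?thesis .
      qed
      have b2: "(3 * G ^ 4 + 1) * exp (- (x * \<delta>\<^sup>2 / (G * (2 * G\<^sup>2 + 2)))) \<le> (3 * G ^ 4 + 1) * Z"
      proof (rule mult_left_mono)
        have "x * \<delta>\<^sup>2 / (G * (2 * G\<^sup>2 + 2)) = c * x powr (1 / 12)"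
          unfolding \<delta>2 by (simp add: c_def)
        thus "exp (- (x * \<delta>\<^sup>2 / (G * (2 * G\<^sup>2 + 2)))) \<le> Z"
          using elim(2) by (simp only: x_def Z_def)
      qed simp
      have b3: "1344 * G ^ 4 / x\<^sup>2 \<le> 1344 * G ^ 4 * Z"
      proof -
        have "1 / x\<^sup>2 = x powr (- 2)" using x by (simp add: powr_minus_divide)
        also have "\<dots> \<le> Z" unfolding Z_def using x by (intro powr_mono) auto
        finally have "1344 * G ^ 4 * (1 / x\<^sup>2) \<le> 1344 * G ^ 4 * Z" by (intro mult_left_mono) auto
        thus ?thesis by simp
      qed
      have "\<bar>2 / (real M)\<^sup>2 * ?r - X0\<bar> \<le> \<bar>2 / (real M)\<^sup>2 * ?r - Y\<bar> + \<bar>Y - X0\<bar>" by linarith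
      also have "\<dots> \<le> (27 * G * ((2 * (5 * G + 240 * G + 100 * G ^ 4) + 3 * (20 * C + 26 * G\<^sup>2)) * Z)
          + (3 * G ^ 4 + 1) * Z) + 1344 * G ^ 4 * Z"
        by (intro add_mono order.trans[OF a1] order.trans[OF a2] b1 b2 b3)
      also have "\<dots> = B * Z" by (simp add: B_def algebra_simps)
      finally show "\<bar>2 / (real M)\<^sup>2 * ?r
          - (real g - 1) / ((2 * pi * digit_var g) powr (3 / 2) * real K powr (3 / 2))\<bar> \<le> B * real K powr (- 7 / 4)"
        by (simp only: X0_def G_def x_def Z_def)
    qed
  qed
qed

section \<open>Replacing the digit sums by their mean, and the two estimates\<close>

lemma inverse_product_approx:
  fixes k1 k2 k3 m C L X :: real
  assumes "\<bar>k1 - m\<bar> \<le> C" "\<bar>k2 - m\<bar> \<le> C" "\<bar>k3 - m\<bar> \<le> C"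
    and "0 < L" "L \<le> k1" "L \<le> k2" "L \<le> k3" "L \<le> m"
    and "k1 \<le> X" "k2 \<le> X" "k3 \<le> X" "m \<le> X"
  shows "\<bar>1 / (k1 * k2 * k3) - 1 / m ^ 3\<bar> \<le> 3 * C * X\<^sup>2 / L ^ 6"
proof -
  have C0: "C \<ge> 0" using assms(1) by linarith
  have pos: "k1 > 0" "k2 > 0" "k3 > 0" "m > 0" "X > 0" using assms by linarith+
  have num: "\<bar>m ^ 3 - k1 * k2 * k3\<bar> \<le> 3 * C * X\<^sup>2"
  proof -
    \<comment> \<open>Telescoping: one factor m at a time is exchanged for a k, each exchange
      costing at most C. With X and L of order K the relative error is then of order 1/K.\<close>
    have "m ^ 3 - k1 * k2 * k3 = (m - k1) * (m * m) + (m - k2) * (k1 * m) + (m - k3) * (k1 * k2)"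
      by (simp add: power3_eq_cube algebra_simps)
    also have "\<bar>\<dots>\<bar> \<le> \<bar>m - k1\<bar> * (m * m) + \<bar>m - k2\<bar> * (k1 * m) + \<bar>m - k3\<bar> * (k1 * k2)"
      using pos abs_triangle_ineq[of "(m - k1) * (m * m) + (m - k2) * (k1 * m)" "(m - k3) * (k1 * k2)"]
        abs_triangle_ineq[of "(m - k1) * (m * m)" "(m - k2) * (k1 * m)"]
      by (simp add: abs_mult)
    also have "\<dots> \<le> C * (X * X) + C * (X * X) + C * (X * X)"
      using assms pos C0 by (intro add_mono mult_mono) (auto simp: abs_minus_commute)
    finally show ?thesis by (simp add: power2_eq_square)
  qed
  have den: "L ^ 6 \<le> k1 * k2 * k3 * m ^ 3"
  proof -
    have "L * L * L * (L * L * L) \<le> k1 * k2 * k3 * (m * m * m)"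
      using assms pos by (intro mult_mono) auto
    thus ?thesis by (simp add: eval_nat_numeral mult.assoc)
  qed
  have "1 / (k1 * k2 * k3) - 1 / m ^ 3 = (m ^ 3 - k1 * k2 * k3) / (k1 * k2 * k3 * m ^ 3)"
    using pos by (simp add: field_simps)
  hence "\<bar>1 / (k1 * k2 * k3) - 1 / m ^ 3\<bar> = \<bar>m ^ 3 - k1 * k2 * k3\<bar> / (k1 * k2 * k3 * m ^ 3)"
    using pos by (simp add: abs_mult)
  also have "\<dots> \<le> 3 * C * X\<^sup>2 / L ^ 6"
    using num den assms(4) C0 by (intro frac_le) auto
  finally show ?thesis .
qed

theorem theorem1p3:
  fixes g :: nat
  assumes "g \<ge> 3"
  shows "\<exists>(K0 :: nat) (A :: real) (B :: real). \<forall>K \<ge> K0. \<forall>M k1 k2 k3 :: nat.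
    g ^ (K - 1) < M \<and> M \<le> g ^ K \<and>
    \<bar>real k1 - digit_mean g K\<bar> \<le> real (C_const g) \<and>
    \<bar>real k2 - digit_mean g K\<bar> \<le> real (C_const g) \<and>
    \<bar>real k3 - digit_mean g K\<bar> \<le> real (C_const g) \<and>
    [k1 + k2 + k3 = M] (mod (g - 1)) \<and>
    gcd k1 g = 1 \<and> gcd k2 g = 1 \<and> gcd k3 g = 1 \<and>
    gcd k1 k2 = 1 \<and> gcd k1 k3 = 1 \<and> gcd k2 k3 = 1 \<longrightarrow>
    \<bar>real (rep3 (niven_set g K k1) (niven_set g K k2) (niven_set g K k3) M)
       - (real g - 1)\<^sup>2 * c_const g k1 k2 k3 / (4 * real k1 * real k2 * real k3)
         * real (rep3 (digit_set g K k1) (digit_set g K k2) (digit_set g K k3) M)\<bar>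
      \<le> A * ((real M)\<^sup>2 * real K powr (- 29 / 6)) \<and>
    \<bar>real (rep3 (niven_set g K k1) (niven_set g K k2) (niven_set g K k3) M)
       - c_const g k1 k2 k3
         * ((real M)\<^sup>2 / ((2 * pi * digit_var g) powr (3 / 2) * real K powr (9 / 2)))\<bar>
      \<le> B * ((real M)\<^sup>2 * ln (real K) ^ 4 * real K powr (- 19 / 4))"
proof -
  obtain A where A0: "A \<ge> 0" and A: "eventually (\<lambda>K. \<forall>M k1 k2 k3 :: nat.
    g ^ (K - 1) < M \<and> M \<le> g ^ K \<and>
    \<bar>real k1 - digit_mean g K\<bar> \<le> real (C_const g) \<and>
    \<bar>real k2 - digit_mean g K\<bar> \<le> real (C_const g) \<and>
    \<bar>real k3 - digit_mean g K\<bar> \<le> real (C_const g) \<and>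
    gcd k1 g = 1 \<and> gcd k2 g = 1 \<and> gcd k3 g = 1 \<and>
    gcd k1 k2 = 1 \<and> gcd k1 k3 = 1 \<and> gcd k2 k3 = 1 \<longrightarrow>
    \<bar>real (rep3 (niven_set g K k1) (niven_set g K k2) (niven_set g K k3) M)
       - real (gcd (g - 1) k1 * gcd (g - 1) k2 * gcd (g - 1) k3) / (real k1 * real k2 * real k3)
         * real (rep3 (digit_set g K k1) (digit_set g K k2) (digit_set g K k3) M)\<bar>
      \<le> A * ((real M)\<^sup>2 * real K powr (- 29 / 6))) sequentially"
    using rep3_niven_set_asymp[OF assms] by blast
  obtain B where B0: "B \<ge> 0" and B: "eventually (\<lambda>K. \<forall>M k1 k2 k3 :: nat.
    g ^ (K - 1) < M \<and> M \<le> g ^ K \<and>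
    \<bar>real k1 - digit_mean g K\<bar> \<le> real (C_const g) \<and>
    \<bar>real k2 - digit_mean g K\<bar> \<le> real (C_const g) \<and>
    \<bar>real k3 - digit_mean g K\<bar> \<le> real (C_const g) \<and>
    [k1 + k2 + k3 = M] (mod (g - 1)) \<longrightarrow>
    \<bar>2 / (real M)\<^sup>2 * real (rep3 (digit_set g K k1) (digit_set g K k2) (digit_set g K k3) M)
       - (real g - 1) / ((2 * pi * digit_var g) powr (3 / 2) * real K powr (3 / 2))\<bar>
      \<le> B * real K powr (- 7 / 4)) sequentially"
    using rep3_digit_set_asymp[OF assms] by blast
  define C where "C = real (C_const g)"
  define G where "G = real g"
  \<comment> \<open>A enters because K^(-29/6) \<le> K^(-19/4); the bracket is half of 8 B + 192 C
    G^3 below, the half coming from M^2/2.\<close>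
  define B' where "B' = A + G ^ 3 * (4 * B + 96 * C * G ^ 3)"
  have G: "G \<ge> 3" using assms by (simp add: G_def)
  have C0: "C \<ge> 0" by (simp add: C_def)
  have B'0: "B' \<ge> 0" using A0 B0 C0 G by (simp add: B'_def)
  have "eventually (\<lambda>K. \<forall>M k1 k2 k3 :: nat.
    g ^ (K - 1) < M \<and> M \<le> g ^ K \<and>
    \<bar>real k1 - digit_mean g K\<bar> \<le> real (C_const g) \<and>
    \<bar>real k2 - digit_mean g K\<bar> \<le> real (C_const g) \<and>
    \<bar>real k3 - digit_mean g K\<bar> \<le> real (C_const g) \<and>
    [k1 + k2 + k3 = M] (mod (g - 1)) \<and>
    gcd k1 g = 1 \<and> gcd k2 g = 1 \<and> gcd k3 g = 1 \<and>
    gcd k1 k2 = 1 \<and> gcd k1 k3 = 1 \<and> gcd k2 k3 = 1 \<longrightarrow>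
    \<bar>real (rep3 (niven_set g K k1) (niven_set g K k2) (niven_set g K k3) M)
       - (real g - 1)\<^sup>2 * c_const g k1 k2 k3 / (4 * real k1 * real k2 * real k3)
         * real (rep3 (digit_set g K k1) (digit_set g K k2) (digit_set g K k3) M)\<bar>
      \<le> A * ((real M)\<^sup>2 * real K powr (- 29 / 6)) \<and>
    \<bar>real (rep3 (niven_set g K k1) (niven_set g K k2) (niven_set g K k3) M)
       - c_const g k1 k2 k3
         * ((real M)\<^sup>2 / ((2 * pi * digit_var g) powr (3 / 2) * real K powr (9 / 2)))\<bar>
      \<le> B' * ((real M)\<^sup>2 * ln (real K) ^ 4 * real K powr (- 19 / 4))) sequentially"
    using A B eventually_digit_sum_range[OF assms] eventually_ge_at_top[of 3]
  proof eventually_elim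
    case (elim K)
    define x where "x = real K"
    define m where "m = digit_mean g K"
    define s where "s = (2 * pi * digit_var g) powr (3 / 2)"
    define X0 where "X0 = (G - 1) / (s * x powr (3 / 2))"
    have x: "x \<ge> 3" using elim(4) by (simp add: x_def)
    have m: "m = (G - 1) * x / 2" by (simp add: m_def digit_mean_def G_def x_def)
    have mb: "x / 2 \<le> m" "m \<le> G * x" "m > 0"
    proof -
      have "2 * x \<le> (G - 1) * x" using G x by (intro mult_right_mono) auto
      thus "x / 2 \<le> m" "m > 0" using x by (auto simp: m)
      have "(G - 1) * x \<le> (2 * G) * x" using G x by (intro mult_right_mono) auto
      thus "m \<le> G * x" by (simp add: m)
    qed
    have s: "s \<ge> 1"
    proof -
      have "2 * 3 * (1 / 4) \<le> 2 * pi * digit_var g"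
        using pi_gt3 digit_var_bounds(3)[of g] assms by (intro mult_mono) auto
      thus ?thesis unfolding s_def by (intro ge_one_powr_ge_zero) auto
    qed
    have X0: "0 \<le> X0" "X0 \<le> G * x powr (- (3 / 2))"
    proof -
      show "0 \<le> X0" using G s x by (simp add: X0_def)
      have "1 * x powr (3 / 2) \<le> s * x powr (3 / 2)" using s by (intro mult_right_mono) auto
      hence "X0 \<le> G / x powr (3 / 2)" unfolding X0_def using G x by (intro frac_le) auto
      thus "X0 \<le> G * x powr (- (3 / 2))" by (simp add: powr_minus_divide)
    qed
    \<comment> \<open>K \<ge> 3 > e makes the logarithm at least 1, so a bound by K^(-19/4) implies
      the one carrying the logarithmic factor.\<close>
    have log: "1 \<le> ln x ^ 4"
    proof -
      have "exp 1 \<le> x" using exp_le x by linarith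
      hence "ln (exp 1) \<le> ln x" using x by (subst ln_le_cancel_iff) auto
      thus ?thesis by (intro one_le_power) simp
    qed
    show ?case
    proof (intro allI impI, elim conjE)
      fix M k1 k2 k3 :: nat
      assume M: "g ^ (K - 1) < M" "M \<le> g ^ K"
        and kC: "\<bar>real k1 - digit_mean g K\<bar> \<le> real (C_const g)"
          "\<bar>real k2 - digit_mean g K\<bar> \<le> real (C_const g)"
          "\<bar>real k3 - digit_mean g K\<bar> \<le> real (C_const g)"
        and cong: "[k1 + k2 + k3 = M] (mod (g - 1))"
        and cop: "gcd k1 g = 1" "gcd k2 g = 1" "gcd k3 g = 1"
          "gcd k1 k2 = 1" "gcd k1 k3 = 1" "gcd k2 k3 = 1"
      define rN where "rN = real (rep3 (niven_set g K k1) (niven_set g K k2) (niven_set g K k3) M)"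
      define rS where "rS = real (rep3 (digit_set g K k1) (digit_set g K k2) (digit_set g K k3) M)"
      define D where "D = real (gcd (g - 1) k1 * gcd (g - 1) k2 * gcd (g - 1) k3)"
      define kk where "kk = real k1 * real k2 * real k3"
      define Y where "Y = (real M)\<^sup>2"
      have Y: "Y > 0" using M by (simp add: Y_def)
      have 1: "\<bar>rN - D / kk * rS\<bar> \<le> A * (Y * x powr (- 29 / 6))"
        unfolding rN_def rS_def D_def kk_def Y_def x_def
        by (rule elim(1)[rule_format]) (intro conjI M kC cop)
      have 2: "\<bar>2 / Y * rS - X0\<bar> \<le> B * x powr (- 7 / 4)"
        unfolding rS_def X0_def s_def Y_def x_def G_def
        by (rule elim(2)[rule_format]) (intro conjI M kC cong)
      have klo: "x / 2 \<le> real k1" "x / 2 \<le> real k2" "x / 2 \<le> real k3"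
        and khi: "k1 \<le> g * K" "k2 \<le> g * K" "k3 \<le> g * K"
        using elim(3)[rule_format, OF kC(1)] elim(3)[rule_format, OF kC(2)]
          elim(3)[rule_format, OF kC(3)] by (auto simp: x_def)
      have khi': "real k \<le> G * x" if "k \<le> g * K" for k
        using that unfolding G_def x_def of_nat_mult[symmetric] by (simp only: of_nat_le_iff)
      have kk: "x ^ 3 / 8 \<le> kk"
      proof -
        have "x / 2 * (x / 2) * (x / 2) \<le> kk" unfolding kk_def using klo x by (intro mult_mono) auto
        thus ?thesis by (simp add: power3_eq_cube)
      qed
      have kk0: "kk > 0"
      proof -
        have "x ^ 3 / 8 > 0" using x by simp
        thus ?thesis using kk by linarith
      qed
      have kkm: "\<bar>1 / kk - 1 / m ^ 3\<bar> \<le> 192 * C * G\<^sup>2 / x ^ 4"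
      proof -
        have "\<bar>1 / kk - 1 / m ^ 3\<bar> \<le> 3 * C * (G * x)\<^sup>2 / (x / 2) ^ 6"
          unfolding kk_def using x klo khi mb kC
          by (intro inverse_product_approx khi') (auto simp: m_def C_def)
        also have "\<dots> = 192 * C * G\<^sup>2 / x ^ 4"
          using x by (simp add: power_divide power_mult_distrib eval_nat_numeral)
        finally show ?thesis .
      qed
      have D: "0 \<le> D" "D \<le> G ^ 3"
      proof -
        show "0 \<le> D" by (simp add: D_def)
        have "gcd (g - 1) k \<le> g" for k
          using assms gcd_le1_nat[of "g - 1" k] by linarith
        hence "D \<le> real (g * g * g)"
          unfolding D_def by (intro of_nat_mono mult_le_mono)
        thus "D \<le> G ^ 3" by (simp add: G_def power3_eq_cube)
      qed
      have pre: "(real g - 1)\<^sup>2 * c_const g k1 k2 k3 / (4 * real k1 * real k2 * real k3) = D / kk"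
        using assms by (simp add: c_const_def D_def kk_def)
      \<comment> \<open>\<open>X0\<close> carries a factor g-1 and m^3 = ((g-1) K/2)^3; together
        with M^2/2 they combine to 4/(g-1)^2, the constant in \<open>c_const\<close>.\<close>
      have main: "c_const g k1 k2 k3 * ((real M)\<^sup>2 / ((2 * pi * digit_var g) powr (3 / 2) * real K powr (9 / 2)))
          = D * (Y / 2) * (X0 * (1 / m ^ 3))"
      proof -
        have "x powr (9 / 2) = x powr (3 / 2) * x ^ 3"
        proof -
          have "x powr (9 / 2) = x powr (3 / 2 + 3)" by simp
          also have "\<dots> = x powr (3 / 2) * x powr 3" by (rule powr_add)
          finally show ?thesis using x by simp
        qed
        hence "c_const g k1 k2 k3 * ((real M)\<^sup>2 / ((2 * pi * digit_var g) powr (3 / 2) * real K powr (9 / 2)))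
            = 4 / (G - 1)\<^sup>2 * D * (Y / (s * (x powr (3 / 2) * x ^ 3)))"
          by (simp add: c_const_def G_def D_def Y_def s_def x_def)
        also have "\<dots> = D * (Y / 2) * (X0 * (1 / m ^ 3))"
          using G s x unfolding X0_def m
          by (simp add: divide_simps) (simp add: power2_eq_square power3_eq_cube)
        finally show ?thesis .
      qed
      have 3: "\<bar>D / kk * rS - D * (Y / 2) * (X0 * (1 / m ^ 3))\<bar> \<le> G ^ 3 * (4 * B + 96 * C * G ^ 3) * (Y * x powr (- 19 / 4))"
      proof -
        define X where "X = 2 / Y * rS"
        have rS: "rS = Y / 2 * X" using Y by (simp add: X_def)
        \<comment> \<open>Two replacements: the normalised count by \<open>X0\<close>, with error
          K^(-7/4) * K^(-3) = K^(-19/4), and 1/(k1 k2 k3) by 1/m^3, with the smaller error K^(-3/2)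
          * K^(-4) = K^(-11/2).\<close>
        have "D / kk * rS - D * (Y / 2) * (X0 * (1 / m ^ 3))
            = D * (Y / 2) * ((X - X0) * (1 / kk) + X0 * (1 / kk - 1 / m ^ 3))"
          unfolding rS divide_inverse by (simp add: algebra_simps)
        also have "\<bar>\<dots>\<bar> = D * (Y / 2) * \<bar>(X - X0) * (1 / kk) + X0 * (1 / kk - 1 / m ^ 3)\<bar>"
          using D Y by (simp only: abs_mult)
        also have "\<dots> \<le> G ^ 3 * (Y / 2) * ((8 * B + 192 * C * G ^ 3) * x powr (- 19 / 4))"
        proof (intro mult_mono D)
          have "\<bar>(X - X0) * (1 / kk) + X0 * (1 / kk - 1 / m ^ 3)\<bar>
              \<le> \<bar>X - X0\<bar> * (1 / kk) + X0 * \<bar>1 / kk - 1 / m ^ 3\<bar>"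
            using abs_triangle_ineq[of "(X - X0) * (1 / kk)" "X0 * (1 / kk - 1 / m ^ 3)"] kk0 X0
            by (simp only: abs_mult) simp
          also have "\<dots> \<le> (B * x powr (- 7 / 4)) * (8 / x ^ 3) + G * x powr (- (3 / 2)) * (192 * C * G\<^sup>2 / x ^ 4)"
          proof (intro add_mono mult_mono X0 kkm)
            show "\<bar>X - X0\<bar> \<le> B * x powr (- 7 / 4)" unfolding X_def by (rule 2)
            have "1 / kk \<le> 1 / (x ^ 3 / 8)" using kk x kk0 by (intro divide_left_mono) auto
            thus "1 / kk \<le> 8 / x ^ 3" by simp
          qed (use B0 G kk0 in auto)
          also have "(B * x powr (- 7 / 4)) * (8 / x ^ 3) = 8 * B * x powr (- 19 / 4)"
          proof -
            have "x powr (- 7 / 4) * (1 / x ^ 3) = x powr (- 7 / 4) * x powr (- 3)"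
              using x by (simp add: powr_minus_divide)
            also have "\<dots> = x powr (- 19 / 4)" unfolding powr_add[symmetric] by simp
            finally have e: "x powr (- 7 / 4) * (1 / x ^ 3) = x powr (- 19 / 4)" .
            have "(B * x powr (- 7 / 4)) * (8 / x ^ 3) = 8 * B * (x powr (- 7 / 4) * (1 / x ^ 3))" by simp
            thus ?thesis unfolding e .
          qed
          also have "G * x powr (- (3 / 2)) * (192 * C * G\<^sup>2 / x ^ 4) \<le> 192 * C * G ^ 3 * x powr (- 19 / 4)"
          proof -
            have "x powr (- (3 / 2)) * (1 / x ^ 4) = x powr (- (3 / 2)) * x powr (- 4)"
              using x by (simp add: powr_minus_divide)
            also have "\<dots> = x powr (- 11 / 2)" unfolding powr_add[symmetric] by simp
            also have "\<dots> \<le> x powr (- 19 / 4)" using x by (intro powr_mono) auto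
            finally have "192 * C * G ^ 3 * (x powr (- (3 / 2)) * (1 / x ^ 4)) \<le> 192 * C * G ^ 3 * x powr (- 19 / 4)"
              using C0 G by (intro mult_left_mono) auto
            thus ?thesis by (simp add: power2_eq_square power3_eq_cube mult_ac)
          qed
          finally show "\<bar>(X - X0) * (1 / kk) + X0 * (1 / kk - 1 / m ^ 3)\<bar>
              \<le> (8 * B + 192 * C * G ^ 3) * x powr (- 19 / 4)"
            by (simp add: distrib_right)
        qed (use Y G B0 C0 in auto)
        finally show ?thesis by (simp add: algebra_simps)
      qed
      have "\<bar>rN - D * (Y / 2) * (X0 * (1 / m ^ 3))\<bar>
          \<le> A * (Y * x powr (- 29 / 6)) + G ^ 3 * (4 * B + 96 * C * G ^ 3) * (Y * x powr (- 19 / 4))"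
        using 1 3 by linarith
      also have "\<dots> \<le> A * (Y * x powr (- 19 / 4)) + G ^ 3 * (4 * B + 96 * C * G ^ 3) * (Y * x powr (- 19 / 4))"
        using A0 Y x by (intro add_right_mono mult_left_mono powr_mono) auto
      also have "\<dots> = B' * (Y * 1 * x powr (- 19 / 4))" by (simp add: B'_def algebra_simps)
      also have "\<dots> \<le> B' * (Y * ln x ^ 4 * x powr (- 19 / 4))"
        using B'0 Y log by (intro mult_left_mono mult_right_mono) auto
      finally have 4: "\<bar>rN - D * (Y / 2) * (X0 * (1 / m ^ 3))\<bar> \<le> B' * (Y * ln x ^ 4 * x powr (- 19 / 4))" .
      show "\<bar>real (rep3 (niven_set g K k1) (niven_set g K k2) (niven_set g K k3) M)
       - (real g - 1)\<^sup>2 * c_const g k1 k2 k3 / (4 * real k1 * real k2 * real k3)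
         * real (rep3 (digit_set g K k1) (digit_set g K k2) (digit_set g K k3) M)\<bar>
      \<le> A * ((real M)\<^sup>2 * real K powr (- 29 / 6)) \<and>
    \<bar>real (rep3 (niven_set g K k1) (niven_set g K k2) (niven_set g K k3) M)
       - c_const g k1 k2 k3
         * ((real M)\<^sup>2 / ((2 * pi * digit_var g) powr (3 / 2) * real K powr (9 / 2)))\<bar>
      \<le> B' * ((real M)\<^sup>2 * ln (real K) ^ 4 * real K powr (- 19 / 4))"
        using 1 4 unfolding pre main by (simp only: rN_def rS_def Y_def x_def)
    qed
  qed
  thus ?thesis unfolding eventually_sequentially by blast
qed

end
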